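(* For any complexity class $\mathsf{B}$, $\mathsf{P/poly^B}=\mathsf{P^{Un(P^B)}}$.
   Context: $\mathsf{Un(D)}$ denotes the set of unary languages (all elements of the form $1^m$) in class $\mathsf{D}$; $\mathsf{X^Y}=\bigcup_{L\in\mathsf{Y}}\mathsf{X}^L$. $\#$ is a separator symbol. (Bounded advice) A language $L$ is in $\mathsf{C/poly^B}$ if there is a sequence of advice strings $\{a_n\}_{n\in\mathbb N}$ such that (i) there is a deterministic polynomial-time Turing machine $T$ with oracle access to a language in $\mathsf{B}$ which on input $1^n$ halts in $\mathrm{poly}(n)$ time with $a_n$ as the final content of its tape, and (ii) the language $\{x\#a_{|x|}: x\in L\}$ is in $\mathsf{C}$.
   Formalization: Condition (ii) is read as: some language L' in C satisfies x∈L iff x#a_|x| ∈ L'. Requiring the set {x#a_|x| : x∈L} itself to be in C makes the claim false, e.g. for B={U}, L=U with U an undecidable unary language. *)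

theory Defs
  imports Main
begin

text \<open>Input/output alphabet: 0, 1 and the separator symbol #.\<close>
datatype sym = S0 | S1 | SH

fun enc :: "sym \<Rightarrow> nat" where
  "enc S0 = 1" | "enc S1 = 2" | "enc SH = 3"

definition dec :: "nat \<Rightarrow> sym" where
  "dec c = (if c = 1 then S0 else if c = 2 then S1 else SH)"

text \<open>Tapes are one-way infinite: cells indexed by nat, tape symbols are nat,
  0 is the blank, 1,2,3 encode S0,S1,SH.  The word written on a tape is the
  maximal block of input symbols starting at cell 0.\<close>
definition read_word :: "(nat \<Rightarrow> nat) \<Rightarrow> sym list" where
  "read_word t = map (\<lambda>i. dec (t i)) [0..<(LEAST n. t n \<notin> {1,2,3})]"

datatype dir = Lft | Rgt | Stay

text \<open>A machine with a work tape (which initially holds the input and at the end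
  holds the output) and an oracle query tape.\<close>
record otm =
  nstates :: nat
  nsyms :: nat
  delta :: "nat \<Rightarrow> nat \<Rightarrow> nat \<Rightarrow> nat \<times> nat \<times> dir \<times> nat \<times> dir"
  q_start :: nat
  q_acc :: nat
  q_rej :: nat
  q_query :: nat
  q_yes :: nat
  q_no :: nat

definition wf_otm :: "otm \<Rightarrow> bool" where
  "wf_otm M \<longleftrightarrow> nsyms M \<ge> 4 \<and>
     q_start M < nstates M \<and> q_acc M < nstates M \<and> q_rej M < nstates M \<and>
     q_query M < nstates M \<and> q_yes M < nstates M \<and> q_no M < nstates M \<and>
     q_acc M \<noteq> q_rej M \<and> q_query M \<noteq> q_acc M \<and> q_query M \<noteq> q_rej M \<and>
     (\<forall>q < nstates M. \<forall>a < nsyms M. \<forall>b < nsyms M.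
        (case delta M q a b of (q', a', d1, b', d2) \<Rightarrow>
           q' < nstates M \<and> a' < nsyms M \<and> b' < nsyms M))"

record config =
  cstate :: nat
  tp1 :: "nat \<Rightarrow> nat"
  hd1 :: nat
  tp2 :: "nat \<Rightarrow> nat"
  hd2 :: nat

fun move :: "dir \<Rightarrow> nat \<Rightarrow> nat" where
  "move Lft h = h - 1" | "move Rgt h = h + 1" | "move Stay h = h"

definition halting :: "otm \<Rightarrow> config \<Rightarrow> bool" where
  "halting M c \<longleftrightarrow> cstate c = q_acc M \<or> cstate c = q_rej M"

definition step :: "otm \<Rightarrow> sym list set \<Rightarrow> config \<Rightarrow> config" where
  "step M Or c =
    (if halting M c then c
     else if cstate c = q_query M then
       c\<lparr>cstate := (if read_word (tp2 c) \<in> Or then q_yes M else q_no M),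
         tp2 := (\<lambda>_. 0), hd2 := 0\<rparr>
     else (case delta M (cstate c) (tp1 c (hd1 c)) (tp2 c (hd2 c)) of
       (q', a, d1, b, d2) \<Rightarrow>
         c\<lparr>cstate := q', tp1 := (tp1 c)(hd1 c := a), hd1 := move d1 (hd1 c),
           tp2 := (tp2 c)(hd2 c := b), hd2 := move d2 (hd2 c)\<rparr>))"

definition init :: "otm \<Rightarrow> sym list \<Rightarrow> config" where
  "init M x = \<lparr>cstate = q_start M,
      tp1 = (\<lambda>i. if i < length x then enc (x ! i) else 0), hd1 = 0,
      tp2 = (\<lambda>_. 0), hd2 = 0\<rparr>"

definition run :: "otm \<Rightarrow> sym list set \<Rightarrow> sym list \<Rightarrow> nat \<Rightarrow> config" where
  "run M Or x n = (step M Or ^^ n) (init M x)"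

definition pbound :: "nat \<Rightarrow> nat \<Rightarrow> nat \<Rightarrow> nat" where
  "pbound k c n = c * n ^ k + c"

type_synonym lang = "sym list set"

definition P_orc :: "lang \<Rightarrow> lang set" where
  "P_orc Or = {L. \<exists>M k c. wf_otm M \<and>
      (\<forall>x. halting M (run M Or x (pbound k c (length x)))) \<and>
      (\<forall>x. x \<in> L \<longleftrightarrow> cstate (run M Or x (pbound k c (length x))) = q_acc M)}"

definition P_rel :: "lang set \<Rightarrow> lang set" where
  "P_rel Y = (\<Union>Or\<in>Y. P_orc Or)"

definition Pc :: "lang set" where
  "Pc = P_orc {}"

definition unary :: "nat \<Rightarrow> sym list" where
  "unary m = replicate m S1"

definition Unary_part :: "lang set \<Rightarrow> lang set" where
  "Unary_part D = {L \<in> D. L \<subseteq> range unary}"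

definition adv_poly :: "lang set \<Rightarrow> lang set \<Rightarrow> lang set" where
  "adv_poly C B = {L. \<exists>a :: nat \<Rightarrow> sym list.
      (\<exists>Or\<in>B. \<exists>T k c. wf_otm T \<and>
         (\<forall>n. halting T (run T Or (unary n) (pbound k c n)) \<and>
              read_word (tp1 (run T Or (unary n) (pbound k c n))) = a n)) \<and>
      (\<exists>L'\<in>C. \<forall>x. x \<in> L \<longleftrightarrow> x @ [SH] @ a (length x) \<in> L')}"

end

theory Submission
  imports Defs "HOL-Library.Nat_Bijection"
begin

text \<open>Given an advice machine \<open>T\<close>, the graph of \<open>(n, i) \<mapsto> a\<^sub>n ! i\<close> is coded as a unary language by the
  Cantor pairing function; querying it reconstructs \<open>a\<^sub>n\<close> symbol by symbol.  Conversely, a machine with a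
  unary oracle \<open>U\<close> and running time \<open>p\<close> asks only about \<open>1\<^sup>m\<close> with \<open>m < p(n)\<close>, so the table of \<open>U\<close> up to
  \<open>p(n)\<close> is enough advice.  A polynomial-time machine must halt even on a word whose table part is wrong, so the
  length of the table also serves as the clock of the simulation.

  The machines are written in a small while language that runs on the two tapes of an oracle machine
  and is compiled to it; the control states of the compiled machine are the continuations of the program.\<close>

section \<open>A while language for oracle machines\<close>

text \<open>A query yields one bit, whereas an advice symbol takes three values and the length of
  the advice is unknown. The code therefore includes a guess \<open>d\<close> for the symbol,
  \<open>m = 3 * prod_encode (i, n) + d\<close>, and three negative answers at position
  \<open>i\<close> tell that the advice ends there. As \<open>m\<close> is given in unary, the
  pairing has to grow polynomially; Cantor's is quadratic. All arithmetic is unary too, done by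
  pointers on the tape: instead of computing a code, the programs walk along the enumeration of
  pairs, which meets the positions of each fixed advice string in increasing order.

  In the converse direction \<open>x\<close> may itself contain the separator, but a table never
  does, so the last separator is the right one. The length of the table has the form
  \<open>d * (n + 1) ^ e\<close> because a fixed program can iterate the multiplication by
  \<open>n + 1\<close>.

  The query tape of a simulated machine is the real query tape. A query can thus be passed on,
  looked up in the table, or answered negatively by the same simulation.\<close>

declare split_paired_All [simp del] split_paired_Ex [simp del]

text \<open>A cell of the first tape holds one number per track.  A register \<open>(q, f, s)\<close> consists of a state of a
  simulated machine, a flag and one auxiliary digit.\<close>

type_synonym cell = "nat \<Rightarrow> nat"
type_synonym reg = "nat \<times> nat \<times> nat"

datatype com =
  Act "reg \<Rightarrow> cell \<Rightarrow> nat \<Rightarrow> reg \<times> cell \<times> dir \<times> nat \<times> dir"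
| Qry "reg \<Rightarrow> bool \<Rightarrow> reg"
| Seq com com  (infixr \<open>;;\<close> 60)
| Cond "reg \<Rightarrow> cell \<Rightarrow> bool" com com
| Whl "reg \<Rightarrow> cell \<Rightarrow> bool" com

datatype st = St (st_reg: reg) (st_tape: "nat \<Rightarrow> cell") nat "nat \<Rightarrow> nat" nat

text \<open>The number is the exact step count of the compiled machine: one step to unfold a
  \<open>Seq\<close>, \<open>Cond\<close> or \<open>Whl\<close>, and three for a query, which stores
  the continuation, asks, and resumes.\<close>

inductive exec :: "lang \<Rightarrow> com \<Rightarrow> st \<Rightarrow> nat \<Rightarrow> st \<Rightarrow> bool" for Or where
  Act: "f r (t h) (u k) = (r', a, d, b, e) \<Longrightarrow>
    exec Or (Act f) (St r t h u k) 1 (St r' (t(h := a)) (move d h) (u(k := b)) (move e k))"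
| Qry: "exec Or (Qry f) (St r t h u k) 3 (St (f r (read_word u \<in> Or)) t h (\<lambda>_. 0) 0)"
| Seq: "exec Or c s m s' \<Longrightarrow> exec Or d s' n s'' \<Longrightarrow> exec Or (c ;; d) s (Suc (m + n)) s''"
| CondT: "b r (t h) \<Longrightarrow> exec Or c (St r t h u k) n s' \<Longrightarrow>
    exec Or (Cond b c d) (St r t h u k) (Suc n) s'"
| CondF: "\<not> b r (t h) \<Longrightarrow> exec Or d (St r t h u k) n s' \<Longrightarrow>
    exec Or (Cond b c d) (St r t h u k) (Suc n) s'"
| WhlT: "b r (t h) \<Longrightarrow> exec Or c (St r t h u k) m s' \<Longrightarrow> exec Or (Whl b c) s' n s'' \<Longrightarrow>
    exec Or (Whl b c) (St r t h u k) (Suc (m + n)) s''"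
| WhlF: "\<not> b r (t h) \<Longrightarrow> exec Or (Whl b c) (St r t h u k) 1 (St r t h u k)"

definition valid_reg :: "nat \<Rightarrow> reg \<Rightarrow> bool" where
  "valid_reg R r \<longleftrightarrow> fst r < R \<and> fst (snd r) < R \<and> snd (snd r) < R"

text \<open>One number bounds the entries and the number of tracks in use. Vanishing beyond track
  \<open>R\<close> leaves only finitely many cells, so that they can be numbered as tape
  symbols.\<close>

definition valid_cell :: "nat \<Rightarrow> cell \<Rightarrow> bool" where
  "valid_cell R a \<longleftrightarrow> (\<forall>k. a k < R) \<and> (\<forall>k\<ge>R. a k = 0)"

fun wfc :: "nat \<Rightarrow> com \<Rightarrow> bool" where
  "wfc R (Act f) \<longleftrightarrow> (\<forall>r a b. valid_reg R r \<longrightarrow> valid_cell R a \<longrightarrow> b < R \<longrightarrow>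
     (case f r a b of (r', a', d, b', e) \<Rightarrow> valid_reg R r' \<and> valid_cell R a' \<and> b' < R))"
| "wfc R (Qry f) \<longleftrightarrow> (\<forall>r v. valid_reg R r \<longrightarrow> valid_reg R (f r v))"
| "wfc R (c ;; d) \<longleftrightarrow> wfc R c \<and> wfc R d"
| "wfc R (Cond b c d) \<longleftrightarrow> wfc R c \<and> wfc R d"
| "wfc R (Whl b c) \<longleftrightarrow> wfc R c"

fun valid_st :: "nat \<Rightarrow> st \<Rightarrow> bool" where
  "valid_st R (St r t h u k) \<longleftrightarrow> valid_reg R r \<and> (\<forall>i. valid_cell R (t i)) \<and> (\<forall>i. u i < R)"

lemma wfc_ActD:
  assumes "wfc R (Act f)" "valid_reg R r" "valid_cell R a" "b < R" "f r a b = (r', a', d, b', e)"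
  shows "valid_reg R r'" "valid_cell R a'" "b' < R"
proof -
  have "case f r a b of (r', a', d, b', e) \<Rightarrow> valid_reg R r' \<and> valid_cell R a' \<and> b' < R"
    using assms(1)[unfolded wfc.simps, rule_format, OF assms(2-4)] .
  then show "valid_reg R r'" "valid_cell R a'" "b' < R" using assms(5) by simp_all
qed

lemma exec_valid: "exec Or c s n s' \<Longrightarrow> wfc R c \<Longrightarrow> valid_st R s \<Longrightarrow> valid_st R s'"
proof (induction rule: exec.induct)
  case (Act f r t h u k r' a d b e)
  have "valid_reg R r" "valid_cell R (t h)" "u k < R" using Act.prems(2) by simp_all
  from wfc_ActD[of R f r "t h" "u k" r' a d b e, OF Act.prems(1) this Act.hyps] Act.prems(2)
  show ?case by simp
next
  case (Qry f r t h u k)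
  have "u 0 < R" using Qry.prems(2) by simp
  then have "0 < R" by simp
  moreover have "valid_reg R (f r (read_word u \<in> Or))" using Qry.prems by simp
  ultimately show ?case using Qry.prems(2) by simp
qed simp_all

text \<open>The continuation stacks that can occur while \<open>c\<close> runs on top of \<open>K\<close>; these sets being finite is what
  makes the control of the compiled machine finite.\<close>

fun conts :: "com \<Rightarrow> com list \<Rightarrow> com list set" where
  "conts (c ;; d) K = insert ((c ;; d) # K) (conts c (d # K) \<union> conts d K)"
| "conts (Cond b c d) K = insert (Cond b c d # K) (conts c K \<union> conts d K)"
| "conts (Whl b c) K = insert (Whl b c # K) (conts c (Whl b c # K))"
| "conts c K = {c # K}"

lemma conts_self: "c # K \<in> conts c K"
  by (cases c) auto

lemma finite_conts: "finite (conts c K)"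
  by (induction c K rule: conts.induct) auto

text \<open>After a query the machine is in one of two fixed states.  The pending continuation and register are
  therefore stored in the cell under the first head, which a query leaves alone (\<open>Mk\<close>).\<close>

datatype mstate = Run "com list" reg | MQ | MY | MN | MAcc | MRej
datatype msym = Pl cell | Mk cell "com list" reg

fun acc_reg :: "reg \<Rightarrow> bool" where
  "acc_reg (q, f, s) \<longleftrightarrow> f = 1"

definition mtrans :: "mstate \<Rightarrow> msym \<Rightarrow> nat \<Rightarrow> mstate \<times> msym \<times> dir \<times> nat \<times> dir" where
  "mtrans q y b = (case (q, y) of
     (Run [] r, Pl a) \<Rightarrow> (if acc_reg r then MAcc else MRej, Pl a, Stay, b, Stay)
   | (Run (c # K) r, Pl a) \<Rightarrow> (case c of
        Act f \<Rightarrow> (case f r a b of (r', a', z) \<Rightarrow> (Run K r', Pl a', z))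
      | Qry f \<Rightarrow> (MQ, Mk a (c # K) r, Stay, b, Stay)
      | c1 ;; c2 \<Rightarrow> (Run (c1 # c2 # K) r, Pl a, Stay, b, Stay)
      | Cond p c1 c2 \<Rightarrow> (Run ((if p r a then c1 else c2) # K) r, Pl a, Stay, b, Stay)
      | Whl p c1 \<Rightarrow> (Run (if p r a then c1 # c # K else K) r, Pl a, Stay, b, Stay))
   | (MY, Mk a (Qry f # K) r) \<Rightarrow> (Run K (f r True), Pl a, Stay, b, Stay)
   | (MN, Mk a (Qry f # K) r) \<Rightarrow> (Run K (f r False), Pl a, Stay, b, Stay)
   | _ \<Rightarrow> (MRej, y, Stay, b, Stay))"

lemma mtrans_simps [simp]:
  "mtrans (Run (Act g # K) r) (Pl a) b =
     (case g r a b of (r', a', z) \<Rightarrow> (Run K r', Pl a', z))"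
  "mtrans (Run (Qry f # K) r) (Pl a) b = (MQ, Mk a (Qry f # K) r, Stay, b, Stay)"
  "mtrans (Run ((c ;; d) # K) r) (Pl a) b = (Run (c # d # K) r, Pl a, Stay, b, Stay)"
  "mtrans (Run (Cond p c d # K) r) (Pl a) b =
     (Run ((if p r a then c else d) # K) r, Pl a, Stay, b, Stay)"
  "mtrans (Run (Whl p c # K) r) (Pl a) b =
     (Run (if p r a then c # Whl p c # K else K) r, Pl a, Stay, b, Stay)"
  "mtrans (Run [] r) (Pl a) b = (if acc_reg r then MAcc else MRej, Pl a, Stay, b, Stay)"
  "mtrans MY (Mk a (Qry f # K) r) b = (Run K (f r True), Pl a, Stay, b, Stay)"
  "mtrans MN (Mk a (Qry f # K) r) b = (Run K (f r False), Pl a, Stay, b, Stay)"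
  by (simp_all add: mtrans_def)

text \<open>The cell that plays the role of the plain symbol \<open>i\<close>: input and output
  consist of such cells, and the numbering of symbols will send \<open>Pl (raw i)\<close> to
  \<open>i\<close> itself for \<open>i < 4\<close>.\<close>

definition raw :: "nat \<Rightarrow> cell" where
  "raw i = (\<lambda>_. 0)(0 := i)"

lemma raw_inj [simp]: "raw i = raw j \<longleftrightarrow> i = j"
  by (auto simp: raw_def fun_eq_iff)

section \<open>Numbering symbols and states, and correctness of the compiled machine\<close>

lemma finite_valid_reg: "finite {r. valid_reg R r}"
  by (rule finite_subset[of _ "{..<R} \<times> {..<R} \<times> {..<R}"]) (auto simp: valid_reg_def)

lemma finite_valid_cell: "finite {a. valid_cell R a}"
proof (rule finite_subset)
  show "{a. valid_cell R a} \<subseteq> {a. \<forall>k. (k \<in> {..<R} \<longrightarrow> a k \<in> {..<R}) \<and> (k \<notin> {..<R} \<longrightarrow> a k = 0)}"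
    by (auto simp: valid_cell_def)
qed (rule finite_set_of_finite_funs; simp)

text \<open>\<open>es\<close> and \<open>eq\<close> are arbitrary numberings, except that
  \<open>es_raw\<close> fixes the codes of the blank and the three input symbols, since
  \<open>init\<close> and \<open>read_word\<close> prescribe them. The second tape is not encoded at
  all, so that the machine asks literally the word that the program wrote; \<open>R \<le> NS\<close>
  makes its contents legal symbols.\<close>

locale compiled =
  fixes c0 :: com and R :: nat and es :: "msym \<Rightarrow> nat" and eq :: "mstate \<Rightarrow> nat" and NS NQ :: nat
  fixes KS Syms States
  assumes wf: "wfc R c0" and R4: "R \<ge> 4"
  defines "KS \<equiv> insert [] (conts c0 [])"
  defines "Syms \<equiv> {Pl a |a. valid_cell R a} \<union> {Mk a K r |a K r. valid_cell R a \<and> K \<in> KS \<and> valid_reg R r}"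
  defines "States \<equiv> {Run K r |K r. K \<in> KS \<and> valid_reg R r} \<union> {MQ, MY, MN, MAcc, MRej}"
  assumes es_inj: "inj_on es Syms" and es_le: "\<And>a. a \<in> Syms \<Longrightarrow> es a < NS"
    and NS: "R \<le> NS" and es_raw: "\<And>i. i < 4 \<Longrightarrow> es (Pl (raw i)) = i"
    and eq_inj: "inj_on eq States" and eq_le: "\<And>q. q \<in> States \<Longrightarrow> eq q < NQ"
begin

text \<open>\<open>wf_otm\<close> quantifies over all numbers below \<open>NQ\<close> and
  \<open>NS\<close>, including those that code nothing, where \<open>inv_into\<close> is arbitrary.
  The guard makes the closure condition hold there as well.\<close>

definition dlt :: "nat \<Rightarrow> nat \<Rightarrow> nat \<Rightarrow> nat \<times> nat \<times> dir \<times> nat \<times> dir" where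
  "dlt q a b =
    (case mtrans (inv_into States eq q) (inv_into Syms es a) b of (q', a', d, b', e) \<Rightarrow>
       if q' \<in> States \<and> a' \<in> Syms \<and> b' < R then (eq q', es a', d, b', e)
       else (eq MRej, 0, Stay, 0, Stay))"

definition M :: otm where
  "M = \<lparr>nstates = NQ, nsyms = NS, delta = dlt, q_start = eq (Run [c0] (0, 0, 0)),
     q_acc = eq MAcc, q_rej = eq MRej, q_query = eq MQ, q_yes = eq MY, q_no = eq MN\<rparr>"

definition conc :: "mstate \<Rightarrow> (nat \<Rightarrow> msym) \<Rightarrow> nat \<Rightarrow> (nat \<Rightarrow> nat) \<Rightarrow> nat \<Rightarrow> config" where
  "conc q t h u k = \<lparr>cstate = eq q, tp1 = es \<circ> t, hd1 = h, tp2 = u, hd2 = k\<rparr>"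

lemma States_simps [simp]:
  "Run K r \<in> States \<longleftrightarrow> K \<in> KS \<and> valid_reg R r"
  "MQ \<in> States" "MY \<in> States" "MN \<in> States" "MAcc \<in> States" "MRej \<in> States"
  by (auto simp: States_def)

lemma Syms_simps [simp]:
  "Pl a \<in> Syms \<longleftrightarrow> valid_cell R a" "Mk a K r \<in> Syms \<longleftrightarrow> valid_cell R a \<and> K \<in> KS \<and> valid_reg R r"
  by (auto simp: Syms_def)

lemma eq_iff: "p \<in> States \<Longrightarrow> q \<in> States \<Longrightarrow> eq p = eq q \<longleftrightarrow> p = q"
  using eq_inj by (auto dest: inj_onD)

lemma start_in: "[c0] \<in> KS" "[] \<in> KS"
  by (auto simp: KS_def conts_self)

lemma wf_M: "wf_otm M"
proof -
  have "case dlt q a b of (q', a', d, b', e) \<Rightarrow> q' < NQ \<and> a' < NS \<and> b' < NS" for q a b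
  proof -
    obtain q' a' d b' e where
      "mtrans (inv_into States eq q) (inv_into Syms es a) b = (q', a', d, b', e)"
      by (metis prod_cases5)
    then show ?thesis using R4 NS eq_le[of q'] es_le[of a'] eq_le[of MRej] by (simp add: dlt_def)
  qed
  moreover have "eq MAcc \<noteq> eq MRej" "eq MQ \<noteq> eq MAcc" "eq MQ \<noteq> eq MRej"
    by (simp_all add: eq_iff)
  moreover have "eq (Run [c0] (0, 0, 0)) < NQ"
    using R4 start_in by (intro eq_le) (simp add: valid_reg_def)
  ultimately show ?thesis
    using R4 NS by (simp add: wf_otm_def M_def eq_le)
qed

lemma step_conc:
  assumes "q \<in> States" "t h \<in> Syms" "q \<notin> {MAcc, MRej, MQ}"
    and "mtrans q (t h) (u k) = (q', a, d, b, e)" "q' \<in> States" "a \<in> Syms" "b < R"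
  shows "step M Or (conc q t h u k) = conc q' (t(h := a)) (move d h) (u(k := b)) (move e k)"
proof -
  have "eq q \<noteq> eq MAcc" "eq q \<noteq> eq MRej" "eq q \<noteq> eq MQ"
    using assms by (auto simp: eq_iff)
  moreover have "dlt (eq q) (es (t h)) (u k) = (eq q', es a, d, b, e)"
    using assms es_inj eq_inj by (simp add: dlt_def)
  ultimately show ?thesis
    by (auto simp: step_def halting_def M_def conc_def fun_eq_iff)
qed

lemma step_query:
  "step M Or (conc MQ t h u k) = conc (if read_word u \<in> Or then MY else MN) t h (\<lambda>_. 0) 0"
  using eq_iff by (auto simp: step_def halting_def M_def conc_def)

fun crun :: "com list \<Rightarrow> st \<Rightarrow> config" where
  "crun K (St r t h u k) = conc (Run K r) (Pl \<circ> t) h u k"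

lemma step_crun:
  assumes "valid_st R (St r t h u k)" "K \<in> KS" "K' \<in> KS"
    and "mtrans (Run K r) (Pl (t h)) (u k) = (Run K' r', Pl a, d, b, e)" "valid_reg R r'" "valid_cell R a" "b < R"
  shows "step M Or (crun K (St r t h u k)) =
    crun K' (St r' (t(h := a)) (move d h) (u(k := b)) (move e k))"
proof -
  have "Pl \<circ> t(h := a) = (Pl \<circ> t)(h := Pl a)" by auto
  then show ?thesis
    using step_conc[of "Run K r" "Pl \<circ> t" h u k "Run K' r'" "Pl a" d b e Or] assms by simp
qed

lemma step_crun_stay:
  assumes "valid_st R (St r t h u k)" "K \<in> KS" "K' \<in> KS"
    and "mtrans (Run K r) (Pl (t h)) (u k) = (Run K' r, Pl (t h), Stay, u k, Stay)"
  shows "step M Or (crun K (St r t h u k)) = crun K' (St r t h u k)"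
  using step_crun[OF assms(1-4)] assms(1) by simp

lemma funpow_add': "(f ^^ (m + n)) x = (f ^^ n) ((f ^^ m) x)"
  by (subst add.commute) (simp add: funpow_add)

lemma funpow_Suc': "(f ^^ Suc n) x = (f ^^ n) (f x)"
  by (simp add: funpow_swap1)

text \<open>The stack \<open>K\<close> is general because the parts of a \<open>Seq\<close> or
  \<open>Whl\<close> run on a longer stack than the whole. \<open>conts c K \<subseteq> KS\<close>
  passes to exactly the stacks under which these parts are run.\<close>

lemma exec_steps:
  "exec Or c s n s' \<Longrightarrow> wfc R c \<Longrightarrow> valid_st R s \<Longrightarrow> conts c K \<subseteq> KS \<Longrightarrow> K \<in> KS \<Longrightarrow>
    (step M Or ^^ n) (crun (c # K) s) = crun K s'"
proof (induction arbitrary: K rule: exec.induct)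
  case (Act f r t h u k r' a d b e)
  then show ?case
    using wfc_ActD[of R f r "t h" "u k" r' a d b e, OF Act.prems(1)] conts_self
    by (auto simp del: crun.simps wfc.simps intro!: step_crun)
next
  case (Qry f r t h u k)
  let ?K = "Qry f # K" and ?v = "read_word u \<in> Or"
  \<comment> \<open>The three steps of a query: the pending work is parked under the first head, the
    oracle answers and clears the second tape, and the parked stack is taken up with the
    answer.\<close>
  have 1: "step M Or (crun ?K (St r t h u k)) = conc MQ ((Pl \<circ> t)(h := Mk (t h) ?K r)) h u k"
    using Qry step_conc[of "Run ?K r" "Pl \<circ> t" h u k MQ "Mk (t h) ?K r" Stay "u k" Stay Or] by simp
  have 2: "step M Or (step M Or (crun ?K (St r t h u k))) =
    conc (if ?v then MY else MN) ((Pl \<circ> t)(h := Mk (t h) ?K r)) h (\<lambda>_. 0) 0"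
    unfolding 1 step_query ..
  have 3: "step M Or (conc (if ?v then MY else MN) ((Pl \<circ> t)(h := Mk (t h) ?K r)) h (\<lambda>_. 0) 0) =
    conc (Run K (f r ?v)) (Pl \<circ> t) h (\<lambda>_. 0) 0"
  proof -
    have "(Pl \<circ> t)(h := Pl (t h)) = Pl \<circ> t" "(\<lambda>_. 0 :: nat)(0 :: nat := 0) = (\<lambda>_. 0)" by auto
    then show ?thesis
      using Qry R4 step_conc[of "if ?v then MY else MN" "(Pl \<circ> t)(h := Mk (t h) ?K r)" h "\<lambda>_. 0" 0
          "Run K (f r ?v)" "Pl (t h)" Stay 0 Stay Or]
      by simp
  qed
  show ?case using 2 3 by (simp add: numeral_3_eq_3)
next
  case (Seq c s m s' d n s'')
  obtain r t h u k where s: "s = St r t h u k" by (cases s)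
  have "valid_st R s'" using exec_valid Seq by auto
  moreover have "d # K \<in> KS" using Seq.prems conts_self by auto
  moreover have "c # d # K \<in> KS" using Seq.prems conts_self by auto
  ultimately have "step M Or (crun ((c ;; d) # K) s) = crun (c # d # K) s"
    using Seq.prems unfolding s by (intro step_crun_stay) auto
  then show ?case using Seq \<open>valid_st R s'\<close> \<open>d # K \<in> KS\<close>
    by (simp add: funpow_Suc' funpow_add' del: funpow.simps)
next
  case (CondT b r t h c u k n s' d)
  have "c # K \<in> KS" using CondT.prems conts_self by auto
  then have "step M Or (crun (Cond b c d # K) (St r t h u k)) = crun (c # K) (St r t h u k)"
    using CondT by (intro step_crun_stay) auto
  then show ?case using CondT by (simp add: funpow_Suc' del: funpow.simps crun.simps)
next
  case (CondF b r t h d u k n s' c)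
  have "d # K \<in> KS" using CondF.prems conts_self by auto
  then have "step M Or (crun (Cond b c d # K) (St r t h u k)) = crun (d # K) (St r t h u k)"
    using CondF by (intro step_crun_stay) auto
  then show ?case using CondF by (simp add: funpow_Suc' del: funpow.simps crun.simps)
next
  case (WhlT b r t h c u k m s' n s'')
  have v: "valid_st R s'" using exec_valid WhlT by auto
  have "c # Whl b c # K \<in> KS" "Whl b c # K \<in> KS" using WhlT.prems conts_self by auto
  moreover from this have "step M Or (crun (Whl b c # K) (St r t h u k)) = crun (c # Whl b c # K) (St r t h u k)"
    using WhlT by (intro step_crun_stay) auto
  ultimately show ?case using WhlT v
    by (simp add: funpow_Suc' funpow_add' del: funpow.simps crun.simps)
next
  case (WhlF b r t h c u k)
  then show ?case by (auto simp del: crun.simps intro!: step_crun_stay)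
qed

lemma valid_st_init: "valid_st R (St (0,0,0) (\<lambda>i. raw (if i < length x then enc (x ! i) else 0)) 0 (\<lambda>_. 0) 0)"
proof -
  have "enc y < R" for y using R4 by (cases y) auto
  then show ?thesis using R4 by (auto simp: valid_reg_def valid_cell_def raw_def)
qed

text \<open>The extra step is the transition from the empty stack into a halting state. Knowing
  which cells hold the symbols below 4 is all that \<open>read_word\<close> can detect of the
  output.\<close>

lemma run_M:
  assumes "exec Or c0 (St (0,0,0) (\<lambda>i. raw (if i < length x then enc (x ! i) else 0)) 0 (\<lambda>_. 0) 0) n s'"
  shows "halting M (run M Or x (Suc n))" 
    and "cstate (run M Or x (Suc n)) = q_acc M \<longleftrightarrow> acc_reg (st_reg s')"
    and "\<And>i j. j < 4 \<Longrightarrow> tp1 (run M Or x (Suc n)) i = j \<longleftrightarrow> st_tape s' i = raw j"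
proof -
  let ?s = "St (0,0,0) (\<lambda>i. raw (if i < length x then enc (x ! i) else 0)) 0 (\<lambda>_. 0) 0"
  have e4: "enc y < 4" for y by (cases y) auto
  have "init M x = crun [c0] ?s"
    using e4 by (auto simp: init_def conc_def M_def fun_eq_iff es_raw)
  then have *: "run M Or x n = crun [] s'"
    using exec_steps[OF assms wf valid_st_init, of "[]"] by (auto simp: run_def KS_def)
  obtain r t h u k where s': "s' = St r t h u k" by (cases s')
  have v: "valid_st R s'" using exec_valid[OF assms wf valid_st_init] .
  have **: "run M Or x (Suc n) = conc (if acc_reg r then MAcc else MRej) (Pl \<circ> t) h u k"
    using * v step_conc[of "Run [] r" "Pl \<circ> t" h u k "if acc_reg r then MAcc else MRej" "Pl (t h)" Stay "u k" Stay Or] start_in(2)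
    by (auto simp: run_def s' fun_upd_idem)
  show "halting M (run M Or x (Suc n))"
    unfolding ** by (auto simp: halting_def conc_def M_def)
  show "cstate (run M Or x (Suc n)) = q_acc M \<longleftrightarrow> acc_reg (st_reg s')"
    unfolding ** using eq_iff by (auto simp: s' conc_def M_def)
  fix i j :: nat assume j: "j < 4"
  then have "valid_cell R (raw j)" "valid_cell R (t i)" using R4 v by (auto simp: valid_cell_def raw_def s')
  then have "es (Pl (t i)) = es (Pl (raw j)) \<longleftrightarrow> t i = raw j"
    using es_inj by (auto dest: inj_onD)
  then show "tp1 (run M Or x (Suc n)) i = j \<longleftrightarrow> st_tape s' i = raw j"
    unfolding ** using es_raw[OF j] by (auto simp: s' conc_def)
qed

end

definition ini :: "sym list \<Rightarrow> st" where
  "ini x = St (0,0,0) (\<lambda>i. raw (if i < length x then enc (x ! i) else 0)) 0 (\<lambda>_. 0) 0"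

lemma finite_code:
  assumes "finite A"
  obtains g :: "'a \<Rightarrow> nat" where "inj_on g A" "\<And>x. x \<in> A \<Longrightarrow> g x < card A"
proof -
  obtain h where h: "bij_betw h A {0..<card A}"
    using ex_bij_betw_finite_nat[OF assms] by blast
  show thesis
    by (rule that[OF bij_betw_imp_inj_on[OF h]]) (use bij_betwE[OF h] in simp)
qed

text \<open>The machine is chosen before the oracle and the input: the control depends on the
  program alone.\<close>

lemma compile:
  assumes "wfc R c" "R \<ge> 4"
  shows "\<exists>M. wf_otm M \<and> (\<forall>Or x n s. exec Or c (ini x) n s \<longrightarrow> halting M (run M Or x (Suc n)) \<and>
      (cstate (run M Or x (Suc n)) = q_acc M \<longleftrightarrow> acc_reg (st_reg s)) \<and>
      (\<forall>i. \<forall>j<4. tp1 (run M Or x (Suc n)) i = j \<longleftrightarrow> st_tape s i = raw j))"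
proof -
  let ?KS = "insert [] (conts c [])"
  let ?Syms = "{Pl a |a. valid_cell R a} \<union> {Mk a K r |a K r. valid_cell R a \<and> K \<in> ?KS \<and> valid_reg R r}"
  let ?States = "{Run K r |K r. K \<in> ?KS \<and> valid_reg R r} \<union> {MQ, MY, MN, MAcc, MRej}"
  have "{Mk a K r |a K r. valid_cell R a \<and> K \<in> ?KS \<and> valid_reg R r} =
    (\<lambda>(a, K, r). Mk a K r) ` ({a. valid_cell R a} \<times> ?KS \<times> {r. valid_reg R r})"
    by (intro set_eqI iffI; clarsimp simp del: split_paired_All split_paired_Ex simp: image_iff) blast+
  then have fs: "finite ?Syms"
    using finite_valid_cell finite_valid_reg finite_conts by (auto simp: Setcompr_eq_image)
  have "{Run K r |K r. K \<in> ?KS \<and> valid_reg R r} = (\<lambda>(K, r). Run K r) ` (?KS \<times> {r. valid_reg R r})"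
    by (intro set_eqI iffI; clarsimp simp: image_iff) blast+
  then have fq: "finite ?States"
    using finite_valid_reg finite_conts by auto
  obtain g :: "msym \<Rightarrow> nat" where g: "inj_on g ?Syms" "\<And>y. y \<in> ?Syms \<Longrightarrow> g y < card ?Syms"
    using finite_code[OF fs] by blast
  obtain eq :: "mstate \<Rightarrow> nat" where eq: "inj_on eq ?States" "\<And>q. q \<in> ?States \<Longrightarrow> eq q < card ?States"
    using finite_code[OF fq] by blast
  define es where "es y = (if \<exists>i<4. y = Pl (raw i) then (THE i. y = Pl (raw i)) else g y + 4)" for y
  have raw: "es (Pl (raw i)) = i" if "i < 4" for i using that by (auto simp: es_def)
  have big: "es y = g y + 4" if "\<not> (\<exists>i<4. y = Pl (raw i))" for y
    unfolding es_def using that by (rule if_not_P)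
  have es4: "y = Pl (raw (es y))" if "es y < 4" for y
  proof (cases "\<exists>i<4. y = Pl (raw i)")
    case True then show ?thesis using raw by auto
  next
    case False then show ?thesis using that big[of y] by simp
  qed
  have inj: "inj_on es ?Syms"
  proof (rule inj_onI)
    fix y z assume yz: "y \<in> ?Syms" "z \<in> ?Syms" and e: "es y = es z"
    show "y = z"
    proof (cases "es y < 4")
      case True
      then have "y = Pl (raw (es y))" "z = Pl (raw (es z))" using e es4[of y] es4[of z] by simp_all
      then show ?thesis using e by metis
    next
      case False
      then have "es y = g y + 4" "es z = g z + 4" using raw e by (metis big)+
      then show ?thesis using e yz g(1) by (auto dest: inj_onD)
    qed
  qed
  \<comment> \<open>The summand 4 makes room for the reserved codes of \<open>raw 0\<close> to
    \<open>raw 3\<close>; \<open>R\<close> is added because the unencoded second tape requires at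
    least \<open>R\<close> symbols.\<close>
  have le: "es a < card ?Syms + 4 + R" if "a \<in> ?Syms" for a
  proof (cases "\<exists>i<4. a = Pl (raw i)")
    case True then show ?thesis using raw by auto
  next
    case False then show ?thesis using g(2)[OF that] big[of a] by simp
  qed
  interpret compiled c R es eq "card ?Syms + 4 + R" "card ?States" ?KS ?Syms ?States
    by (unfold_locales; (rule assms raw inj le eq le_add2 | assumption)+)
  show ?thesis
    using wf_M run_M unfolding ini_def by blast
qed

section \<open>Pointers and loops\<close>

text \<open>From here on only upper bounds are tracked: exact step counts depend on the data, while
  bounds in terms of a space parameter compose.\<close>

definition execs :: "lang \<Rightarrow> com \<Rightarrow> st \<Rightarrow> nat \<Rightarrow> st \<Rightarrow> bool" where
  "execs Or c s N s' \<longleftrightarrow> (\<exists>n\<le>N. exec Or c s n s')"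

lemma execs_mono: "execs Or c s M s' \<Longrightarrow> M \<le> N \<Longrightarrow> execs Or c s N s'"
  unfolding execs_def by (meson le_trans)

lemma execs_Seq: "execs Or c s m s' \<Longrightarrow> execs Or d s' n s'' \<Longrightarrow> execs Or (c ;; d) s (m + n + 1) s''"
proof -
  assume "execs Or c s m s'" "execs Or d s' n s''"
  then obtain a b where "a \<le> m" "exec Or c s a s'" "b \<le> n" "exec Or d s' b s''"
    unfolding execs_def by auto
  then have "Suc (a + b) \<le> m + n + 1 \<and> exec Or (c ;; d) s (Suc (a + b)) s''"
    by (simp add: exec.Seq)
  then show ?thesis unfolding execs_def by (rule exI)
qed

text \<open>In place of an invariant, the states at the loop test are given as an explicit sequence
  \<open>\<sigma>\<close>. Every loop below is verified by exhibiting this sequence as a function of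
  the round.\<close>

lemma execs_Whl:
  assumes "\<And>i. i < n \<Longrightarrow> (case \<sigma> i of St r t h u k \<Rightarrow> p r (t h)) \<and> execs Or c (\<sigma> i) B (\<sigma> (Suc i))"
    and "case \<sigma> n of St r t h u k \<Rightarrow> \<not> p r (t h)"
  shows "execs Or (Whl p c) (\<sigma> 0) (n * (B + 1) + 1) (\<sigma> n)"
  using assms
proof (induction n arbitrary: \<sigma>)
  case 0
  obtain r t h u k where s: "\<sigma> 0 = St r t h u k" by (cases "\<sigma> 0")
  then have "exec Or (Whl p c) (\<sigma> 0) 1 (\<sigma> 0)"
    using 0(2) exec.WhlF[of p r t h Or c u k] unfolding s by simp
  then show ?case unfolding execs_def by auto
next
  case (Suc n)
  have "execs Or (Whl p c) (\<sigma> (Suc 0)) (n * (B + 1) + 1) (\<sigma> (Suc n))"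
    using Suc.IH[of "\<lambda>i. \<sigma> (Suc i)"] Suc.prems by auto
  then obtain a where a: "a \<le> n * (B + 1) + 1" "exec Or (Whl p c) (\<sigma> (Suc 0)) a (\<sigma> (Suc n))"
    unfolding execs_def by blast
  obtain b where b: "b \<le> B" "exec Or c (\<sigma> 0) b (\<sigma> (Suc 0))"
    using Suc.prems(1)[of 0] unfolding execs_def by auto
  obtain r t h u k where s: "\<sigma> 0 = St r t h u k" by (cases "\<sigma> 0")
  have "exec Or (Whl p c) (\<sigma> 0) (Suc (b + a)) (\<sigma> (Suc n))"
    using exec.WhlT[of p r t h Or c u k b "\<sigma> (Suc 0)" a "\<sigma> (Suc n)"] a b s Suc.prems(1)[of 0] by simp
  moreover have "Suc (b + a) \<le> Suc n * (B + 1) + 1" using a b by simp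
  ultimately show ?case unfolding execs_def by blast
qed

lemma execs_Act: "f r (t h) (u k) = (r', a, d, b, e) \<Longrightarrow>
    execs Or (Act f) (St r t h u k) 1 (St r' (t(h := a)) (move d h) (u(k := b)) (move e k))"
  unfolding execs_def using exec.Act[of f r t h u k r' a d b e Or] by (intro exI[of _ 1]) simp

lemma execs_Act_move: "f r (t h) (u k) = (r', t h, d, u k, e) \<Longrightarrow>
    execs Or (Act f) (St r t h u k) 1 (St r' t (move d h) u (move e k))"
  using execs_Act[of f r t h u k r' "t h" d "u k" e Or] by simp

text \<open>Tracks 0 and 1 carry data, track \<open>j + 2\<close> marks the position of pointer \<open>j\<close>.  Pointer 0 always stays at cell
  0, so its mark tells the head where to turn.\<close>

definition cells :: "(nat \<Rightarrow> nat) \<Rightarrow> (nat \<Rightarrow> nat) \<Rightarrow> nat list \<Rightarrow> nat \<Rightarrow> cell" where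
  "cells t0 t1 ps i = (\<lambda>k. if k = 0 then t0 i else if k = 1 then t1 i
     else if k - 2 < length ps \<and> ps ! (k - 2) = i then 1 else 0)"

text \<open>Between commands the first head rests at cell 0. Programs thus refer to positions only
  through pointers, and commands compose without conditions on the head.\<close>

definition cfg :: "reg \<Rightarrow> (nat \<Rightarrow> nat) \<Rightarrow> (nat \<Rightarrow> nat) \<Rightarrow> nat list \<Rightarrow> (nat \<Rightarrow> nat) \<Rightarrow> nat \<Rightarrow> st" where
  "cfg r t0 t1 ps u k = St r (cells t0 t1 ps) 0 u k"

text \<open>Coincidence of pointers is the only arithmetic test available to a program. As pointer 0
  stays at cell 0, \<open>m 0\<close> is the test for zero, and \<open>m l\<close> is equality with
  pointer \<open>l\<close>.\<close>

definition marks :: "nat list \<Rightarrow> nat \<Rightarrow> nat \<Rightarrow> bool" where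
  "marks ps j i \<longleftrightarrow> i < length ps \<and> ps ! i = ps ! j"

text \<open>Two steps per cell on the way out and back, the way back being at most one cell longer;
  the 9 collects that excess, two loop exits, two actions and three compositions.\<close>

definition at_time :: "nat \<Rightarrow> nat" where
  "at_time S = 4 * S + 9"

type_synonym point_op = "reg \<Rightarrow> nat \<Rightarrow> nat \<Rightarrow> (nat \<Rightarrow> bool) \<Rightarrow> nat \<Rightarrow> reg \<times> nat \<times> nat \<times> dir \<times> nat \<times> dir"

text \<open>Walk to pointer \<open>j\<close>, perform \<open>f\<close> there (its fourth argument tells which pointers share the cell, its
  direction moves the pointer), and walk back to cell 0.\<close>

definition At :: "nat \<Rightarrow> point_op \<Rightarrow> com" where
  "At j f =
     Whl (\<lambda>r a. a (j + 2) = 0) (Act (\<lambda>r a b. (r, a, Rgt, b, Stay))) ;;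
     Act (\<lambda>r a b. case f r (a 0) (a 1) (\<lambda>i. a (i + 2) = 1) b of
       (r', v0, v1, d, b', e) \<Rightarrow> (r', a(0 := v0, 1 := v1, j + 2 := 0), d, b', e)) ;;
     Act (\<lambda>r a b. (r, a(j + 2 := 1), Stay, b, Stay)) ;;
     Whl (\<lambda>r a. a 2 = 0) (Act (\<lambda>r a b. (r, a, Lft, b, Stay)))"

lemma execs_At:
  assumes j: "0 < j" "j < length ps" "ps ! 0 = 0" "ps ! j \<le> S"
    and f: "f r (t0 (ps ! j)) (t1 (ps ! j)) (marks ps j) (u k) = (r', v0, v1, d, b', e)"
  shows "execs Or (At j f) (cfg r t0 t1 ps u k) (at_time S)
    (cfg r' (t0(ps ! j := v0)) (t1(ps ! j := v1)) (ps[j := move d (ps ! j)]) (u(k := b')) (move e k))"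
proof -
  define p where "p = ps ! j"
  define q where "q = move d p"
  let ?t = "cells t0 t1 ps" and ?x = "t0(p := v0)" and ?y = "t1(p := v1)" and ?u = "u(k := b')"
  let ?qs = "ps[j := q]"
  let ?a = "(?t p)(0 := v0, 1 := v1, j + 2 := 0)"
  let ?w = "?t(p := ?a)"
  have 1: "execs Or (Whl (\<lambda>r a. a (j + 2) = 0) (Act (\<lambda>r a b. (r, a, Rgt, b, Stay))))
      (St r ?t 0 u k) (p * (1 + 1) + 1) (St r ?t p u k)"
  proof (rule execs_Whl[where n = p and \<sigma> = "\<lambda>i. St r ?t i u k"], goal_cases)
    case (1 i)
    then have "?t i (j + 2) = 0" using j by (auto simp: cells_def p_def)
    then show ?case
      using execs_Act_move[of "\<lambda>r a b. (r, a, Rgt, b, Stay)" r ?t i u k r Rgt Stay Or] by simp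
  next
    case 2
    then show ?case using j by (simp add: cells_def p_def)
  qed
  have m: "(\<lambda>i. ?t p (i + 2) = 1) = marks ps j"
    by (auto simp: cells_def marks_def p_def fun_eq_iff)
  have 2: "execs Or (Act (\<lambda>r a b. case f r (a 0) (a 1) (\<lambda>i. a (i + 2) = 1) b of
       (r', v0, v1, d, b', e) \<Rightarrow> (r', a(0 := v0, 1 := v1, j + 2 := 0), d, b', e)))
     (St r ?t p u k) 1 (St r' ?w q ?u (move e k))"
    unfolding q_def
  proof (rule execs_Act)
    have "?t p 0 = t0 p" "?t p 1 = t1 p" by (auto simp: cells_def)
    then show "(case f r (?t p 0) (?t p 1) (\<lambda>i. ?t p (i + 2) = 1) (u k) of
       (r', v0, v1, d, b', e) \<Rightarrow> (r', (?t p)(0 := v0, 1 := v1, j + 2 := 0), d, b', e)) =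
       (r', ?a, d, b', e)"
      unfolding m using f by (simp add: p_def)
  qed
  have 3: "execs Or (Act (\<lambda>r a b. (r, a(j + 2 := 1), Stay, b, Stay)))
     (St r' ?w q ?u (move e k)) 1 (St r' (cells ?x ?y ?qs) q ?u (move e k))"
  proof -
    \<comment> \<open>The old mark is removed before the new one is set, so the equation includes
      \<open>q = p\<close>, which occurs for \<open>Stay\<close> and for \<open>Lft\<close> at cell
      0.\<close>
    have *: "?w(q := (?w q)(j + 2 := 1)) = cells ?x ?y ?qs"
    proof (intro ext)
      fix i l :: nat
      consider "l = 0" | "l = 1" | j' where "l = j' + 2" by (metis One_nat_def add_2_eq_Suc' not0_implies_Suc)
      then show "(?w(q := (?w q)(j + 2 := 1))) i l = cells ?x ?y ?qs i l"
      proof cases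
        case 3
        then show ?thesis using j by (auto simp: cells_def p_def nth_list_update)
      qed (auto simp: cells_def)
    qed
    show ?thesis
      using execs_Act[of "\<lambda>r a b. (r, a(j + 2 := 1), Stay, b, Stay)" r' ?w q ?u "move e k"
          r' "(?w q)(j + 2 := 1)" Stay "?u (move e k)" Stay Or, OF refl]
      by (simp only: * fun_upd_triv move.simps)
  qed
  have 4: "execs Or (Whl (\<lambda>r a. a 2 = 0) (Act (\<lambda>r a b. (r, a, Lft, b, Stay))))
      (St r' (cells ?x ?y ?qs) q ?u (move e k)) (q * (1 + 1) + 1) (St r' (cells ?x ?y ?qs) 0 ?u (move e k))"
  proof -
    \<comment> \<open>Writing the positions as \<open>q - 0\<close> and \<open>q - q\<close> makes
      them instances of the state sequence at its first and last index. The same device recurs for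
      later loops.\<close>
    have "execs Or (Whl (\<lambda>r a. a 2 = 0) (Act (\<lambda>r a b. (r, a, Lft, b, Stay))))
      (St r' (cells ?x ?y ?qs) (q - 0) ?u (move e k)) (q * (1 + 1) + 1) (St r' (cells ?x ?y ?qs) (q - q) ?u (move e k))"
    proof (rule execs_Whl[where n = q and \<sigma> = "\<lambda>i. St r' (cells ?x ?y ?qs) (q - i) ?u (move e k)"], goal_cases)
      case (1 i)
      have "q - Suc i = q - i - 1" by simp
      moreover have "cells ?x ?y ?qs (q - i) 2 = 0" using j 1 by (auto simp: cells_def)
      ultimately show ?case
        using execs_Act_move[of "\<lambda>r a b. (r, a, Lft, b, Stay)" r' "cells ?x ?y ?qs" "q - i" ?u "move e k"
            r' Lft Stay Or] by simp
    next
      case 2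
      then show ?case using j by (auto simp: cells_def)
    qed
    then show ?thesis by simp
  qed
  have "q \<le> p + 1" by (cases d) (auto simp: q_def)
  then show ?thesis
    unfolding At_def cfg_def p_def[symmetric] q_def[symmetric]
    using j(4) by (intro execs_mono[OF execs_Seq[OF 1 execs_Seq[OF 2 execs_Seq[OF 3 4]]]]) (simp add: at_time_def p_def)
qed

lemma wfc_At:
  assumes "j + 2 < R"
    and "\<And>r a0 a1 m b. valid_reg R r \<Longrightarrow> a0 < R \<Longrightarrow> a1 < R \<Longrightarrow> b < R \<Longrightarrow>
      (case f r a0 a1 m b of (r', v0, v1, d, b', e) \<Rightarrow> valid_reg R r' \<and> v0 < R \<and> v1 < R \<and> b' < R)"
  shows "wfc R (At j f)"
proof -
  have "case (case f r (a 0) (a 1) (\<lambda>i. a (i + 2) = 1) b of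
       (r', v0, v1, d, b', e) \<Rightarrow> (r', a(0 := v0, 1 := v1, j + 2 := 0), d, b', e)) of
       (r', a', d, b', e) \<Rightarrow> valid_reg R r' \<and> valid_cell R a' \<and> b' < R"
    if "valid_reg R r" "valid_cell R a" "b < R" for r a b
  proof -
    have "a 0 < R" "a 1 < R" using that by (auto simp: valid_cell_def)
    from assms(2)[OF that(1) this that(3), of "\<lambda>i. a (i + 2) = 1"] that(2) assms(1) show ?thesis
      by (auto simp: valid_cell_def split: prod.splits)
  qed
  then show ?thesis using assms(1)
    by (simp add: At_def) (simp add: valid_cell_def)
qed

definition Reg :: "(reg \<Rightarrow> reg) \<Rightarrow> com" where
  "Reg h = Act (\<lambda>r a b. (h r, a, Stay, b, Stay))"

lemma execs_Reg: "execs Or (Reg h) (cfg r t0 t1 ps u k) 1 (cfg (h r) t0 t1 ps u k)"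
  using execs_Act_move[of "\<lambda>r a b. (h r, a, Stay, b, Stay)" r "cells t0 t1 ps" 0 u k "h r" Stay Stay Or]
  by (simp add: Reg_def cfg_def)

lemma execs_flag: "execs Or (Reg (\<lambda>(q, f, s). (q, v, s))) (cfg (q, f, s) t0 t1 ps u k) 1 (cfg (q, v, s) t0 t1 ps u k)"
  using execs_Reg[of Or "\<lambda>(q, f, s). (q, v, s)" "(q, f, s)"] by simp

lemma wfc_Reg: "(\<And>r. valid_reg R r \<Longrightarrow> valid_reg R (h r)) \<Longrightarrow> wfc R (Reg h)"
  by (simp add: Reg_def)

abbreviation Skip :: com where "Skip \<equiv> Reg (\<lambda>r. r)"

definition CondR :: "(reg \<Rightarrow> bool) \<Rightarrow> com \<Rightarrow> com \<Rightarrow> com" where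
  "CondR p c d = Cond (\<lambda>r _. p r) c d"

definition WhlR :: "(reg \<Rightarrow> bool) \<Rightarrow> com \<Rightarrow> com" where
  "WhlR p c = Whl (\<lambda>r _. p r) c"

lemma wfc_CondR [simp]: "wfc R (CondR p c d) \<longleftrightarrow> wfc R c \<and> wfc R d"
  by (simp add: CondR_def)

lemma wfc_WhlR [simp]: "wfc R (WhlR p c) \<longleftrightarrow> wfc R c"
  by (simp add: WhlR_def)

lemma execs_CondR:
  assumes "p r \<Longrightarrow> execs Or c (cfg r t0 t1 ps u k) N s" "\<not> p r \<Longrightarrow> execs Or d (cfg r t0 t1 ps u k) N s"
  shows "execs Or (CondR p c d) (cfg r t0 t1 ps u k) (N + 1) s"
proof (cases "p r")
  case True
  then obtain n where "n \<le> N" "exec Or c (St r (cells t0 t1 ps) 0 u k) n s"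
    using assms(1) by (auto simp: execs_def cfg_def)
  then show ?thesis using True exec.CondT[of "\<lambda>r _. p r" r "cells t0 t1 ps" 0 Or c u k n s d]
    unfolding execs_def CondR_def cfg_def by (intro exI[of _ "Suc n"]) simp
next
  case False
  then obtain n where "n \<le> N" "exec Or d (St r (cells t0 t1 ps) 0 u k) n s"
    using assms(2) by (auto simp: execs_def cfg_def)
  then show ?thesis using False exec.CondF[of "\<lambda>r _. p r" r "cells t0 t1 ps" 0 Or d u k n s c]
    unfolding execs_def CondR_def cfg_def by (intro exI[of _ "Suc n"]) simp
qed

fun reg_of :: "st \<Rightarrow> reg" where "reg_of (St r t h u k) = r"

lemma reg_of_cfg [simp]: "reg_of (cfg r t0 t1 ps u k) = r"
  by (simp add: cfg_def)

lemma execs_WhlR: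
  assumes "\<And>i. i < n \<Longrightarrow> p (reg_of (\<sigma> i)) \<and> execs Or c (\<sigma> i) B (\<sigma> (Suc i))"
    and "\<not> p (reg_of (\<sigma> n))"
  shows "execs Or (WhlR p c) (\<sigma> 0) (n * (B + 1) + 1) (\<sigma> n)"
proof -
  have "(case s of St r t h u k \<Rightarrow> p r) = p (reg_of s)" for s by (cases s) simp
  moreover have "(case s of St r t h u k \<Rightarrow> \<not> p r) = (\<not> p (reg_of s))" for s by (cases s) simp
  ultimately show ?thesis unfolding WhlR_def using assms by (intro execs_Whl) auto
qed

lemma execs_Qry: "execs Or (Qry f) (cfg r t0 t1 ps u k) 3 (cfg (f r (read_word u \<in> Or)) t0 t1 ps (\<lambda>_. 0) 0)"
  unfolding execs_def cfg_def using exec.Qry[of Or f r "cells t0 t1 ps" 0 u k] by (intro exI[of _ 3]) simp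

text \<open>The test concerns the cell of pointer \<open>j\<close>, but a loop condition sees only
  the register once the head is back at cell 0. Hence the outcome travels in the flag; it is set to
  1 again after \<open>c\<close>, which may use the flag freely, and it is 0 on exit.\<close>

definition Loop :: "nat \<Rightarrow> (nat \<Rightarrow> nat \<Rightarrow> (nat \<Rightarrow> bool) \<Rightarrow> nat \<Rightarrow> bool) \<Rightarrow>
    (nat \<Rightarrow> nat \<Rightarrow> nat \<Rightarrow> nat \<times> nat \<times> dir \<times> nat \<times> dir) \<Rightarrow> com \<Rightarrow> com" where
  "Loop j P g c =
     Reg (\<lambda>(q, f, s). (q, 1, s)) ;;
     WhlR (\<lambda>(q, f, s). f = 1)
       (At j (\<lambda>(q, f, s) a0 a1 m b.
          if P a0 a1 m b then ((q, 0, s), a0, a1, Stay, b, Stay) else ((q, 1, s), g a0 a1 b)) ;;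
        CondR (\<lambda>(q, f, s). f = 1) (c ;; Reg (\<lambda>(q, f, s). (q, 1, s))) Skip)"

text \<open>There are \<open>n + 1\<close> rounds because the test that ends the loop is itself a
  walk to the pointer.\<close>

definition loop_time :: "nat \<Rightarrow> nat \<Rightarrow> nat \<Rightarrow> nat" where
  "loop_time S n B = (n + 1) * (at_time S + B + 5) + 3"

lemma execs_Loop:
  fixes q s :: "nat \<Rightarrow> nat" and t0 t1 u :: "nat \<Rightarrow> nat \<Rightarrow> nat" and ps :: "nat \<Rightarrow> nat list" and k :: "nat \<Rightarrow> nat"
  assumes j: "0 < j"
    and ps: "\<And>i. i \<le> n \<Longrightarrow> j < length (ps i) \<and> ps i ! 0 = 0 \<and> ps i ! j \<le> S"
    and stop: "P (t0 n (ps n ! j)) (t1 n (ps n ! j)) (marks (ps n) j) (u n (k n))"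
    and go: "\<And>i. i < n \<Longrightarrow> \<not> P (t0 i (ps i ! j)) (t1 i (ps i ! j)) (marks (ps i) j) (u i (k i))"
    and body: "\<And>i. i < n \<Longrightarrow> case g (t0 i (ps i ! j)) (t1 i (ps i ! j)) (u i (k i)) of (v0, v1, d, b', e) \<Rightarrow>
      \<exists>f. execs Or c (cfg (q i, 1, s i) ((t0 i)(ps i ! j := v0)) ((t1 i)(ps i ! j := v1))
        ((ps i)[j := move d (ps i ! j)]) ((u i)(k i := b')) (move e (k i))) B
        (cfg (q (Suc i), f, s (Suc i)) (t0 (Suc i)) (t1 (Suc i)) (ps (Suc i)) (u (Suc i)) (k (Suc i)))"
  shows "execs Or (Loop j P g c) (cfg (q 0, f0, s 0) (t0 0) (t1 0) (ps 0) (u 0) (k 0)) (loop_time S n B)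
    (cfg (q n, 0, s n) (t0 n) (t1 n) (ps n) (u n) (k n))"
proof -
  define C where "C f i = cfg (q i, f, s i) (t0 i) (t1 i) (ps i) (u i) (k i)" for f i
  let ?F = "\<lambda>(q, f, s) a0 a1 m b.
          if P a0 a1 m b then ((q, 0, s), a0, a1, Stay, b, Stay) else ((q, 1, s), g a0 a1 b)"
  let ?C = "CondR (\<lambda>(q, f, s). f = 1) (c ;; Reg (\<lambda>(q, f, s). (q, 1, s))) Skip"
  have step: "execs Or (At j ?F ;; ?C) (C 1 i) (at_time S + B + 4) (C 1 (Suc i))" if i: "i < n" for i
  proof -
    obtain v0 v1 d b' e where g: "g (t0 i (ps i ! j)) (t1 i (ps i ! j)) (u i (k i)) = (v0, v1, d, b', e)"
      by (metis prod_cases5)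
    let ?m = "(q i, 1, s i)" and ?rest = "cfg (q i, 1, s i) ((t0 i)(ps i ! j := v0)) ((t1 i)(ps i ! j := v1))
        ((ps i)[j := move d (ps i ! j)]) ((u i)(k i := b')) (move e (k i))"
    have 1: "execs Or (At j ?F) (C 1 i) (at_time S) ?rest"
      unfolding C_def using j ps[of i] go[OF i] i g by (intro execs_At) auto
    obtain f where f: "execs Or c ?rest B (C f (Suc i))"
      using body[OF i] g unfolding C_def by auto
    have 2: "execs Or ?C ?rest (B + 1 + 1 + 1) (C 1 (Suc i))"
    proof (rule execs_CondR)
      show "execs Or (c ;; Reg (\<lambda>(q, f, s). (q, 1, s))) ?rest (B + 1 + 1) (C 1 (Suc i))"
        using f unfolding C_def by (intro execs_Seq[OF _ execs_flag])
    qed auto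
    show ?thesis by (rule execs_mono[OF execs_Seq[OF 1 2]]) simp
  qed
  have last: "execs Or (At j ?F ;; ?C) (C 1 n) (at_time S + B + 4) (C 0 n)"
  proof -
    have 1: "execs Or (At j ?F) (C 1 n) (at_time S) (C 0 n)"
      using execs_At[of j "ps n" S ?F "(q n, 1, s n)" "t0 n" "t1 n" "u n" "k n" "(q n, 0, s n)"
          "t0 n (ps n ! j)" "t1 n (ps n ! j)" Stay "u n (k n)" Stay Or] j ps[of n] stop
      by (simp add: C_def)
    have 2: "execs Or ?C (C 0 n) (1 + 1) (C 0 n)"
      unfolding C_def by (rule execs_CondR) (use execs_Reg[of Or "\<lambda>r. r"] in auto)
    show ?thesis by (rule execs_mono[OF execs_Seq[OF 1 2]]) simp
  qed
  \<comment> \<open>The last round only discovers that \<open>P\<close> holds and lowers the flag,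
    so the sequence of states needs one entry beyond \<open>n\<close>.\<close>
  define D where "D i = (if i \<le> n then C 1 i else C 0 n)" for i
  have "execs Or (WhlR (\<lambda>(q, f, s). f = 1) (At j ?F ;; ?C)) (D 0) (Suc n * ((at_time S + B + 4) + 1) + 1) (D (Suc n))"
  proof (rule execs_WhlR)
    fix i assume "i < Suc n"
    then show "(case reg_of (D i) of (q, f, s) \<Rightarrow> f = 1) \<and> execs Or (At j ?F ;; ?C) (D i) (at_time S + B + 4) (D (Suc i))"
      using step[of i] last by (cases "i = n") (auto simp: D_def C_def)
  qed (simp add: D_def C_def)
  moreover have "execs Or (Reg (\<lambda>(q, f, s). (q, 1, s))) (C f0 0) 1 (C 1 0)"
    unfolding C_def by (rule execs_flag)
  ultimately have "execs Or (Loop j P g c) (C f0 0) (loop_time S n B) (C 0 n)"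
    unfolding Loop_def D_def by (intro execs_mono[OF execs_Seq]) (auto simp: loop_time_def)
  then show ?thesis by (simp add: C_def)
qed

lemma wfc_Loop:
  assumes "j + 2 < R" "wfc R c"
    and "\<And>a0 a1 b. a0 < R \<Longrightarrow> a1 < R \<Longrightarrow> b < R \<Longrightarrow>
      (case g a0 a1 b of (v0, v1, d, b', e) \<Rightarrow> v0 < R \<and> v1 < R \<and> b' < R)"
  shows "wfc R (Loop j P g c)"
proof -
  have "wfc R (Reg (\<lambda>(q, f, s). (q, 1, s)))"
    using assms(1) by (intro wfc_Reg) (auto simp: valid_reg_def)
  moreover have "wfc R (At j (\<lambda>(q, f, s) a0 a1 m b.
          if P a0 a1 m b then ((q, 0, s), a0, a1, Stay, b, Stay) else ((q, 1, s), g a0 a1 b)))"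
  proof (rule wfc_At[OF assms(1)], goal_cases)
    case (1 r a0 a1 m b)
    obtain v0 v1 d b' e where "g a0 a1 b = (v0, v1, d, b', e)" by (metis prod_cases5)
    then show ?case using 1 assms(1) assms(3)[of a0 a1 b] by (cases r) (simp add: valid_reg_def)
  qed
  moreover have "wfc R Skip" by (rule wfc_Reg)
  ultimately show ?thesis using assms(2) unfolding Loop_def by simp
qed

definition init_marks :: "nat \<Rightarrow> com" where
  "init_marks J = Act (\<lambda>r a b. (r, \<lambda>k. if 2 \<le> k \<and> k < J + 2 then 1 else a k, Stay, b, Stay))"

definition inp :: "sym list \<Rightarrow> nat \<Rightarrow> nat" where
  "inp x i = (if i < length x then enc (x ! i) else 0)"

lemma execs_init_marks: "execs Or (init_marks J) (ini x) 1 (cfg (0,0,0) (inp x) (\<lambda>_. 0) (replicate J 0) (\<lambda>_. 0) 0)"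
proof -
  let ?f = "\<lambda>r a b. (r, \<lambda>k. if 2 \<le> k \<and> k < J + 2 then 1 else a k, Stay, b, Stay)"
  let ?t = "\<lambda>i. raw (inp x i)"
  have *: "?t(0 := (\<lambda>k. if 2 \<le> k \<and> k < J + 2 then 1 else ?t 0 k)) = cells (inp x) (\<lambda>_. 0) (replicate J 0)"
    by (auto simp: fun_eq_iff cells_def raw_def)
  show ?thesis
    using execs_Act[of ?f "(0,0,0)" ?t 0 "\<lambda>_. 0" 0 "(0,0,0)" "\<lambda>k. if 2 \<le> k \<and> k < J + 2 then 1 else ?t 0 k" Stay 0 Stay Or]
    unfolding * by (simp add: init_marks_def ini_def cfg_def inp_def fun_upd_idem)
qed

lemma wfc_init_marks: "J + 2 \<le> R \<Longrightarrow> 2 \<le> R \<Longrightarrow> wfc R (init_marks J)"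
  by (auto simp: init_marks_def valid_cell_def)

section \<open>Polynomial time bounds\<close>

text \<open>With the base \<open>n + 1 \<ge> 1\<close> exponents may be raised freely, which gives
  closure under sums. \<open>poly_bounded_le_pbound\<close> returns to the base \<open>n\<close> of
  \<open>pbound\<close>.\<close>

definition poly_bounded :: "(nat \<Rightarrow> nat) \<Rightarrow> bool" where
  "poly_bounded f \<longleftrightarrow> (\<exists>k c. \<forall>n. f n \<le> c * (n + 1) ^ k)"

lemma poly_boundedI: "(\<And>n. f n \<le> c * (n + 1) ^ k) \<Longrightarrow> poly_bounded f"
  unfolding poly_bounded_def by blast

lemma poly_bounded_const: "poly_bounded (\<lambda>_. a)"
  by (rule poly_boundedI[of _ a 0]) simp

lemma poly_bounded_id: "poly_bounded (\<lambda>n. n)"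
  by (rule poly_boundedI[of _ 1 1]) simp

lemma poly_bounded_add: assumes "poly_bounded f" "poly_bounded g" shows "poly_bounded (\<lambda>n. f n + g n)"
proof -
  obtain k c l d where f: "\<And>n. f n \<le> c * (n + 1) ^ k" and g: "\<And>n. g n \<le> d * (n + 1) ^ l"
    using assms unfolding poly_bounded_def by blast
  show ?thesis
  proof (rule poly_boundedI[of _ "c + d" "k + l"])
    fix n :: nat
    have "c * (n + 1) ^ k \<le> c * (n + 1) ^ (k + l)" "d * (n + 1) ^ l \<le> d * (n + 1) ^ (k + l)"
      by (intro mult_left_mono power_increasing; simp)+
    then show "f n + g n \<le> (c + d) * (n + 1) ^ (k + l)"
      using f[of n] g[of n] unfolding add_mult_distrib by linarith
  qed
qed

lemma poly_bounded_mult: assumes "poly_bounded f" "poly_bounded g" shows "poly_bounded (\<lambda>n. f n * g n)"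
proof -
  obtain k c l d where f: "\<And>n. f n \<le> c * (n + 1) ^ k" and g: "\<And>n. g n \<le> d * (n + 1) ^ l"
    using assms unfolding poly_bounded_def by blast
  show ?thesis
  proof (rule poly_boundedI[of _ "c * d" "k + l"])
    fix n :: nat
    show "f n * g n \<le> c * d * (n + 1) ^ (k + l)"
      using mult_mono[OF f[of n] g[of n]] by (simp add: power_add mult_ac)
  qed
qed

lemma poly_bounded_power: "poly_bounded f \<Longrightarrow> poly_bounded (\<lambda>n. f n ^ k)"
  by (induction k) (auto intro: poly_bounded_const poly_bounded_mult)

lemma poly_bounded_Suc: "poly_bounded f \<Longrightarrow> poly_bounded (\<lambda>n. Suc (f n))"
  using poly_bounded_add[of f "\<lambda>_. 1"] by (simp add: poly_bounded_const)

lemma poly_bounded_pbound: "poly_bounded f \<Longrightarrow> poly_bounded (\<lambda>n. pbound k c (f n))"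
  unfolding pbound_def by (intro poly_bounded_add poly_bounded_mult poly_bounded_power poly_bounded_const)

lemma poly_bounded_at_time: "poly_bounded f \<Longrightarrow> poly_bounded (\<lambda>n. at_time (f n))"
  unfolding at_time_def by (intro poly_bounded_add poly_bounded_mult poly_bounded_const)

lemma poly_bounded_loop_time: "poly_bounded f \<Longrightarrow> poly_bounded g \<Longrightarrow> poly_bounded h \<Longrightarrow> poly_bounded (\<lambda>n. loop_time (f n) (g n) (h n))"
  unfolding loop_time_def by (intro poly_bounded_add poly_bounded_mult poly_bounded_const poly_bounded_at_time)

lemmas poly_bounded_intros = poly_bounded_const poly_bounded_id poly_bounded_Suc poly_bounded_add poly_bounded_mult poly_bounded_power poly_bounded_pbound poly_bounded_at_time poly_bounded_loop_time

lemma poly_bounded_le_pbound: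
  assumes "poly_bounded f" shows "\<exists>k c. \<forall>n. f n \<le> pbound k c n"
proof -
  obtain k c where f: "\<And>n. f n \<le> c * (n + 1) ^ k" using assms unfolding poly_bounded_def by blast
  have "f n \<le> pbound k (c * 2 ^ k) n" for n
  proof -
    \<comment> \<open>For positive \<open>n\<close> this is \<open>n + 1 \<le> 2 * n\<close>; the
      additive \<open>2 ^ k\<close> covers \<open>n = 0\<close>.\<close>
    have "(n + 1) ^ k \<le> 2 ^ k * n ^ k + 2 ^ k"
    proof (cases n)
      case (Suc m)
      have "(n + 1) ^ k \<le> (2 * n) ^ k" by (rule power_mono) (use Suc in auto)
      then show ?thesis by (simp add: power_mult_distrib)
    qed (simp add: trans_le_add2)
    then have "c * (n + 1) ^ k \<le> c * (2 ^ k * n ^ k + 2 ^ k)" by (rule mult_left_mono) simp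
    then show ?thesis using f[of n] by (simp add: pbound_def algebra_simps)
  qed
  then show ?thesis by blast
qed

lemma pbound_mono: "m \<le> n \<Longrightarrow> pbound k c m \<le> pbound k c n"
  by (simp add: pbound_def power_mono)

section \<open>Halting runs; deciders and transducers obtained from programs\<close>

lemma halting_step: "halting M c \<Longrightarrow> (step M Or ^^ n) c = c"
  by (induction n) (auto simp: step_def)

lemma run_halted:
  assumes "halting M (run M Or x n)" "n \<le> m"
  shows "run M Or x m = run M Or x n"
proof -
  have "m = (m - n) + n" using assms by simp
  then have "run M Or x m = (step M Or ^^ (m - n)) (run M Or x n)"
    unfolding run_def by (metis comp_apply funpow_add)
  then show ?thesis using halting_step[OF assms(1)] by simp
qed

lemma decider:
  assumes wf: "wfc R c" "4 \<le> R" and t: "poly_bounded t"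
    and ex: "\<And>x. \<exists>s. execs Or c (ini x) (t (length x)) s \<and> (x \<in> L \<longleftrightarrow> acc_reg (st_reg s))"
  shows "L \<in> P_orc Or"
proof -
  obtain M where M: "wf_otm M" and "\<forall>Or x n s. exec Or c (ini x) n s \<longrightarrow> halting M (run M Or x (Suc n)) \<and>
      (cstate (run M Or x (Suc n)) = q_acc M \<longleftrightarrow> acc_reg (st_reg s)) \<and>
      (\<forall>i. \<forall>j<4. tp1 (run M Or x (Suc n)) i = j \<longleftrightarrow> st_tape s i = raw j)"
    using compile[OF wf] by (elim exE conjE)
  note M' = this(2)[rule_format]
  obtain k d where kd: "\<And>n. Suc (t n) \<le> pbound k d n"
    using poly_bounded_le_pbound[OF poly_bounded_Suc[OF t]] by blast
  have "halting M (run M Or x (pbound k d (length x))) \<and>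
    (x \<in> L \<longleftrightarrow> cstate (run M Or x (pbound k d (length x))) = q_acc M)" for x
  proof -
    obtain s n where "n \<le> t (length x)" "exec Or c (ini x) n s" "x \<in> L \<longleftrightarrow> acc_reg (st_reg s)"
      using ex[of x] unfolding execs_def by blast
    note s = this
    have "run M Or x (pbound k d (length x)) = run M Or x (Suc n)"
      by (rule run_halted) (use M'[OF s(2)] s(1) kd[of "length x"] in auto)
    then show ?thesis using M'[OF s(2)] s(3) by simp
  qed
  then show ?thesis unfolding P_orc_def using M by blast
qed

text \<open>\<open>read_word\<close> stops at the first cell that is not a plain input symbol. So
  just one cell behind the output is constrained, and it may carry marks or other data.\<close>

lemma transducer:
  assumes wf: "wfc R c" "4 \<le> R" and t: "poly_bounded t"
    and ex: "\<And>n. \<exists>s. execs Or c (ini (unary n)) (t n) s \<and>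
      (\<forall>i<length (a n). st_tape s i = raw (enc (a n ! i))) \<and>
      (\<forall>j\<in>{1,2,3}. st_tape s (length (a n)) \<noteq> raw j)"
  shows "\<exists>T k d. wf_otm T \<and> (\<forall>n. halting T (run T Or (unary n) (pbound k d n)) \<and>
    read_word (tp1 (run T Or (unary n) (pbound k d n))) = a n)"
proof -
  obtain M where M: "wf_otm M" and "\<forall>Or x n s. exec Or c (ini x) n s \<longrightarrow> halting M (run M Or x (Suc n)) \<and>
      (cstate (run M Or x (Suc n)) = q_acc M \<longleftrightarrow> acc_reg (st_reg s)) \<and>
      (\<forall>i. \<forall>j<4. tp1 (run M Or x (Suc n)) i = j \<longleftrightarrow> st_tape s i = raw j)"
    using compile[OF wf] by (elim exE conjE)
  note M' = this(2)[rule_format]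
  obtain k d where kd: "\<And>n. Suc (t n) \<le> pbound k d n"
    using poly_bounded_le_pbound[OF poly_bounded_Suc[OF t]] by blast
  have "halting M (run M Or (unary n) (pbound k d n)) \<and>
    read_word (tp1 (run M Or (unary n) (pbound k d n))) = a n" for n
  proof -
    obtain s m where s: "m \<le> t n" "exec Or c (ini (unary n)) m s"
      "\<forall>i<length (a n). st_tape s i = raw (enc (a n ! i))" "\<forall>j\<in>{1,2,3}. st_tape s (length (a n)) \<noteq> raw j"
      using ex[of n] unfolding execs_def by blast
    then have r: "run M Or (unary n) (pbound k d n) = run M Or (unary n) (Suc m)"
      by (intro run_halted) (use M'[OF s(2)] s(1) kd[of n] in auto)
    let ?u = "tp1 (run M Or (unary n) (Suc m))"
    have u: "\<And>i j. j < 4 \<Longrightarrow> ?u i = j \<longleftrightarrow> st_tape s i = raw j" using M'[OF s(2)] by blast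
    have e4: "enc y < 4" "enc y \<in> {1,2,3}" "dec (enc y) = y" for y by (cases y; simp add: dec_def)+
    have ui: "?u i = enc (a n ! i)" if "i < length (a n)" for i
      using u[OF e4(1)] s(3) that by blast
    have "?u (length (a n)) \<notin> {1,2,3}" using u s(4) by auto
    moreover have "i \<ge> length (a n)" if "?u i \<notin> {1,2,3}" for i
      using that ui[of i] e4(2)[of "a n ! i"] by (metis not_le)
    ultimately have "(LEAST i. ?u i \<notin> {1,2,3}) = length (a n)"
      by (intro Least_equality) blast+
    then have "read_word ?u = a n"
      using ui e4(3) unfolding read_word_def by (auto intro: nth_equalityI)
    then show ?thesis unfolding r using M'[OF s(2)] by blast
  qed
  then show ?thesis using M by blast
qed

lemma execs_At_case:
  assumes "0 < j" "j < length ps" "ps ! 0 = 0" "ps ! j \<le> S"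
    and "(case f r (t0 (ps ! j)) (t1 (ps ! j)) (marks ps j) (u k) of (r', v0, v1, d, b', e) \<Rightarrow>
      cfg r' (t0(ps ! j := v0)) (t1(ps ! j := v1)) (ps[j := move d (ps ! j)]) (u(k := b')) (move e k)) = s'"
  shows "execs Or (At j f) (cfg r t0 t1 ps u k) (at_time S) s'"
proof -
  obtain r' v0 v1 d b' e where "f r (t0 (ps ! j)) (t1 (ps ! j)) (marks ps j) (u k) = (r', v0, v1, d, b', e)"
    by (metis prod_cases6)
  from execs_At[of j ps S f r t0 t1 u k r' v0 v1 d b' e Or, OF assms(1-4) this] this assms(5)
  show ?thesis by simp
qed

section \<open>Simulating a machine\<close>

definition shift :: "nat \<Rightarrow> dir \<Rightarrow> com" where
  "shift j d = At j (\<lambda>r a0 a1 m b. (r, a0, a1, d, b, Stay))"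

lemma execs_shift:
  assumes "0 < j" "j < length ps" "ps ! 0 = 0" "ps ! j \<le> S" "ps' = ps[j := move d (ps ! j)]"
  shows "execs Or (shift j d) (cfg r t0 t1 ps u k) (at_time S) (cfg r t0 t1 ps' u k)"
  unfolding shift_def assms(5) by (rule execs_At_case[OF assms(1-4)]) simp

lemma wfc_shift: "j + 2 < R \<Longrightarrow> wfc R (shift j d)"
  unfolding shift_def by (rule wfc_At) auto

lemma loop_time_mono: "n \<le> n' \<Longrightarrow> B \<le> B' \<Longrightarrow> loop_time S n B \<le> loop_time S n' B'"
  unfolding loop_time_def by (intro add_mono mult_mono) auto

lemma execs_Skip: "execs Or Skip (cfg r t0 t1 ps u k) (Suc 0) (cfg r t0 t1 ps u k)"
  using execs_Reg[of Or "\<lambda>r. r"] by simp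

definition reset :: "nat \<Rightarrow> com" where
  "reset j = Loop j (\<lambda>a0 a1 m b. m 0) (\<lambda>a0 a1 b. (a0, a1, Lft, b, Stay)) Skip"

lemma execs_reset:
  assumes "0 < j" "j < length ps" "ps ! 0 = 0" "ps ! j \<le> S" "ps' = ps[j := 0]"
  shows "execs Or (reset j) (cfg (q, f, s) t0 t1 ps u k) (loop_time S S 1) (cfg (q, 0, s) t0 t1 ps' u k)"
proof -
  have "execs Or (reset j) (cfg (q, f, s) t0 t1 (ps[j := ps ! j - 0]) u k) (loop_time S (ps ! j) 1)
      (cfg (q, 0, s) t0 t1 (ps[j := ps ! j - ps ! j]) u k)"
    unfolding reset_def
    by (rule execs_Loop[where ps = "\<lambda>i. ps[j := ps ! j - i]" and q = "\<lambda>_. q" and s = "\<lambda>_. s"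
          and ?t0.0 = "\<lambda>_. t0" and ?t1.0 = "\<lambda>_. t1" and u = "\<lambda>_. u" and k = "\<lambda>_. k" and S = S])
      (use assms in \<open>auto simp: marks_def nth_list_update intro!: exI[of _ 1] execs_Skip\<close>)
  then show ?thesis
    using loop_time_mono[OF assms(4), of 1 1 S] assms(5) by (auto intro: execs_mono)
qed

definition upto :: "nat \<Rightarrow> nat \<Rightarrow> com" where
  "upto j l = Loop j (\<lambda>a0 a1 m b. m l) (\<lambda>a0 a1 b. (a0, a1, Rgt, b, Stay)) Skip"

lemma execs_upto:
  assumes "0 < j" "j < length ps" "ps ! 0 = 0" "ps ! j \<le> ps ! l" "ps ! l \<le> S" "l < length ps" "l \<noteq> j"
    "ps' = ps[j := ps ! l]"
  shows "execs Or (upto j l) (cfg (q, f, s) t0 t1 ps u k) (loop_time S S 1) (cfg (q, 0, s) t0 t1 ps' u k)"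
proof -
  have "execs Or (upto j l) (cfg (q, f, s) t0 t1 (ps[j := ps ! j + 0]) u k) (loop_time S (ps ! l - ps ! j) 1)
      (cfg (q, 0, s) t0 t1 (ps[j := ps ! j + (ps ! l - ps ! j)]) u k)"
    unfolding upto_def
    by (rule execs_Loop[where ps = "\<lambda>i. ps[j := ps ! j + i]" and q = "\<lambda>_. q" and s = "\<lambda>_. s"
          and ?t0.0 = "\<lambda>_. t0" and ?t1.0 = "\<lambda>_. t1" and u = "\<lambda>_. u" and k = "\<lambda>_. k" and S = S])
      (use assms in \<open>auto simp: marks_def nth_list_update intro!: exI[of _ 1] execs_Skip\<close>)
  moreover have "loop_time S (ps ! l - ps ! j) 1 \<le> loop_time S S 1" using assms by (intro loop_time_mono) auto
  ultimately show ?thesis using assms by (auto intro: execs_mono)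
qed

definition fill :: "nat \<Rightarrow> nat \<Rightarrow> nat \<Rightarrow> com" where
  "fill j l v = Loop j (\<lambda>a0 a1 m b. m l) (\<lambda>a0 a1 b. (v, a1, Rgt, b, Stay)) Skip"

lemma execs_fill:
  assumes "0 < j" "j < length ps" "ps ! 0 = 0" "ps ! j \<le> ps ! l" "ps ! l \<le> S" "l < length ps" "l \<noteq> j"
    "ps' = ps[j := ps ! l]" "t0' = (\<lambda>x. if ps ! j \<le> x \<and> x < ps ! l then v else t0 x)"
  shows "execs Or (fill j l v) (cfg (q, f, s) t0 t1 ps u k) (loop_time S S 1) (cfg (q, 0, s) t0' t1 ps' u k)"
proof -
  define t where "t i = (\<lambda>x. if ps ! j \<le> x \<and> x < ps ! j + i then v else t0 x)" for i
  have t: "(t i)(ps ! j + i := v) = t (Suc i)" for i by (auto simp: t_def fun_eq_iff)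
  have "execs Or (fill j l v) (cfg (q, f, s) (t 0) t1 (ps[j := ps ! j + 0]) u k) (loop_time S (ps ! l - ps ! j) 1)
      (cfg (q, 0, s) (t (ps ! l - ps ! j)) t1 (ps[j := ps ! j + (ps ! l - ps ! j)]) u k)"
    unfolding fill_def
    by (rule execs_Loop[where ps = "\<lambda>i. ps[j := ps ! j + i]" and q = "\<lambda>_. q" and s = "\<lambda>_. s"
          and ?t0.0 = t and ?t1.0 = "\<lambda>_. t1" and u = "\<lambda>_. u" and k = "\<lambda>_. k" and S = S])
      (use assms in \<open>auto simp: marks_def nth_list_update t intro!: exI[of _ 1] execs_Skip\<close>)
  moreover have "t 0 = t0" "t (ps ! l - ps ! j) = t0'" using assms by (auto simp: t_def fun_eq_iff)
  moreover have "loop_time S (ps ! l - ps ! j) 1 \<le> loop_time S S 1" using assms by (intro loop_time_mono) auto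
  ultimately show ?thesis using assms by (auto intro: execs_mono)
qed

lemma wfc_Skip: "wfc R Skip" by (rule wfc_Reg)

lemma wfc_reset: "j + 2 < R \<Longrightarrow> wfc R (reset j)"
  unfolding reset_def by (rule wfc_Loop[OF _ wfc_Skip]) auto

lemma wfc_upto: "j + 2 < R \<Longrightarrow> wfc R (upto j l)"
  unfolding upto_def by (rule wfc_Loop[OF _ wfc_Skip]) auto

lemma wfc_fill: "j + 2 < R \<Longrightarrow> v < R \<Longrightarrow> wfc R (fill j l v)"
  unfolding fill_def by (rule wfc_Loop[OF _ wfc_Skip]) auto

section \<open>Runs of a machine and their step-by-step simulation\<close>

definition valid_config :: "otm \<Rightarrow> config \<Rightarrow> bool" where
  "valid_config M c \<longleftrightarrow> cstate c < nstates M \<and> (\<forall>i. tp1 c i < nsyms M) \<and> (\<forall>i. tp2 c i < nsyms M)"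

lemma wf_deltaD:
  assumes "wf_otm M" "q < nstates M" "a < nsyms M" "b < nsyms M" "delta M q a b = (q', a', d, b', e)"
  shows "q' < nstates M" "a' < nsyms M" "b' < nsyms M"
proof -
  have "\<forall>q < nstates M. \<forall>a < nsyms M. \<forall>b < nsyms M.
        (case delta M q a b of (q', a', d1, b', d2) \<Rightarrow> q' < nstates M \<and> a' < nsyms M \<and> b' < nsyms M)"
    using assms(1) unfolding wf_otm_def by (elim conjE)
  from this[rule_format, OF assms(2-4)] show "q' < nstates M" "a' < nsyms M" "b' < nsyms M"
    using assms(5) by simp_all
qed

lemma valid_config_step:
  assumes "wf_otm M" "valid_config M c" shows "valid_config M (step M Or c)"
proof -
  obtain q' a' d b' e where d: "delta M (cstate c) (tp1 c (hd1 c)) (tp2 c (hd2 c)) = (q', a', d, b', e)"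
    by (metis prod_cases5)
  have "0 < nsyms M" "q_yes M < nstates M" "q_no M < nstates M" using assms(1) unfolding wf_otm_def by auto
  then show ?thesis
    using assms(2) wf_deltaD[OF assms(1) _ _ _ d] d by (auto simp: valid_config_def step_def)
qed

lemma valid_config_init: "wf_otm M \<Longrightarrow> valid_config M (init M x)"
proof -
  assume "wf_otm M"
  then have "q_start M < nstates M" "4 \<le> nsyms M" by (auto simp: wf_otm_def)
  moreover have "enc y < 4" for y by (cases y) auto
  ultimately show ?thesis by (auto simp: valid_config_def init_def intro: less_le_trans)
qed

lemma run_Suc: "run M Or x (Suc n) = step M Or (run M Or x n)"
  by (simp add: run_def)

lemma run_0: "run M Or x 0 = init M x"
  by (simp add: run_def)

lemma valid_config_run: "wf_otm M \<Longrightarrow> valid_config M (run M Or x n)"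
  by (induction n) (simp_all add: run_Suc run_0 valid_config_step valid_config_init)

lemma move_le: "move d h \<le> Suc h" by (cases d) auto

lemma step_bounds:
  "hd1 (step M Or c) \<le> Suc (hd1 c)" "hd2 (step M Or c) \<le> Suc (hd2 c)"
  "i \<noteq> hd1 c \<Longrightarrow> tp1 (step M Or c) i = tp1 c i"
  "i \<noteq> hd2 c \<Longrightarrow> tp2 c i = 0 \<Longrightarrow> tp2 (step M Or c) i = 0"
  by (auto simp: step_def move_le split: prod.splits)

lemma run_bounds:
  "hd1 (run M Or x n) \<le> n" "hd2 (run M Or x n) \<le> n"
  "length x + n \<le> i \<Longrightarrow> tp1 (run M Or x n) i = 0" "n \<le> i \<Longrightarrow> tp2 (run M Or x n) i = 0"
proof (induction n arbitrary: i)
  case (Suc n)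
  { case 1 show ?case using step_bounds(1)[of M Or "run M Or x n"] Suc(1) by (simp add: run_Suc) }
  { case 2 show ?case using step_bounds(2)[of M Or "run M Or x n"] Suc(2) by (simp add: run_Suc) }
  { case 3 then show ?case using step_bounds(3)[of i "run M Or x n" M Or] Suc(1) Suc(3)[of i] by (simp add: run_Suc) }
  { case 4 then show ?case using step_bounds(4)[of i "run M Or x n" M Or] Suc(2) Suc(4)[of i] by (simp add: run_Suc) }
qed (auto simp: run_0 init_def)

text \<open>A simulation stops at the first halting configuration rather than at the prescribed time
  bound. Since halted runs are stationary, it finds the same configuration.\<close>

lemma halting_first:
  assumes "halting M (run M Or x N)"
  shows "\<exists>n\<le>N. halting M (run M Or x n) \<and> (\<forall>i<n. \<not> halting M (run M Or x i)) \<and> run M Or x n = run M Or x N"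
proof -
  let ?n = "LEAST n. halting M (run M Or x n)"
  have "halting M (run M Or x ?n)" "?n \<le> N" using assms by (rule LeastI, rule Least_le)
  moreover have "\<forall>i<?n. \<not> halting M (run M Or x i)" by (intro allI impI) (rule not_less_Least)
  ultimately show ?thesis using run_halted[of M Or x ?n N] by metis
qed

text \<open>Only the first head is represented, as pointer 1. The second tape and its head are taken
  over unchanged, so a query of the simulated machine can be asked directly; \<open>p\<close> lists
  the pointers of the surrounding program.\<close>

definition sim_state :: "nat \<Rightarrow> nat \<Rightarrow> (nat \<Rightarrow> nat) \<Rightarrow> nat list \<Rightarrow> config \<Rightarrow> st" where
  "sim_state f s t1 p c = cfg (cstate c, f, s) (tp1 c) t1 (0 # hd1 c # p) (tp2 c) (hd2 c)"

text \<open>\<open>delta\<close> is constrained only below \<open>nstates\<close> and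
  \<open>nsyms\<close>; the range test keeps the program well-formed on all other values. Halting
  states are left fixed, as in \<open>step\<close>.\<close>

definition sim_move :: "otm \<Rightarrow> com" where
  "sim_move M = At 1 (\<lambda>(q, f, s) a0 a1 m b.
     if q = q_acc M \<or> q = q_rej M \<or> \<not> (q < nstates M \<and> a0 < nsyms M \<and> b < nsyms M)
     then ((q, f, s), a0, a1, Stay, b, Stay)
     else case delta M q a0 b of (q', a', d, b', e) \<Rightarrow> ((q', f, s), a', a1, d, b', e))"

lemma execs_sim_move:
  assumes "valid_config M c" "hd1 c \<le> S" "cstate c \<noteq> q_query M"
  shows "execs Or (sim_move M) (sim_state f s t1 p c) (at_time S) (sim_state f s t1 p (step M O' c))"
  unfolding sim_move_def sim_state_def
  by (rule execs_At_case) (use assms in \<open>auto simp: valid_config_def step_def halting_def split: prod.splits\<close>)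

definition sim_step :: "otm \<Rightarrow> com \<Rightarrow> com" where
  "sim_step M qc = CondR (\<lambda>(q, f, s). q = q_query M) qc (sim_move M)"

lemma execs_sim_step:
  assumes "valid_config M c" "hd1 c \<le> S"
    and "cstate c = q_query M \<Longrightarrow> execs Or qc (sim_state f s t1 p c) N (sim_state f s t1 p (step M O' c))"
  shows "execs Or (sim_step M qc) (sim_state f s t1 p c) (at_time S + N + 1) (sim_state f s t1 p (step M O' c))"
proof -
  have "execs Or (sim_step M qc) (cfg (cstate c, f, s) (tp1 c) t1 (0 # hd1 c # p) (tp2 c) (hd2 c)) (at_time S + N + 1) (sim_state f s t1 p (step M O' c))"
    unfolding sim_step_def
  proof (rule execs_CondR)
    assume "case (cstate c, f, s) of (q, f, s) \<Rightarrow> q = q_query M"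
    then show "execs Or qc (cfg (cstate c, f, s) (tp1 c) t1 (0 # hd1 c # p) (tp2 c) (hd2 c)) (at_time S + N) (sim_state f s t1 p (step M O' c))"
      using assms(3) unfolding sim_state_def by (auto intro: execs_mono)
  next
    assume "\<not> (case (cstate c, f, s) of (q, f, s) \<Rightarrow> q = q_query M)"
    then show "execs Or (sim_move M) (cfg (cstate c, f, s) (tp1 c) t1 (0 # hd1 c # p) (tp2 c) (hd2 c)) (at_time S + N) (sim_state f s t1 p (step M O' c))"
      using execs_sim_move[OF assms(1,2), of Or f s t1 p O'] unfolding sim_state_def by (auto intro: execs_mono)
  qed
  then show ?thesis by (simp add: sim_state_def)
qed

definition sim :: "otm \<Rightarrow> com \<Rightarrow> com \<Rightarrow> com" where
  "sim M tick qc = WhlR (\<lambda>(q, f, s). q \<noteq> q_acc M \<and> q \<noteq> q_rej M) (tick ;; sim_step M qc)"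

text \<open>The simulating program has oracle \<open>Or\<close>, the simulated run has oracle
  \<open>O'\<close>; the two meet only in the hypothesis on \<open>qc\<close>. The command
  \<open>tick\<close> runs before every step and may move the outer pointers, whence the family
  \<open>p\<close>.\<close>

lemma execs_sim:
  assumes M: "wf_otm M" and n: "halting M (run M O' x n)" "\<And>i. i < n \<Longrightarrow> \<not> halting M (run M O' x i)" "n \<le> S"
    and tick: "\<And>i. i < n \<Longrightarrow> execs Or tick (sim_state f s t1 (p i) (run M O' x i)) B (sim_state f s t1 (p (Suc i)) (run M O' x i))"
    and qc: "\<And>i. i < n \<Longrightarrow> cstate (run M O' x i) = q_query M \<Longrightarrow>
      execs Or qc (sim_state f s t1 (p (Suc i)) (run M O' x i)) N (sim_state f s t1 (p (Suc i)) (run M O' x (Suc i)))"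
  shows "execs Or (sim M tick qc) (sim_state f s t1 (p 0) (init M x)) (n * (B + at_time S + N + 3) + 1)
    (sim_state f s t1 (p n) (run M O' x n))"
proof -
  define D where "D i = sim_state f s t1 (p i) (run M O' x i)" for i
  have "execs Or (sim M tick qc) (D 0) (n * ((B + (at_time S + N + 1) + 1) + 1) + 1) (D n)"
    unfolding sim_def
  proof (rule execs_WhlR[where \<sigma> = D])
    fix i assume i: "i < n"
    have "hd1 (run M O' x i) \<le> S" using run_bounds(1)[of M O' x i] i n(3) by linarith
    then have "execs Or (sim_step M qc) (sim_state f s t1 (p (Suc i)) (run M O' x i)) (at_time S + N + 1) (D (Suc i))"
      unfolding D_def run_Suc using valid_config_run[OF M] qc[OF i] run_Suc by (intro execs_sim_step) auto
    from execs_Seq[OF tick[OF i] this] n(2)[OF i]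
    show "(case reg_of (D i) of (q, f, s) \<Rightarrow> q \<noteq> q_acc M \<and> q \<noteq> q_rej M) \<and>
         execs Or (tick ;; sim_step M qc) (D i) (B + (at_time S + N + 1) + 1) (D (Suc i))"
      by (simp add: D_def sim_state_def halting_def)
  qed (use n(1) in \<open>auto simp: D_def sim_state_def halting_def\<close>)
  then show ?thesis unfolding D_def run_0
    by (rule execs_mono) (simp add: algebra_simps)
qed

definition real_query :: "otm \<Rightarrow> com" where
  "real_query M = Qry (\<lambda>(q, f, s) v. (if v then q_yes M else q_no M, f, s))"

text \<open>Ignoring the answer simulates the empty oracle under any oracle; asking nevertheless
  clears the second tape, as \<open>step\<close> prescribes.\<close>

definition empty_query :: "otm \<Rightarrow> com" where
  "empty_query M = Qry (\<lambda>(q, f, s) v. (q_no M, f, s))"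

lemma not_halting_query: "wf_otm M \<Longrightarrow> cstate c = q_query M \<Longrightarrow> \<not> halting M c"
  by (auto simp: wf_otm_def halting_def)

lemma execs_real_query:
  assumes "wf_otm M" "cstate c = q_query M"
  shows "execs Or (real_query M) (sim_state f s t1 p c) 3 (sim_state f s t1 p (step M Or c))"
  using execs_Qry[of Or "\<lambda>(q, f, s) v. (if v then q_yes M else q_no M, f, s)" "(cstate c, f, s)" "tp1 c" t1 "0 # hd1 c # p" "tp2 c" "hd2 c"]
    assms not_halting_query[OF assms] by (simp add: real_query_def sim_state_def step_def)

lemma execs_empty_query:
  assumes "wf_otm M" "cstate c = q_query M"
  shows "execs Or (empty_query M) (sim_state f s t1 p c) 3 (sim_state f s t1 p (step M {} c))"
  using execs_Qry[of Or "\<lambda>(q, f, s) v. (q_no M, f, s)" "(cstate c, f, s)" "tp1 c" t1 "0 # hd1 c # p" "tp2 c" "hd2 c"]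
    assms not_halting_query[OF assms] by (simp add: empty_query_def sim_state_def step_def)

lemma wfc_sim_move:
  assumes M: "wf_otm M" and R: "nstates M \<le> R" "nsyms M \<le> R" "4 \<le> R"
  shows "wfc R (sim_move M)"
  unfolding sim_move_def
proof (rule wfc_At, goal_cases)
  case (2 r a0 a1 m b)
  obtain q f s where r: "r = (q, f, s)" by (cases r)
  obtain q' a' d b' e where d: "delta M q a0 b = (q', a', d, b', e)" by (metis prod_cases5)
  show ?case using 2 R wf_deltaD[OF M _ _ _ d] by (auto simp: r d valid_reg_def)
qed (use R in simp)

lemma wfc_sim:
  assumes "wf_otm M" "nstates M \<le> R" "nsyms M \<le> R" "4 \<le> R" "wfc R tick" "wfc R qc"
  shows "wfc R (sim M tick qc)"
  using assms wfc_sim_move[OF assms(1-4)] by (simp add: sim_def sim_step_def)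

lemma wfc_queries:
  assumes "wf_otm M" "nstates M \<le> R" shows "wfc R (real_query M)" "wfc R (empty_query M)"
proof -
  have "q_yes M < nstates M" "q_no M < nstates M" using assms(1) unfolding wf_otm_def by auto
  then show "wfc R (real_query M)" "wfc R (empty_query M)" using assms(2)
    by (auto simp: real_query_def empty_query_def valid_reg_def split: prod.splits)
qed

text \<open>One step along the enumeration \<^const>\<open>prod_decode\<close> of pairs, with pointers 5 and 4 as first and
  second component.\<close>

definition next_pair :: com where
  "next_pair = At 4 (\<lambda>(q, f, s) a0 a1 m b. ((q, if m 0 then 1 else 0, s), a0, a1, Stay, b, Stay)) ;;
    CondR (\<lambda>(q, f, s). f = 1)
      (Loop 5 (\<lambda>a0 a1 m b. m 0) (\<lambda>a0 a1 b. (a0, a1, Lft, b, Stay)) (shift 4 Rgt) ;; shift 4 Rgt)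
      (shift 4 Lft ;; shift 5 Rgt) ;;
    Reg (\<lambda>(q, f, s). (q, 0, s))"

lemma wfc_next_pair: "7 < R \<Longrightarrow> wfc R next_pair"
  unfolding next_pair_def
  by (auto intro!: wfc_At wfc_Loop wfc_shift wfc_Reg simp: valid_reg_def)

text \<open>Cantor's enumeration runs through the diagonals \<open>i + n = const\<close> with
  \<open>i\<close> increasing; from \<open>(i, 0)\<close> it passes to the start
  \<open>(0, i + 1)\<close> of the next diagonal.\<close>

lemma prod_decode_Suc:
  "prod_decode (Suc e) = (case prod_decode e of (i, n) \<Rightarrow> if n = 0 then (0, Suc i) else (Suc i, n - 1))"
proof -
  obtain i n where e: "prod_decode e = (i, n)" by (cases "prod_decode e")
  then have "e = prod_encode (i, n)" by (metis prod_decode_inverse)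
  then have "Suc e = prod_encode (if n = 0 then (0, Suc i) else (Suc i, n - 1))"
    by (cases n) (auto simp: prod_encode_def)
  then show ?thesis using e by simp
qed

definition next_time :: "nat \<Rightarrow> nat" where
  "next_time S = loop_time S S (at_time S) + 4 * at_time S + 10"

lemma poly_bounded_next_time: "poly_bounded f \<Longrightarrow> poly_bounded (\<lambda>n. next_time (f n))"
  unfolding next_time_def by (intro poly_bounded_intros)

lemma execs_next_pair:
  assumes e: "prod_decode e = (i, n)" "prod_decode (Suc e) = (i', n')" and S: "n + i < S"
  shows "execs Or next_pair (cfg (q, f, s) t0 t1 (0 # h # x # z # n # i # p) u k) (next_time S)
    (cfg (q, 0, s) t0 t1 (0 # h # x # z # n' # i' # p) u k)"
proof -
  let ?f = "if n = 0 then 1 else 0 :: nat"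
  have 1: "execs Or (At 4 (\<lambda>(q, f, s) a0 a1 m b. ((q, if m 0 then 1 else 0, s), a0, a1, Stay, b, Stay)))
     (cfg (q, f, s) t0 t1 (0 # h # x # z # n # i # p) u k) (at_time S)
     (cfg (q, ?f, s) t0 t1 (0 # h # x # z # n # i # p) u k)"
    by (rule execs_At_case) (use S in \<open>auto simp: marks_def\<close>)
  let ?C = "CondR (\<lambda>(q, f, s). f = 1)
      (Loop 5 (\<lambda>a0 a1 m b. m 0) (\<lambda>a0 a1 b. (a0, a1, Lft, b, Stay)) (shift 4 Rgt) ;; shift 4 Rgt)
      (shift 4 Lft ;; shift 5 Rgt)"
  have 2: "execs Or ?C (cfg (q, ?f, s) t0 t1 (0 # h # x # z # n # i # p) u k) (loop_time S S (at_time S) + 2 * at_time S + 3)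
     (cfg (q, 0, s) t0 t1 (0 # h # x # z # n' # i' # p) u k)"
  proof (cases "n = 0")
    case True
    \<comment> \<open>At the end of a diagonal pointer 4 is 0: the loop transfers the
      \<open>i\<close> units of pointer 5 to it, and the shift behind the loop adds the one that
      opens the next diagonal.\<close>
    have "execs Or (Loop 5 (\<lambda>a0 a1 m b. m 0) (\<lambda>a0 a1 b. (a0, a1, Lft, b, Stay)) (shift 4 Rgt))
      (cfg (q, 1, s) t0 t1 (0 # h # x # z # 0 # (i - 0) # p) u k) (loop_time S i (at_time S))
      (cfg (q, 0, s) t0 t1 (0 # h # x # z # i # (i - i) # p) u k)"
      by (rule execs_Loop[where ps = "\<lambda>l. 0 # h # x # z # l # (i - l) # p" and q = "\<lambda>_. q" and s = "\<lambda>_. s"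
          and ?t0.0 = "\<lambda>_. t0" and ?t1.0 = "\<lambda>_. t1" and u = "\<lambda>_. u" and k = "\<lambda>_. k" and S = S])
        (use S in \<open>auto simp: marks_def intro!: exI[of _ 1] execs_shift\<close>)
    moreover have "execs Or (shift 4 Rgt) (cfg (q, 0, s) t0 t1 (0 # h # x # z # i # (i - i) # p) u k) (at_time S)
      (cfg (q, 0, s) t0 t1 (0 # h # x # z # n' # i' # p) u k)"
      by (rule execs_shift) (use S e True in \<open>auto simp: prod_decode_Suc\<close>)
    ultimately have "execs Or (Loop 5 (\<lambda>a0 a1 m b. m 0) (\<lambda>a0 a1 b. (a0, a1, Lft, b, Stay)) (shift 4 Rgt) ;; shift 4 Rgt)
      (cfg (q, 1, s) t0 t1 (0 # h # x # z # 0 # (i - 0) # p) u k) (loop_time S i (at_time S) + at_time S + 1)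
      (cfg (q, 0, s) t0 t1 (0 # h # x # z # n' # i' # p) u k)"
      by (rule execs_Seq)
    moreover have "loop_time S i (at_time S) \<le> loop_time S S (at_time S)" using S by (intro loop_time_mono) auto
    ultimately have "execs Or ?C (cfg (q, ?f, s) t0 t1 (0 # h # x # z # n # i # p) u k) (loop_time S S (at_time S) + 2 * at_time S + 2 + 1)
     (cfg (q, 0, s) t0 t1 (0 # h # x # z # n' # i' # p) u k)"
      using True by (intro execs_CondR) (auto intro: execs_mono)
    then show ?thesis by (simp add: numeral_3_eq_3)
  next
    case False
    have "execs Or (shift 4 Lft) (cfg (q, 0, s) t0 t1 (0 # h # x # z # n # i # p) u k) (at_time S)
       (cfg (q, 0, s) t0 t1 (0 # h # x # z # n' # i # p) u k)"
      by (rule execs_shift) (use S e False in \<open>auto simp: prod_decode_Suc\<close>)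
    moreover have "execs Or (shift 5 Rgt) (cfg (q, 0, s) t0 t1 (0 # h # x # z # n' # i # p) u k) (at_time S)
       (cfg (q, 0, s) t0 t1 (0 # h # x # z # n' # i' # p) u k)"
      by (rule execs_shift) (use S e False in \<open>auto simp: prod_decode_Suc\<close>)
    ultimately have "execs Or (shift 4 Lft ;; shift 5 Rgt) (cfg (q, 0, s) t0 t1 (0 # h # x # z # n # i # p) u k) (at_time S + at_time S + 1)
       (cfg (q, 0, s) t0 t1 (0 # h # x # z # n' # i' # p) u k)"
      by (rule execs_Seq)
    then have "execs Or ?C (cfg (q, ?f, s) t0 t1 (0 # h # x # z # n # i # p) u k) (loop_time S S (at_time S) + 2 * at_time S + 2 + 1)
     (cfg (q, 0, s) t0 t1 (0 # h # x # z # n' # i' # p) u k)"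
      using False by (intro execs_CondR) (auto intro: execs_mono)
    then show ?thesis by (simp add: numeral_3_eq_3)
  qed
  show ?thesis unfolding next_pair_def
    by (rule execs_mono[OF execs_Seq[OF 1 execs_Seq[OF 2 execs_flag]]]) (simp add: next_time_def)
qed

lemma read_word_props:
  assumes "\<exists>n. u n \<notin> {1,2,3}"
  shows "i < length (read_word u) \<Longrightarrow> u i \<in> {1,2,3} \<and> enc (read_word u ! i) = u i"
    and "u (length (read_word u)) \<notin> {1,2,3}"
proof -
  have l: "length (read_word u) = (LEAST n. u n \<notin> {1,2,3})" by (simp add: read_word_def)
  show "u (length (read_word u)) \<notin> {1,2,3}" unfolding l using assms by (rule LeastI_ex)
  assume i: "i < length (read_word u)"
  then have "u i \<in> {1,2,3}" unfolding l using not_less_Least by blast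
  then show "u i \<in> {1,2,3} \<and> enc (read_word u ! i) = u i"
    using i unfolding l by (auto simp: read_word_def dec_def)
qed

section \<open>The advice as a unary language\<close>

lemma fun_upd_const [simp]: "(\<lambda>_. c)(i := c) = (\<lambda>_. c)"
  by auto

lemma inp_unary: "inp (unary n) = (\<lambda>i. if i < n then 2 else 0)"
  by (auto simp: inp_def unary_def)

lemma sim_state_init: "sim_state f s t1 p (init M x) = cfg (q_start M, f, s) (inp x) t1 (0 # 0 # p) (\<lambda>_. 0) 0"
  by (simp add: sim_state_def init_def inp_def[abs_def])

text \<open>Division by 3 by counting: the digit \<open>s\<close> cycles through 0, 1, 2, and the
  pair advances only when it wraps.\<close>

definition decode_body :: com where
  "decode_body = CondR (\<lambda>(q, f, s). s < 2) (Reg (\<lambda>(q, f, s). (q, f, if s = 0 then 1 else 2)))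
     (Reg (\<lambda>(q, f, s). (q, f, 0)) ;; next_pair)"

text \<open>Pointer 2 stands at the input length \<open>m\<close>, pointer 3 counts up to it. The
  outcome is \<open>n\<close> in pointer 4, \<open>i\<close> in pointer 5 and the guess in
  \<open>s\<close>. After \<open>T\<close> has been run on a freshly written \<open>1\<close> to the
  \<open>n\<close>, pointer 1 walks over its output to position \<open>i\<close>, stopping early
  where the output ends.\<close>

definition bit_prog :: "otm \<Rightarrow> com" where
  "bit_prog T = Loop 3 (\<lambda>a0 a1 m b. m 2) (\<lambda>a0 a1 b. (a0, a1, Rgt, b, Stay)) decode_body ;;
     fill 1 4 2 ;; reset 1 ;; Reg (\<lambda>(q, f, s). (q_start T, f, s)) ;; sim T Skip (real_query T) ;; reset 1 ;;
     Loop 1 (\<lambda>a0 a1 m b. m 5 \<or> a0 \<notin> {1,2,3}) (\<lambda>a0 a1 b. (a0, a1, Rgt, b, Stay)) Skip ;;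
     At 1 (\<lambda>(q, f, s) a0 a1 m b. ((q, if m 5 \<and> a0 = s + 1 then 1 else 0, s), a0, a1, Stay, b, Stay))"

text \<open>Leading ones are erased while they are counted, because track 0 becomes the work tape of
  \<open>T\<close>. The input is unary exactly when the count ends at a blank; otherwise the flag
  stays 0, which rejects.\<close>

definition advice_prog :: "otm \<Rightarrow> com" where
  "advice_prog T = init_marks 6 ;;
     Loop 2 (\<lambda>a0 a1 m b. a0 \<noteq> 2) (\<lambda>a0 a1 b. (0, a1, Rgt, b, Stay)) Skip ;;
     At 2 (\<lambda>(q, f, s) a0 a1 m b. ((q, if a0 = 0 then 1 else 0, s), a0, a1, Stay, b, Stay)) ;;
     CondR (\<lambda>(q, f, s). f = 1) (bit_prog T) Skip"

lemma wfc_advice_prog: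
  assumes "wf_otm T" shows "wfc (nstates T + nsyms T + 10) (advice_prog T)"
proof -
  have "q_start T < nstates T" using assms by (simp add: wf_otm_def)
  then show ?thesis
    unfolding advice_prog_def bit_prog_def decode_body_def
    by (auto intro!: wfc_init_marks wfc_At wfc_Loop wfc_Reg wfc_fill wfc_reset wfc_next_pair wfc_sim wfc_queries assms
        simp: valid_reg_def)
qed

definition strip_time :: "nat \<Rightarrow> nat" where
  "strip_time S = loop_time S S 1 + at_time S + 5"

definition bit_time :: "nat \<Rightarrow> nat" where
  "bit_time S = loop_time S S (next_time S + 10) + 4 * loop_time S S 1 + S * (at_time S + 10) + at_time S + 20"

lemma execs_decode:
  assumes "3 * m + 3 < S" 
  shows "execs Or (Loop 3 (\<lambda>a0 a1 m b. m 2) (\<lambda>a0 a1 b. (a0, a1, Rgt, b, Stay)) decode_body)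
    (cfg (0, f, 0) t0 t1 [0, 0, m, 0, 0, 0] u k) (loop_time S S (next_time S + 10))
    (cfg (0, 0, m mod 3) t0 t1 [0, 0, m, m, snd (prod_decode (m div 3)), fst (prod_decode (m div 3))] u k)"
proof -
  define I N where "I e = fst (prod_decode (e div 3))" and "N e = snd (prod_decode (e div 3))" for e
  have b: "I e \<le> e" "N e \<le> e" for e
  proof -
    have e: "prod_encode (I e, N e) = e div 3" by (simp add: I_def N_def)
    show "I e \<le> e" "N e \<le> e"
      using le_prod_encode_1[of "I e" "N e"] le_prod_encode_2[of "N e" "I e"] unfolding e
      by (meson div_le_dividend le_trans)+
  qed
  have "execs Or (Loop 3 (\<lambda>a0 a1 m b. m 2) (\<lambda>a0 a1 b. (a0, a1, Rgt, b, Stay)) decode_body)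
    (cfg (0, f, 0 mod 3) t0 t1 [0, 0, m, 0, N 0, I 0] u k) (loop_time S m (next_time S + 10))
    (cfg (0, 0, m mod 3) t0 t1 [0, 0, m, m, N m, I m] u k)"
  proof (rule execs_Loop[where ps = "\<lambda>e. [0, 0, m, e, N e, I e]" and q = "\<lambda>_. 0" and s = "\<lambda>e. e mod 3"
          and ?t0.0 = "\<lambda>_. t0" and ?t1.0 = "\<lambda>_. t1" and u = "\<lambda>_. u" and k = "\<lambda>_. k" and S = S], goal_cases)
    case (5 e)
    have "execs Or decode_body (cfg (0, 1, e mod 3) t0 t1 [0, 0, m, Suc e, N e, I e] u k) (next_time S + 9 + 1)
      (cfg (0, if e mod 3 < 2 then 1 else 0, Suc e mod 3) t0 t1 [0, 0, m, Suc e, N (Suc e), I (Suc e)] u k)"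
      unfolding decode_body_def
    proof (rule execs_CondR, goal_cases)
      case 1
      then have "Suc e div 3 = e div 3" "Suc e mod 3 = Suc (e mod 3)" "e mod 3 = 0 \<or> e mod 3 = 1"
        by (auto simp: div_Suc mod_Suc)
      then have "execs Or (Reg (\<lambda>(q, f, s). (q, f, if s = 0 then 1 else 2)))
          (cfg (0, 1, e mod 3) t0 t1 [0, 0, m, Suc e, N e, I e] u k) 1
          (cfg (0, if e mod 3 < 2 then 1 else 0, Suc e mod 3) t0 t1 [0, 0, m, Suc e, N (Suc e), I (Suc e)] u k)"
        using execs_Reg[of Or "\<lambda>(q, f, s). (q, f, if s = 0 then 1 else 2)" "(0, 1, e mod 3)"]
        by (auto simp: I_def N_def numeral_2_eq_2)
      then show ?case by (rule execs_mono) simp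
    next
      case 2
      then have e: "e mod 3 = 2" using mod_less_divisor[of 3 e] by simp
      then have *: "Suc e div 3 = Suc (e div 3)" "Suc e mod 3 = 0" by (auto simp: div_Suc mod_Suc)
      have "execs Or (Reg (\<lambda>(q, f, s). (q, f, 0))) (cfg (0, 1, e mod 3) t0 t1 [0, 0, m, Suc e, N e, I e] u k) 1
          (cfg (0, 1, 0) t0 t1 [0, 0, m, Suc e, N e, I e] u k)"
        using execs_Reg[of Or "\<lambda>(q, f, s). (q, f, 0)" "(0, 1, e mod 3)"] by simp
      moreover have "execs Or next_pair (cfg (0, 1, 0) t0 t1 [0, 0, m, Suc e, N e, I e] u k) (next_time S)
          (cfg (0, 0, 0) t0 t1 [0, 0, m, Suc e, N (Suc e), I (Suc e)] u k)"
        by (rule execs_next_pair[of "e div 3"]) (use b[of e] assms 5 in \<open>auto simp: I_def N_def *\<close>)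
      ultimately show ?case using e * by (auto intro!: execs_mono[OF execs_Seq])
    qed
    then show ?case by (auto simp: add.commute)
  qed (use assms in \<open>auto simp: marks_def\<close>)
  moreover have "N 0 = 0" "I 0 = 0" using b[of 0] by auto
  moreover have "loop_time S m (next_time S + 10) \<le> loop_time S S (next_time S + 10)" using assms by (intro loop_time_mono) auto
  ultimately show ?thesis by (auto simp: I_def N_def intro: execs_mono)
qed

lemma execs_bit_prog:
  assumes T: "wf_otm T" "halting T (run T Or (unary n) t)" "read_word (tp1 (run T Or (unary n) t)) = a"
    and in': "prod_decode (m div 3) = (i, n)" and S: "3 * m + t + 5 < S"
  shows "\<exists>s. execs Or (bit_prog T) (cfg (0, 1, 0) (\<lambda>_. 0) (\<lambda>_. 0) [0, 0, m, 0, 0, 0] (\<lambda>_. 0) 0) (bit_time S) s \<and>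
    (acc_reg (st_reg s) \<longleftrightarrow> i < length a \<and> enc (a ! i) = m mod 3 + 1)"
proof -
  have "prod_encode (i, n) = m div 3" using in' by (metis prod_decode_inverse)
  then have iS: "i \<le> m" "n \<le> m"
    using le_prod_encode_1[of i n] le_prod_encode_2[of n i] by (metis div_le_dividend le_trans)+
  obtain t' where t': "t' \<le> t" "halting T (run T Or (unary n) t')" "\<And>i. i < t' \<Longrightarrow> \<not> halting T (run T Or (unary n) i)"
    "run T Or (unary n) t' = run T Or (unary n) t" using halting_first[OF T(2)] by blast
  define c where "c = run T Or (unary n) t"
  have hc: "hd1 c \<le> t" unfolding c_def by (rule run_bounds)
  let ?s = "m mod 3" and ?z = "\<lambda>_. 0 :: nat"
  have 1: "execs Or (Loop 3 (\<lambda>a0 a1 m b. m 2) (\<lambda>a0 a1 b. (a0, a1, Rgt, b, Stay)) decode_body)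
     (cfg (0, 1, 0) ?z ?z [0, 0, m, 0, 0, 0] ?z 0) (loop_time S S (next_time S + 10))
     (cfg (0, 0, ?s) ?z ?z [0, 0, m, m, n, i] ?z 0)"
    using execs_decode[of m S Or 1 ?z ?z ?z 0] S in' by simp
  have 2: "execs Or (fill 1 4 2) (cfg (0, 0, ?s) ?z ?z [0, 0, m, m, n, i] ?z 0) (loop_time S S 1)
     (cfg (0, 0, ?s) (inp (unary n)) ?z [0, n, m, m, n, i] ?z 0)"
    by (rule execs_fill) (use iS S in \<open>auto simp: inp_unary fun_eq_iff\<close>)
  have 3: "execs Or (reset 1) (cfg (0, 0, ?s) (inp (unary n)) ?z [0, n, m, m, n, i] ?z 0) (loop_time S S 1)
     (cfg (0, 0, ?s) (inp (unary n)) ?z [0, 0, m, m, n, i] ?z 0)"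
    by (rule execs_reset) (use iS S in auto)
  have 4: "execs Or (Reg (\<lambda>(q, f, s). (q_start T, f, s))) (cfg (0, 0, ?s) (inp (unary n)) ?z [0, 0, m, m, n, i] ?z 0) 1
     (sim_state 0 ?s ?z [m, m, n, i] (init T (unary n)))"
    using execs_Reg[of Or "\<lambda>(q, f, s). (q_start T, f, s)" "(0, 0, ?s)"] by (simp add: sim_state_init)
  have 5: "execs Or (sim T Skip (real_query T)) (sim_state 0 ?s ?z [m, m, n, i] (init T (unary n)))
     (t' * (Suc 0 + at_time S + 3 + 3) + 1) (sim_state 0 ?s ?z [m, m, n, i] c)"
    unfolding c_def t'(4)[symmetric]
    by (rule execs_sim[where p = "\<lambda>_. [m, m, n, i]" and S = S])
      (use T(1) t' S in \<open>auto simp: run_Suc intro!: execs_real_query\<close>, auto simp: sim_state_def intro!: execs_Skip)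
  have 6: "execs Or (reset 1) (sim_state 0 ?s ?z [m, m, n, i] c) (loop_time S S 1)
     (cfg (cstate c, 0, ?s) (tp1 c) ?z [0, 0, m, m, n, i] (tp2 c) (hd2 c))"
    unfolding sim_state_def by (rule execs_reset) (use hc S in auto)
  have fin: "\<exists>j. tp1 c j \<notin> {1,2,3}"
    using run_bounds(3)[of "unary n" t "length (unary n) + t" T Or] unfolding c_def by (intro exI[of _ "length (unary n) + t"]) auto
  have rw: "j < length a \<Longrightarrow> tp1 c j \<in> {1,2,3} \<and> enc (a ! j) = tp1 c j" "tp1 c (length a) \<notin> {1,2,3}" for j
    using read_word_props[OF fin] T(3) unfolding c_def[symmetric] by auto
  \<comment> \<open>If the walk ends at \<open>i = length a\<close>, the pointers coincide although
    there is no symbol. The comparison still fails, since that cell is outside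
    \<open>{1,2,3}\<close> while \<open>s + 1\<close> is inside.\<close>
  define j where "j = min i (length a)"
  then have j: "j \<le> i" "j \<le> length a" "j = i \<or> j = length a" by auto
  have 7: "execs Or (Loop 1 (\<lambda>a0 a1 m b. m 5 \<or> a0 \<notin> {1,2,3}) (\<lambda>a0 a1 b. (a0, a1, Rgt, b, Stay)) Skip)
     (cfg (cstate c, 0, ?s) (tp1 c) ?z [0, 0, m, m, n, i] (tp2 c) (hd2 c)) (loop_time S j 1)
     (cfg (cstate c, 0, ?s) (tp1 c) ?z [0, j, m, m, n, i] (tp2 c) (hd2 c))"
    by (rule execs_Loop[where ps = "\<lambda>j. [0, j, m, m, n, i]" and q = "\<lambda>_. cstate c" and s = "\<lambda>_. ?s"
          and ?t0.0 = "\<lambda>_. tp1 c" and ?t1.0 = "\<lambda>_. ?z" and u = "\<lambda>_. tp2 c" and k = "\<lambda>_. hd2 c" and S = S])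
      (use iS S rw j in \<open>auto simp: marks_def intro!: exI[of _ 1] execs_Skip\<close>)
  let ?f = "if j = i \<and> tp1 c j = ?s + 1 then 1 else 0 :: nat"
  have 8: "execs Or (At 1 (\<lambda>(q, f, s) a0 a1 m b. ((q, if m 5 \<and> a0 = s + 1 then 1 else 0, s), a0, a1, Stay, b, Stay)))
     (cfg (cstate c, 0, ?s) (tp1 c) ?z [0, j, m, m, n, i] (tp2 c) (hd2 c)) (at_time S)
     (cfg (cstate c, ?f, ?s) (tp1 c) ?z [0, j, m, m, n, i] (tp2 c) (hd2 c))"
    by (rule execs_At_case) (use iS S in \<open>auto simp: marks_def j_def\<close>)
  have "loop_time S j 1 \<le> loop_time S S 1" using iS S by (intro loop_time_mono) (auto simp: j_def)
  moreover have "t' * (Suc 0 + at_time S + 3 + 3) \<le> S * (at_time S + 10)" using t'(1) S by (intro mult_mono) auto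
  ultimately have "execs Or (bit_prog T) (cfg (0, 1, 0) ?z ?z [0, 0, m, 0, 0, 0] ?z 0) (bit_time S)
     (cfg (cstate c, ?f, ?s) (tp1 c) ?z [0, j, m, m, n, i] (tp2 c) (hd2 c))"
    unfolding bit_prog_def
    by (intro execs_mono[OF execs_Seq[OF 1 execs_Seq[OF 2 execs_Seq[OF 3 execs_Seq[OF 4 execs_Seq[OF 5 execs_Seq[OF 6 execs_Seq[OF 7 8]]]]]]]])
      (simp add: bit_time_def)
  moreover have "?f = 1 \<longleftrightarrow> i < length a \<and> enc (a ! i) = ?s + 1"
  proof (cases "i < length a")
    case True then show ?thesis using rw(1)[of i] by (auto simp: j_def)
  next
    case False
    have "?s + 1 \<in> {1,2,3}" using mod_less_divisor[of 3 m] by auto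
    then show ?thesis using False rw(2) by (auto simp: j_def)
  qed
  ultimately show ?thesis by (intro exI conjI) (auto simp: cfg_def)
qed

text \<open>The word of length \<open>3 * prod_encode (i, n) + d\<close> asserts that symbol
  \<open>i\<close> of \<open>a n\<close> has code \<open>d + 1\<close>. The length of
  \<open>a n\<close> is not coded separately: it is the first \<open>i\<close> at which all three
  assertions fail.\<close>

definition bits :: "(nat \<Rightarrow> sym list) \<Rightarrow> lang" where
  "bits a = {unary m |m. case prod_decode (m div 3) of (i, n) \<Rightarrow> i < length (a n) \<and> enc (a n ! i) = m mod 3 + 1}"

lemma unary_inj: "unary m = unary n \<longleftrightarrow> m = n"
  by (simp add: unary_def)

lemma unary_in_bits: "unary m \<in> bits a \<longleftrightarrow>
    (case prod_decode (m div 3) of (i, n) \<Rightarrow> i < length (a n) \<and> enc (a n ! i) = m mod 3 + 1)"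
  by (auto simp: bits_def unary_inj)

lemma all_S1_iff: "length (takeWhile (\<lambda>y. y = S1) w) = length w \<longleftrightarrow> w = unary (length w)"
  by (induction w) (simp_all add: unary_def)

lemma execs_strip:
  assumes "length w < S"
  defines "m \<equiv> length (takeWhile (\<lambda>y. y = S1) w)"
  shows "execs Or (Loop 2 (\<lambda>a0 a1 m b. a0 \<noteq> 2) (\<lambda>a0 a1 b. (0, a1, Rgt, b, Stay)) Skip)
    (cfg (q, f, s) (inp w) t1 [0, 0, 0, 0, 0, 0] u k) (loop_time S S 1)
    (cfg (q, 0, s) (\<lambda>i. if i < m then 0 else inp w i) t1 [0, 0, m, 0, 0, 0] u k)"
proof -
  have m: "m \<le> length w" unfolding m_def by (rule length_takeWhile_le)
  have lt: "inp w i = 2" if "i < m" for i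
    using that m nth_mem[of i "takeWhile (\<lambda>y. y = S1) w"] takeWhile_nth[of i "\<lambda>y. y = S1" w] set_takeWhileD
    unfolding m_def[symmetric] by (fastforce simp: inp_def m_def)
  have eq: "inp w m \<noteq> 2"
  proof (cases "m < length w")
    case True
    then have "w ! m \<noteq> S1" using nth_length_takeWhile[of "\<lambda>y. y = S1" w] unfolding m_def by simp
    then show ?thesis using True by (cases "w ! m") (auto simp: inp_def)
  qed (simp add: inp_def)
  have *: "(\<lambda>x. if x < i then 0 else inp w x)(i := 0) = (\<lambda>x. if x < Suc i then 0 else inp w x)" for i
    by (auto simp: fun_eq_iff)
  have "execs Or (Loop 2 (\<lambda>a0 a1 m b. a0 \<noteq> 2) (\<lambda>a0 a1 b. (0, a1, Rgt, b, Stay)) Skip)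
    (cfg (q, f, s) (\<lambda>x. if x < 0 then 0 else inp w x) t1 [0, 0, 0, 0, 0, 0] u k) (loop_time S m 1)
    (cfg (q, 0, s) (\<lambda>x. if x < m then 0 else inp w x) t1 [0, 0, m, 0, 0, 0] u k)"
    by (rule execs_Loop[where ps = "\<lambda>i. [0, 0, i, 0, 0, 0]" and q = "\<lambda>_. q" and s = "\<lambda>_. s"
          and ?t0.0 = "\<lambda>i x. if x < i then 0 else inp w x" and ?t1.0 = "\<lambda>_. t1" and u = "\<lambda>_. u" and k = "\<lambda>_. k" and S = S])
      (use lt eq m assms in \<open>auto simp: * simp del: fun_upd_apply intro!: exI[of _ 1] execs_Skip\<close>)
  moreover have "loop_time S m 1 \<le> loop_time S S 1" using m assms(1) by (intro loop_time_mono) auto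
  ultimately show ?thesis by (auto intro: execs_mono)
qed

lemma inp_ge: "inp w i = 0 \<longleftrightarrow> length w \<le> i"
proof -
  have "enc y \<noteq> 0" for y by (cases y) auto
  then show ?thesis by (auto simp: inp_def)
qed

text \<open>On input length \<open>m\<close> the machine \<open>T\<close> runs on a word of length
  \<open>n \<le> m\<close>, because a component of a pair never exceeds its code. So a time bound in
  \<open>n\<close> is one in \<open>m\<close>.\<close>

lemma bits_in_P:
  assumes T: "wf_otm T" "\<And>n. halting T (run T Or (unary n) (pbound k c n))"
    "\<And>n. read_word (tp1 (run T Or (unary n) (pbound k c n))) = a n"
  shows "bits a \<in> P_orc Or"
proof -
  define S where "S l = 3 * l + pbound k c l + 6" for l
  have poly: "poly_bounded (\<lambda>l. strip_time (S l) + bit_time (S l) + 10)"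
    unfolding strip_time_def bit_time_def S_def by (intro poly_bounded_intros poly_bounded_next_time)
  show ?thesis
  proof (rule decider[OF wfc_advice_prog[OF T(1)] _ poly])
    fix w :: "sym list"
    let ?l = "length w" and ?z = "\<lambda>_. 0 :: nat" and ?S = "S (length w)"
    let ?m = "length (takeWhile (\<lambda>y. y = S1) w)"
    let ?f = "if ?m = ?l then 1 else 0 :: nat"
    define t where "t i = (if i < ?m then 0 else inp w i)" for i
    have m: "?m \<le> ?l" by (rule length_takeWhile_le)
    have 1: "execs Or (init_marks 6) (ini w) 1 (cfg (0,0,0) (inp w) ?z [0, 0, 0, 0, 0, 0] ?z 0)"
      using execs_init_marks[of Or 6 w] by (simp add: numeral_eq_Suc)
    have 2: "execs Or (Loop 2 (\<lambda>a0 a1 m b. a0 \<noteq> 2) (\<lambda>a0 a1 b. (0, a1, Rgt, b, Stay)) Skip)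
      (cfg (0,0,0) (inp w) ?z [0, 0, 0, 0, 0, 0] ?z 0) (loop_time ?S ?S 1)
      (cfg (0,0,0) t ?z [0, 0, ?m, 0, 0, 0] ?z 0)"
      unfolding t_def by (rule execs_strip) (simp add: S_def)
    have tm: "t ?m = 0 \<longleftrightarrow> ?m = ?l" using m by (auto simp: t_def inp_ge)
    have 3: "execs Or (At 2 (\<lambda>(q, f, s) a0 a1 m b. ((q, if a0 = 0 then 1 else 0, s), a0, a1, Stay, b, Stay)))
      (cfg (0,0,0) t ?z [0, 0, ?m, 0, 0, 0] ?z 0) (at_time ?S) (cfg (0,?f,0) t ?z [0, 0, ?m, 0, 0, 0] ?z 0)"
      by (rule execs_At_case) (use m tm in \<open>auto simp: S_def\<close>)
    have tw: "?m = ?l \<longleftrightarrow> w = unary ?l" by (rule all_S1_iff)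
    have "\<exists>s. execs Or (CondR (\<lambda>(q, f, s). f = 1) (bit_prog T) Skip) (cfg (0,?f,0) t ?z [0, 0, ?m, 0, 0, 0] ?z 0)
      (bit_time ?S + 1) s \<and> (w \<in> bits a \<longleftrightarrow> acc_reg (st_reg s))"
    proof (cases "w = unary ?l")
      case True
      then have mf: "?m = ?l" using tw by blast
      then have f1: "?f = 1" by simp
      have t0: "t = ?z" unfolding t_def mf by (auto simp: fun_eq_iff inp_ge)
      obtain i n where e: "prod_decode (?l div 3) = (i, n)" by (cases "prod_decode (?l div 3)")
      have "n \<le> ?l"
      proof -
        have "prod_encode (i, n) = ?l div 3" using e by (metis prod_decode_inverse)
        then show ?thesis using le_prod_encode_2[of n i] by (metis div_le_dividend le_trans)
      qed
      then have "3 * ?l + pbound k c n + 5 < ?S" using pbound_mono[of n ?l k c] by (simp add: S_def)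
      from execs_bit_prog[OF T(1) T(2) T(3) e this]
      obtain s where s: "execs Or (bit_prog T) (cfg (0, 1, 0) ?z ?z [0, 0, ?l, 0, 0, 0] ?z 0) (bit_time ?S) s"
        "acc_reg (st_reg s) \<longleftrightarrow> i < length (a n) \<and> enc (a n ! i) = ?l mod 3 + 1" by blast
      have "w \<in> bits a \<longleftrightarrow> acc_reg (st_reg s)"
        unfolding s(2) arg_cong[OF True, of "\<lambda>v. v \<in> bits a"] unary_in_bits e by simp
      moreover have "execs Or (CondR (\<lambda>(q, f, s). f = 1) (bit_prog T) Skip) (cfg (0,?f,0) t ?z [0, 0, ?m, 0, 0, 0] ?z 0)
        (bit_time ?S + 1) s"
        unfolding t0 f1 unfolding mf by (rule execs_CondR) (use s(1) in auto)
      ultimately show ?thesis by blast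
    next
      case False
      then have mf: "?f = 0" using tw by auto
      have "w \<notin> bits a" using False by (auto simp: bits_def unary_def)
      moreover have "execs Or (CondR (\<lambda>(q, f, s). f = 1) (bit_prog T) Skip) (cfg (0,?f,0) t ?z [0, 0, ?m, 0, 0, 0] ?z 0)
        (bit_time ?S + 1) (cfg (0,?f,0) t ?z [0, 0, ?m, 0, 0, 0] ?z 0)"
        by (rule execs_CondR) (use mf in \<open>auto intro!: execs_mono[OF execs_Skip] simp: bit_time_def\<close>)
      moreover have "\<not> acc_reg (st_reg (cfg (0,?f,0) t ?z [0, 0, ?m, 0, 0, 0] ?z 0))"
        unfolding mf by (simp add: cfg_def)
      ultimately show ?thesis by blast
    qed
    then obtain s where 4: "execs Or (CondR (\<lambda>(q, f, s). f = 1) (bit_prog T) Skip) (cfg (0,?f,0) t ?z [0, 0, ?m, 0, 0, 0] ?z 0)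
      (bit_time ?S + 1) s" and s: "w \<in> bits a \<longleftrightarrow> acc_reg (st_reg s)" by blast
    have "execs Or (advice_prog T) (ini w) (strip_time ?S + bit_time ?S + 10) s"
      unfolding advice_prog_def
      by (rule execs_mono[OF execs_Seq[OF 1 execs_Seq[OF 2 execs_Seq[OF 3 4]]]]) (simp add: strip_time_def)
    then show "\<exists>s. execs Or (advice_prog T) (ini w) (strip_time ?S + bit_time ?S + 10) s \<and>
      (w \<in> bits a \<longleftrightarrow> acc_reg (st_reg s))" using s by blast
  qed simp
qed

lemma bits_unary: "bits a \<subseteq> range unary"
  by (auto simp: bits_def)

section \<open>Reconstructing the advice by queries\<close>

fun write_ones :: "nat \<Rightarrow> com" where
  "write_ones 0 = Skip"
| "write_ones (Suc d) = At 7 (\<lambda>r a0 a1 m b. (r, a0, a1, Stay, 2, Rgt)) ;; write_ones d"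

definition ask_word :: "nat \<Rightarrow> com" where
  "ask_word d = Loop 7 (\<lambda>a0 a1 m b. m 6) (\<lambda>a0 a1 b. (a0, a1, Rgt, 2, Rgt)) Skip ;; reset 7 ;; write_ones d ;;
     Qry (\<lambda>(q, f, s) v. (q, if v then 1 else 0, s))"

definition ask :: "nat \<Rightarrow> com \<Rightarrow> com" where
  "ask d els = ask_word d ;; CondR (\<lambda>(q, f, s). f = 1) (At 3 (\<lambda>r a0 a1 m b. (r, d + 1, a1, Rgt, b, Stay))) els"

text \<open>Three negative answers mean that the position is past the end of the advice; the digit
  \<open>s = 1\<close> then ends the scan.\<close>

definition ask_symbol :: com where
  "ask_symbol = ask 0 (ask 1 (ask 2 (Reg (\<lambda>(q, f, s). (q, f, 1)))))"

text \<open>All pairs are enumerated, but questions are asked only when the second component equals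
  the input length in pointer 2. Pointer 6 keeps pace at three times the index of the pair, which is
  the length of the word to be asked for guess 0.\<close>

definition scan_body :: com where
  "scan_body = At 4 (\<lambda>(q, f, s) a0 a1 m b. ((q, if m 2 then 1 else 0, s), a0, a1, Stay, b, Stay)) ;;
     CondR (\<lambda>(q, f, s). f = 1) ask_symbol Skip ;; shift 6 Rgt ;; shift 6 Rgt ;; shift 6 Rgt ;; next_pair"

definition to_end :: "nat \<Rightarrow> com" where
  "to_end j = Loop j (\<lambda>a0 a1 m b. a0 = 0) (\<lambda>a0 a1 b. (a0, a1, Rgt, b, Stay)) Skip"

definition final_test :: "otm \<Rightarrow> com" where
  "final_test M = Reg (\<lambda>(q, f, s). (q, if q = q_acc M then 1 else 0, s))"

text \<open>The separator, code 3, and the advice are written directly behind \<open>x\<close> at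
  pointer 3, so the input for \<open>M\<close> is assembled in place.\<close>

definition main_prog :: "otm \<Rightarrow> com" where
  "main_prog M = init_marks 8 ;; to_end 2 ;; to_end 3 ;;
     At 3 (\<lambda>r a0 a1 m b. (r, 3, a1, Rgt, b, Stay)) ;; WhlR (\<lambda>(q, f, s). s = 0) scan_body ;;
     Reg (\<lambda>(q, f, s). (q_start M, f, s)) ;; sim M Skip (empty_query M) ;; final_test M"

lemma wfc_write_ones: "9 < R \<Longrightarrow> wfc R (write_ones d)"
  by (induction d) (auto intro!: wfc_At wfc_Skip)

lemma wfc_to_end: "j + 2 < R \<Longrightarrow> wfc R (to_end j)"
  unfolding to_end_def by (rule wfc_Loop[OF _ wfc_Skip]) auto

lemma wfc_final_test: "1 < R \<Longrightarrow> wfc R (final_test M)"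
  unfolding final_test_def by (rule wfc_Reg) (auto simp: valid_reg_def)

lemma wfc_Qry: "(\<And>r v. valid_reg R r \<Longrightarrow> valid_reg R (h r v)) \<Longrightarrow> wfc R (Qry h)"
  by simp

lemma wfc_main_prog:
  assumes "wf_otm M" shows "wfc (nstates M + nsyms M + 12) (main_prog M)"
proof -
  have "q_start M < nstates M" using assms by (simp add: wf_otm_def)
  then show ?thesis
    unfolding main_prog_def scan_body_def ask_symbol_def ask_def ask_word_def
    by (auto intro!: wfc_init_marks wfc_At wfc_Loop wfc_Reg wfc_reset wfc_next_pair wfc_sim wfc_queries assms wfc_shift
        wfc_write_ones wfc_to_end wfc_final_test wfc_Qry
        simp: valid_reg_def simp del: wfc.simps(2))
qed

definition ones :: "nat \<Rightarrow> nat \<Rightarrow> nat" where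
  "ones m i = (if i < m then 2 else 0)"

lemma read_word_ones: "read_word (ones m) = unary m"
proof -
  have "(LEAST n. ones m n \<notin> {1,2,3}) = m"
    by (rule Least_equality) (auto simp: ones_def split: if_splits)
  then show ?thesis
    unfolding read_word_def unary_def by (auto simp: dec_def ones_def list_eq_iff_nth_eq)
qed

lemma ones_upd: "(ones m)(m := 2) = ones (Suc m)"
  by (auto simp: ones_def fun_eq_iff)

lemma ones_0: "ones 0 = (\<lambda>_. 0)"
  by (auto simp: ones_def)

lemma execs_write_ones:
  "ps ! 0 = 0 \<Longrightarrow> 7 < length ps \<Longrightarrow> ps ! 7 \<le> S \<Longrightarrow>
    execs Or (write_ones d) (cfg r t0 t1 ps (ones m) m) (d * (at_time S + 1) + 1) (cfg r t0 t1 ps (ones (m + d)) (m + d))"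
proof (induction d arbitrary: m)
  case 0 then show ?case using execs_Skip by simp
next
  case (Suc d)
  have "execs Or (At 7 (\<lambda>r a0 a1 m b. (r, a0, a1, Stay, 2, Rgt))) (cfg r t0 t1 ps (ones m) m) (at_time S)
    (cfg r t0 t1 ps (ones (Suc m)) (Suc m))"
    by (rule execs_At_case) (use Suc.prems in \<open>auto simp: ones_upd\<close>)
  from execs_Seq[OF this Suc.IH[of "Suc m"]] Suc.prems show ?case
    by (auto intro: execs_mono)
qed

definition ask_time :: "nat \<Rightarrow> nat" where
  "ask_time S = 2 * loop_time S S 1 + 3 * at_time S + 20"

lemma execs_ask_word:
  assumes "d \<le> 2" "m \<le> S"
  shows "execs Or (ask_word d) (cfg (q, f, s) t0 t1 [0, h, x, w, n, i, m, 0] (\<lambda>_. 0) 0) (2 * loop_time S S 1 + 2 * at_time S + 10)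
    (cfg (q, if unary (m + d) \<in> Or then 1 else 0, s) t0 t1 [0, h, x, w, n, i, m, 0] (\<lambda>_. 0) 0)"
proof -
  have 1: "execs Or (Loop 7 (\<lambda>a0 a1 m b. m 6) (\<lambda>a0 a1 b. (a0, a1, Rgt, 2, Rgt)) Skip)
     (cfg (q, f, s) t0 t1 [0, h, x, w, n, i, m, 0] (ones 0) 0) (loop_time S m 1)
     (cfg (q, 0, s) t0 t1 [0, h, x, w, n, i, m, m] (ones m) m)"
    by (rule execs_Loop[where ps = "\<lambda>j. [0, h, x, w, n, i, m, j]" and q = "\<lambda>_. q" and s = "\<lambda>_. s"
          and ?t0.0 = "\<lambda>_. t0" and ?t1.0 = "\<lambda>_. t1" and u = ones and k = "\<lambda>j. j" and S = S])
      (use assms in \<open>auto simp: marks_def ones_upd intro!: exI[of _ 1] execs_Skip\<close>)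
  have 2: "execs Or (reset 7) (cfg (q, 0, s) t0 t1 [0, h, x, w, n, i, m, m] (ones m) m) (loop_time S S 1)
     (cfg (q, 0, s) t0 t1 [0, h, x, w, n, i, m, 0] (ones m) m)"
    by (rule execs_reset) (use assms in auto)
  have 3: "execs Or (write_ones d) (cfg (q, 0, s) t0 t1 [0, h, x, w, n, i, m, 0] (ones m) m) (d * (at_time S + 1) + 1)
     (cfg (q, 0, s) t0 t1 [0, h, x, w, n, i, m, 0] (ones (m + d)) (m + d))"
    by (rule execs_write_ones) auto
  have 4: "execs Or (Qry (\<lambda>(q, f, s) v. (q, if v then 1 else 0, s)))
     (cfg (q, 0, s) t0 t1 [0, h, x, w, n, i, m, 0] (ones (m + d)) (m + d)) 3
     (cfg (q, if unary (m + d) \<in> Or then 1 else 0, s) t0 t1 [0, h, x, w, n, i, m, 0] (\<lambda>_. 0) 0)"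
    using execs_Qry[of Or "\<lambda>(q, f, s) v. (q, if v then 1 else 0, s)" "(q, 0, s)" t0 t1
        "[0, h, x, w, n, i, m, 0]" "ones (m + d)" "m + d"] by (simp add: read_word_ones)
  have "loop_time S m 1 \<le> loop_time S S 1" using assms by (intro loop_time_mono) auto
  moreover have "d * (at_time S + 1) \<le> 2 * (at_time S + 1)" using assms by (intro mult_mono) auto
  ultimately show ?thesis unfolding ask_word_def ones_0[symmetric]
    by (intro execs_mono[OF execs_Seq[OF 1 execs_Seq[OF 2 execs_Seq[OF 3 4[folded ones_0]]]]]) (simp add: ones_0)
qed

lemma execs_ask_yes:
  assumes "d \<le> 2" "m \<le> S" "w \<le> S" "unary (m + d) \<in> Or"
  shows "execs Or (ask d els) (cfg (q, f, s) t0 t1 [0, h, x, w, n, i, m, 0] (\<lambda>_. 0) 0) (ask_time S)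
    (cfg (q, 1, s) (t0(w := d + 1)) t1 [0, h, x, Suc w, n, i, m, 0] (\<lambda>_. 0) 0)"
proof -
  have "execs Or (At 3 (\<lambda>r a0 a1 m b. (r, d + 1, a1, Rgt, b, Stay)))
      (cfg (q, 1, s) t0 t1 [0, h, x, w, n, i, m, 0] (\<lambda>_. 0) 0) (at_time S)
      (cfg (q, 1, s) (t0(w := d + 1)) t1 [0, h, x, Suc w, n, i, m, 0] (\<lambda>_. 0) 0)"
    by (rule execs_At_case) (use assms in auto)
  then have "execs Or (CondR (\<lambda>(q, f, s). f = 1) (At 3 (\<lambda>r a0 a1 m b. (r, d + 1, a1, Rgt, b, Stay))) els)
      (cfg (q, 1, s) t0 t1 [0, h, x, w, n, i, m, 0] (\<lambda>_. 0) 0) (at_time S + 1)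
      (cfg (q, 1, s) (t0(w := d + 1)) t1 [0, h, x, Suc w, n, i, m, 0] (\<lambda>_. 0) 0)"
    by (intro execs_CondR) auto
  from execs_Seq[OF execs_ask_word[OF assms(1,2), of Or q f s t0 t1 h x w n i, unfolded if_P[OF assms(4)]] this]
  show ?thesis unfolding ask_def by (rule execs_mono) (simp add: ask_time_def)
qed

lemma execs_ask_no:
  assumes "d \<le> 2" "m \<le> S" "unary (m + d) \<notin> Or"
    and "execs Or els (cfg (q, 0, s) t0 t1 [0, h, x, w, n, i, m, 0] (\<lambda>_. 0) 0) B s'"
  shows "execs Or (ask d els) (cfg (q, f, s) t0 t1 [0, h, x, w, n, i, m, 0] (\<lambda>_. 0) 0) (ask_time S + B) s'"
proof -
  have "execs Or (CondR (\<lambda>(q, f, s). f = 1) (At 3 (\<lambda>r a0 a1 m b. (r, d + 1, a1, Rgt, b, Stay))) els)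
      (cfg (q, 0, s) t0 t1 [0, h, x, w, n, i, m, 0] (\<lambda>_. 0) 0) (B + 1) s'"
    using assms(4) by (intro execs_CondR) auto
  from execs_Seq[OF execs_ask_word[OF assms(1,2), of Or q f s t0 t1 h x w n i, unfolded if_not_P[OF assms(3)]] this]
  show ?thesis unfolding ask_def by (rule execs_mono) (simp add: ask_time_def)
qed

lemma execs_ask_symbol_yes:
  assumes "m \<le> S" "w \<le> S" "\<And>d. d \<le> 2 \<Longrightarrow> unary (m + d) \<in> Or \<longleftrightarrow> enc y = d + 1"
  shows "\<exists>f'. execs Or ask_symbol (cfg (q, f, s) t0 t1 [0, h, x, w, n, i, m, 0] (\<lambda>_. 0) 0) (3 * ask_time S + 1)
    (cfg (q, f', s) (t0(w := enc y)) t1 [0, h, x, Suc w, n, i, m, 0] (\<lambda>_. 0) 0)"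
proof -
  let ?c = "\<lambda>f. cfg (q, f, s) t0 t1 [0, h, x, w, n, i, m, 0] (\<lambda>_. 0) 0"
  let ?g = "cfg (q, 1, s) (t0(w := enc y)) t1 [0, h, x, Suc w, n, i, m, 0] (\<lambda>_. 0) 0"
  have yes: "execs Or (ask d els) (?c f) (ask_time S) ?g" if "enc y = d + 1" "d \<le> 2" for d els f
    using execs_ask_yes[OF that(2) assms(1,2)] assms(3)[OF that(2)] that by simp
  have no: "execs Or (ask d els) (?c f) (ask_time S + B) ?g"
    if "enc y \<noteq> d + 1" "d \<le> 2" "execs Or els (?c 0) B ?g" for d els B f
    using execs_ask_no[OF that(2) assms(1) _ that(3)] assms(3)[OF that(2)] that by simp
  have "execs Or ask_symbol (?c f) (3 * ask_time S + 1) ?g"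
  proof (cases y)
    case S0
    then show ?thesis unfolding ask_symbol_def by (intro execs_mono[OF yes]) auto
  next
    case S1
    then show ?thesis unfolding ask_symbol_def by (intro execs_mono[OF no[OF _ _ yes]]) auto
  next
    case SH
    then show ?thesis unfolding ask_symbol_def by (intro execs_mono[OF no[OF _ _ no[OF _ _ yes]]]) auto
  qed
  then show ?thesis by blast
qed

lemma execs_ask_symbol_no:
  assumes "m \<le> S" "\<And>d. d \<le> 2 \<Longrightarrow> unary (m + d) \<notin> Or"
  shows "execs Or ask_symbol (cfg (q, f, s) t0 t1 [0, h, x, w, n, i, m, 0] (\<lambda>_. 0) 0) (3 * ask_time S + 1)
    (cfg (q, 0, 1) t0 t1 [0, h, x, w, n, i, m, 0] (\<lambda>_. 0) 0)"
proof -
  have "execs Or (Reg (\<lambda>(q, f, s). (q, f, 1))) (cfg (q, 0, s) t0 t1 [0, h, x, w, n, i, m, 0] (\<lambda>_. 0) 0) 1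
    (cfg (q, 0, 1) t0 t1 [0, h, x, w, n, i, m, 0] (\<lambda>_. 0) 0)"
    using execs_Reg[of Or "\<lambda>(q, f, s). (q, f, 1)" "(q, 0, s)"] by simp
  then show ?thesis unfolding ask_symbol_def
    by (intro execs_mono[OF execs_ask_no[OF _ assms(1) _ execs_ask_no[OF _ assms(1) _ execs_ask_no[OF _ assms(1)]]]])
      (use assms(2)[of 0] assms(2)[of 1] assms(2)[of 2] in auto)
qed

definition scan_time :: "nat \<Rightarrow> nat" where
  "scan_time S = 3 * ask_time S + 4 * at_time S + next_time S + 20"

text \<open>The free outcome \<open>w'\<close>, \<open>t0'\<close>, \<open>s'\<close> lets one
  statement cover a foreign pair, a symbol that is found, and the end of the advice.\<close>

lemma execs_scan_body:
  assumes e: "prod_decode e = (i, n)" "prod_decode (Suc e) = (i', n')"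
    and S: "3 * e + 3 \<le> S" "n + i < S" "w \<le> S"
    and skip: "n \<noteq> x \<Longrightarrow> w' = w \<and> t0' = t0 \<and> s' = s"
    and asks: "n = x \<Longrightarrow> \<exists>f'. execs Or ask_symbol (cfg (q, 1, s) t0 t1 [0, h, x, w, n, i, 3 * e, 0] (\<lambda>_. 0) 0) (3 * ask_time S + 1)
      (cfg (q, f', s') t0' t1 [0, h, x, w', n, i, 3 * e, 0] (\<lambda>_. 0) 0)"
  shows "execs Or scan_body (cfg (q, f, s) t0 t1 [0, h, x, w, n, i, 3 * e, 0] (\<lambda>_. 0) 0) (scan_time S)
    (cfg (q, 0, s') t0' t1 [0, h, x, w', n', i', 3 * Suc e, 0] (\<lambda>_. 0) 0)"
proof -
  let ?z = "\<lambda>_. 0 :: nat" and ?f = "if n = x then 1 else 0 :: nat"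
  have 1: "execs Or (At 4 (\<lambda>(q, f, s) a0 a1 m b. ((q, if m 2 then 1 else 0, s), a0, a1, Stay, b, Stay)))
    (cfg (q, f, s) t0 t1 [0, h, x, w, n, i, 3 * e, 0] ?z 0) (at_time S)
    (cfg (q, ?f, s) t0 t1 [0, h, x, w, n, i, 3 * e, 0] ?z 0)"
    by (rule execs_At_case) (use S in \<open>auto simp: marks_def\<close>)
  have "\<exists>f'. execs Or (CondR (\<lambda>(q, f, s). f = 1) ask_symbol Skip) (cfg (q, ?f, s) t0 t1 [0, h, x, w, n, i, 3 * e, 0] ?z 0)
    (3 * ask_time S + 2) (cfg (q, f', s') t0' t1 [0, h, x, w', n, i, 3 * e, 0] ?z 0)"
  proof (cases "n = x")
    case True
    then obtain f' where "execs Or ask_symbol (cfg (q, 1, s) t0 t1 [0, h, x, w, n, i, 3 * e, 0] ?z 0) (3 * ask_time S + 1)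
      (cfg (q, f', s') t0' t1 [0, h, x, w', n, i, 3 * e, 0] ?z 0)" using asks by blast
    then have "execs Or (CondR (\<lambda>(q, f, s). f = 1) ask_symbol Skip) (cfg (q, ?f, s) t0 t1 [0, h, x, w, n, i, 3 * e, 0] ?z 0)
      (3 * ask_time S + 1 + 1) (cfg (q, f', s') t0' t1 [0, h, x, w', n, i, 3 * e, 0] ?z 0)"
      using True by (intro execs_CondR) auto
    then show ?thesis by (auto intro: execs_mono)
  next
    case False
    have "execs Or (CondR (\<lambda>(q, f, s). f = 1) ask_symbol Skip) (cfg (q, ?f, s) t0 t1 [0, h, x, w, n, i, 3 * e, 0] ?z 0)
      (Suc 0 + 1) (cfg (q, ?f, s) t0 t1 [0, h, x, w, n, i, 3 * e, 0] ?z 0)"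
      using False by (intro execs_CondR execs_Skip) auto
    then have "execs Or (CondR (\<lambda>(q, f, s). f = 1) ask_symbol Skip) (cfg (q, ?f, s) t0 t1 [0, h, x, w, n, i, 3 * e, 0] ?z 0)
      (3 * ask_time S + 2) (cfg (q, ?f, s) t0 t1 [0, h, x, w, n, i, 3 * e, 0] ?z 0)"
      by (rule execs_mono) simp
    then show ?thesis using skip[OF False] by blast
  qed
  then obtain f' where 2: "execs Or (CondR (\<lambda>(q, f, s). f = 1) ask_symbol Skip) (cfg (q, ?f, s) t0 t1 [0, h, x, w, n, i, 3 * e, 0] ?z 0)
    (3 * ask_time S + 2) (cfg (q, f', s') t0' t1 [0, h, x, w', n, i, 3 * e, 0] ?z 0)" by blast
  have 3: "execs Or (shift 6 Rgt) (cfg (q, f', s') t0' t1 [0, h, x, w', n, i, m, 0] ?z 0) (at_time S)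
    (cfg (q, f', s') t0' t1 [0, h, x, w', n, i, Suc m, 0] ?z 0)" if "m \<le> S" for m
    by (rule execs_shift) (use that in auto)
  have 4: "execs Or next_pair (cfg (q, f', s') t0' t1 [0, h, x, w', n, i, Suc (Suc (Suc (3 * e))), 0] ?z 0) (next_time S)
    (cfg (q, 0, s') t0' t1 [0, h, x, w', n', i', Suc (Suc (Suc (3 * e))), 0] ?z 0)"
    by (rule execs_next_pair[OF e S(2)])
  have "execs Or scan_body (cfg (q, f, s) t0 t1 [0, h, x, w, n, i, 3 * e, 0] ?z 0)
    (at_time S + (3 * ask_time S + 2 + (at_time S + (at_time S + (at_time S + next_time S + 1) + 1) + 1) + 1) + 1)
    (cfg (q, 0, s') t0' t1 [0, h, x, w', n', i', Suc (Suc (Suc (3 * e))), 0] ?z 0)"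
    unfolding scan_body_def
    by (intro execs_Seq[OF 1 execs_Seq[OF 2 execs_Seq[OF 3 execs_Seq[OF 3 execs_Seq[OF 3 4]]]]]) (use S in auto)
  moreover have "3 * Suc e = Suc (Suc (Suc (3 * e)))" by simp
  ultimately show ?thesis by (simp only:) (erule execs_mono, simp add: scan_time_def)
qed

lemma inp_snoc: "inp (y @ [c]) = (inp y)(length y := enc c)"
  by (auto simp: inp_def fun_eq_iff nth_append)

lemma execs_to_end:
  assumes "0 < j" "j < length ps" "ps ! 0 = 0" "ps ! j = 0" "length x \<le> S" "ps' = ps[j := length x]"
  shows "execs Or (to_end j) (cfg (q, f, s) (inp x) t1 ps u k) (loop_time S S 1) (cfg (q, 0, s) (inp x) t1 ps' u k)"
proof -
  have "execs Or (to_end j) (cfg (q, f, s) (inp x) t1 (ps[j := 0]) u k) (loop_time S (length x) 1)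
      (cfg (q, 0, s) (inp x) t1 (ps[j := length x]) u k)"
    unfolding to_end_def
    by (rule execs_Loop[where ps = "\<lambda>i. ps[j := i]" and q = "\<lambda>_. q" and s = "\<lambda>_. s"
          and ?t0.0 = "\<lambda>_. inp x" and ?t1.0 = "\<lambda>_. t1" and u = "\<lambda>_. u" and k = "\<lambda>_. k" and S = S])
      (use assms in \<open>auto simp: inp_ge nth_list_update intro!: exI[of _ 1] execs_Skip\<close>)
  moreover have "ps[j := 0] = ps" using assms by (metis list_update_id)
  ultimately show ?thesis
    using loop_time_mono[OF assms(5), of 1 1 S] assms(6) by (auto intro: execs_mono)
qed

text \<open>The number of pairs belonging to \<open>n\<close> among the first \<open>e\<close>.
  While the scan has not passed the end of the advice, this is the number of its symbols already on
  the tape.\<close>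

definition before :: "nat \<Rightarrow> nat \<Rightarrow> nat" where
  "before n e = card {i. prod_encode (i, n) < e}"

lemma prod_encode_mono: "prod_encode (i, n) < prod_encode (j, n) \<longleftrightarrow> i < j"
proof -
  have tri: "triangle a \<le> triangle b" if "a \<le> b" for a b
    using that by (induction rule: dec_induct) auto
  have "prod_encode (i, n) < prod_encode (j, n)" if "i < j" for i j
    using that tri[of "i + n" "j + n"] by (auto simp: prod_encode_def)
  then show ?thesis by (metis less_asym' linorder_neqE_nat)
qed

lemma before_encode: "before n (prod_encode (i, n)) = i"
  by (simp add: before_def prod_encode_mono)

lemma before_Suc: "before n (Suc e) = before n e + (if snd (prod_decode e) = n then 1 else 0)"
proof -
  have fin: "finite {i. prod_encode (i, n) < e}"
    by (rule finite_subset[of _ "{..<e}"]) (use le_prod_encode_1 in \<open>auto intro: le_less_trans\<close>)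
  have "{i. prod_encode (i, n) < Suc e} = {i. prod_encode (i, n) < e} \<union> {i. prod_encode (i, n) = e}" by auto
  moreover have "{i. prod_encode (i, n) = e} = (if snd (prod_decode e) = n then {fst (prod_decode e)} else {})"
  proof -
    obtain a b where ab: "prod_decode e = (a, b)" by (cases "prod_decode e")
    then have "e = prod_encode (a, b)" by (metis prod_decode_inverse)
    then have "prod_encode (i, n) = e \<longleftrightarrow> i = a \<and> n = b" for i by simp
    then show ?thesis using ab by auto
  qed
  ultimately show ?thesis using fin by (auto simp: before_def card_insert_if)
qed

lemma before_mono: "e \<le> e' \<Longrightarrow> before n e \<le> before n e'"
  by (induction rule: dec_induct) (auto simp: before_Suc)

text \<open>The scan visits all pairs up to the code of \<open>(length (a n), n)\<close>. As the
  advice is polynomially long and the pairing quadratic, these are polynomially many, and so are the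
  letters of each query.\<close>

lemma main_in_P:
  assumes M: "wf_otm M" "\<And>y. halting M (run M {} y (pbound k' c' (length y)))"
    and len: "\<And>n. length (a n) \<le> n + pbound k c n"
    and L: "\<And>x. x \<in> L \<longleftrightarrow> cstate (run M {} (x @ [SH] @ a (length x))
        (pbound k' c' (length (x @ [SH] @ a (length x))))) = q_acc M"
  shows "L \<in> P_orc (bits a)"
proof -
  define A where "A n = n + pbound k c n" for n
  \<comment> \<open>An upper bound for the code of the pair at which the scan ends, from
    \<open>triangle m \<le> m * (m + 1)\<close>.\<close>
  define E where "E n = (A n + n) * (A n + n + 1) + A n" for n
  define S where "S n = 4 * E n + 2 * n + A n + pbound k' c' (2 * n + 2 + A n) + 10" for n
  define t where "t n = 2 * loop_time (S n) (S n) 1 + at_time (S n) + S n * (scan_time (S n) + 1) +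
    S n * (at_time (S n) + 10) + 20" for n
  have poly: "poly_bounded t"
    unfolding t_def scan_time_def ask_time_def S_def E_def A_def by (intro poly_bounded_intros poly_bounded_next_time)
  show ?thesis
  proof (rule decider[OF wfc_main_prog[OF M(1)] _ poly])
    fix x :: "sym list"
    define n where "n = length x"
    let ?z = "\<lambda>_. 0 :: nat" and ?S = "S n" and ?a = "a n" and ?b = "before n"
    \<comment> \<open>The first pair for \<open>n\<close> whose position lies outside the advice,
      hence the round in which all three questions are denied.\<close>
    define e0 where "e0 = prod_encode (length ?a, n)"
    let ?N = "\<lambda>e. snd (prod_decode e)" and ?I = "\<lambda>e. fst (prod_decode e)"
    let ?t = "\<lambda>e. inp (x @ [SH] @ take (?b e) ?a)"
    let ?ps = "\<lambda>e. [0, 0, n, n + 1 + ?b e, ?N e, ?I e, 3 * e, 0]"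
    have la: "length ?a \<le> A n" using len[of n] by (simp add: A_def)
    have tri: "triangle m \<le> m * (m + 1)" for m by (simp add: triangle_def)
    have mono: "(length ?a + n) * (length ?a + n + 1) \<le> (A n + n) * (A n + n + 1)"
      using la by (intro mult_mono) auto
    have e0: "e0 \<le> E n"
      using tri[of "length ?a + n"] la mono unfolding e0_def prod_encode_def E_def by simp
    have le_e: "?N e \<le> e" "?I e \<le> e" for e
      using le_prod_encode_1[of "?I e" "?N e"] le_prod_encode_2[of "?N e" "?I e"] by auto
    have b_le: "?b e \<le> length ?a" if "e \<le> e0" for e
      using before_mono[OF that, of n] by (simp add: e0_def before_encode)
    have b_le': "?b (Suc e0) \<le> Suc (length ?a)"
      by (simp add: before_Suc) (simp add: e0_def before_encode)
    have query: "unary (3 * e + d) \<in> bits a \<longleftrightarrow> ?b e < length ?a \<and> enc (?a ! ?b e) = d + 1"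
      if "?N e = n" "d \<le> 2" for e d
    proof -
      have "?b e = ?I e"
        using that(1) before_encode[of n "?I e"] by (metis prod.collapse prod_decode_inverse)
      moreover have "(3 * e + d) div 3 = e" "(3 * e + d) mod 3 = d" using that(2) by auto
      ultimately show ?thesis using that(1) unfolding unary_in_bits by (auto simp: split_beta)
    qed
    have body: "execs (bits a) scan_body (cfg (0, 0, 0) (?t e) ?z (?ps e) ?z 0) (scan_time ?S)
      (cfg (0, 0, 0) (?t (Suc e)) ?z (?ps (Suc e)) ?z 0)" if e: "e < e0" for e
    proof (rule execs_scan_body)
      show "prod_decode e = (?I e, ?N e)" "prod_decode (Suc e) = (?I (Suc e), ?N (Suc e))" by auto
      show "3 * e + 3 \<le> ?S" "?N e + ?I e < ?S" using e e0 le_e[of e] by (auto simp: S_def)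
      show w: "n + 1 + ?b e \<le> ?S" using b_le[of e] e la by (auto simp: S_def)
      show "?N e \<noteq> n \<Longrightarrow> n + 1 + ?b (Suc e) = n + 1 + ?b e \<and> ?t (Suc e) = ?t e \<and> 0 = (0 :: nat)"
        by (simp add: before_Suc)
      assume N: "?N e = n"
      then have b: "?b (Suc e) = Suc (?b e)" by (simp add: before_Suc)
      then have b': "n + 1 + ?b (Suc e) = Suc (n + 1 + ?b e)" by simp
      from b have lt: "?b e < length ?a" using b_le[of "Suc e"] e by simp
      have t: "?t (Suc e) = (?t e)(n + 1 + ?b e := enc (?a ! ?b e))"
        unfolding b take_Suc_conv_app_nth[OF lt]
        using inp_snoc[of "x @ [SH] @ take (?b e) ?a" "?a ! ?b e"] lt by (simp add: n_def)
      show "\<exists>f'. execs (bits a) ask_symbol (cfg (0, 1, 0) (?t e) ?z [0, 0, n, n + 1 + ?b e, ?N e, ?I e, 3 * e, 0] ?z 0)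
          (3 * ask_time ?S + 1) (cfg (0, f', 0) (?t (Suc e)) ?z [0, 0, n, n + 1 + ?b (Suc e), ?N e, ?I e, 3 * e, 0] ?z 0)"
        unfolding t b'
        by (rule execs_ask_symbol_yes) (use w query[OF N] lt e e0 in \<open>auto simp: S_def\<close>)
    qed
    have last: "execs (bits a) scan_body (cfg (0, 0, 0) (?t e0) ?z (?ps e0) ?z 0) (scan_time ?S)
      (cfg (0, 0, 1) (?t e0) ?z [0, 0, n, n + 1 + ?b e0, ?N (Suc e0), ?I (Suc e0), 3 * Suc e0, 0] ?z 0)"
    proof (rule execs_scan_body)
      have N: "?N e0 = n" and b: "?b e0 = length ?a" by (simp_all add: e0_def before_encode)
      show "prod_decode e0 = (?I e0, ?N e0)" "prod_decode (Suc e0) = (?I (Suc e0), ?N (Suc e0))" by auto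
      show "3 * e0 + 3 \<le> ?S" "?N e0 + ?I e0 < ?S" using e0 le_e[of e0] by (auto simp: S_def)
      show w: "n + 1 + ?b e0 \<le> ?S" using b_le[of e0] la by (auto simp: S_def)
      show "?N e0 \<noteq> n \<Longrightarrow> n + 1 + ?b e0 = n + 1 + ?b e0 \<and> ?t e0 = ?t e0 \<and> 1 = (0 :: nat)" using N by simp
      have "execs (bits a) ask_symbol (cfg (0, 1, 0) (?t e0) ?z [0, 0, n, n + 1 + ?b e0, ?N e0, ?I e0, 3 * e0, 0] ?z 0)
          (3 * ask_time ?S + 1) (cfg (0, 0, 1) (?t e0) ?z [0, 0, n, n + 1 + ?b e0, ?N e0, ?I e0, 3 * e0, 0] ?z 0)"
        by (rule execs_ask_symbol_no) (use query[OF N] b e0 in \<open>auto simp: S_def\<close>)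
      then show "\<exists>f'. execs (bits a) ask_symbol (cfg (0, 1, 0) (?t e0) ?z [0, 0, n, n + 1 + ?b e0, ?N e0, ?I e0, 3 * e0, 0] ?z 0)
          (3 * ask_time ?S + 1) (cfg (0, f', 1) (?t e0) ?z [0, 0, n, n + 1 + ?b e0, ?N e0, ?I e0, 3 * e0, 0] ?z 0)" by blast
    qed
    define p where "p = [n, n + 1 + ?b e0, ?N (Suc e0), ?I (Suc e0), 3 * Suc e0, 0]"
    define y where "y = x @ [SH] @ ?a"
    have y: "?t e0 = inp y" by (simp add: y_def e0_def before_encode)
    \<comment> \<open>Round \<open>e0\<close> writes nothing and only sets the digit to 1, so the
      final state does not follow the pattern of the earlier ones.\<close>
    define D where "D e = (if e \<le> e0 then cfg (0, 0, 0) (?t e) ?z (?ps e) ?z 0 else cfg (0, 0, 1) (inp y) ?z (0 # 0 # p) ?z 0)" for e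
    have "execs (bits a) (WhlR (\<lambda>(q, f, s). s = 0) scan_body) (D 0) (Suc e0 * (scan_time ?S + 1) + 1) (D (Suc e0))"
    proof (rule execs_WhlR)
      fix e assume "e < Suc e0"
      then show "(case reg_of (D e) of (q, f, s) \<Rightarrow> s = 0) \<and> execs (bits a) scan_body (D e) (scan_time ?S) (D (Suc e))"
        using body[of e] last y by (cases "e = e0") (auto simp: D_def p_def)
    qed (simp add: D_def)
    moreover have "D 0 = cfg (0, 0, 0) (inp (x @ [SH])) ?z [0, 0, n, n + 1, 0, 0, 0, 0] ?z 0"
      using le_e[of 0] by (simp add: D_def before_def)
    moreover have "D (Suc e0) = cfg (0, 0, 1) (inp y) ?z (0 # 0 # p) ?z 0" by (simp add: D_def)
    moreover have "Suc e0 * (scan_time ?S + 1) \<le> ?S * (scan_time ?S + 1)"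
      using e0 by (intro mult_mono) (auto simp: S_def)
    ultimately have 5: "execs (bits a) (WhlR (\<lambda>(q, f, s). s = 0) scan_body)
      (cfg (0, 0, 0) (inp (x @ [SH])) ?z [0, 0, n, n + 1, 0, 0, 0, 0] ?z 0) (?S * (scan_time ?S + 1) + 1)
      (cfg (0, 0, 1) (inp y) ?z (0 # 0 # p) ?z 0)"
      by (auto intro: execs_mono)
    have 1: "execs (bits a) (init_marks 8) (ini x) 1 (cfg (0,0,0) (inp x) ?z [0, 0, 0, 0, 0, 0, 0, 0] ?z 0)"
      using execs_init_marks[of "bits a" 8 x] by (simp add: numeral_eq_Suc)
    have 2: "execs (bits a) (to_end 2) (cfg (0,0,0) (inp x) ?z [0, 0, 0, 0, 0, 0, 0, 0] ?z 0) (loop_time ?S ?S 1)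
      (cfg (0,0,0) (inp x) ?z [0, 0, n, 0, 0, 0, 0, 0] ?z 0)"
      by (rule execs_to_end) (auto simp: n_def S_def)
    have 3: "execs (bits a) (to_end 3) (cfg (0,0,0) (inp x) ?z [0, 0, n, 0, 0, 0, 0, 0] ?z 0) (loop_time ?S ?S 1)
      (cfg (0,0,0) (inp x) ?z [0, 0, n, n, 0, 0, 0, 0] ?z 0)"
      by (rule execs_to_end) (auto simp: n_def S_def)
    have 4: "execs (bits a) (At 3 (\<lambda>r a0 a1 m b. (r, 3, a1, Rgt, b, Stay)))
      (cfg (0,0,0) (inp x) ?z [0, 0, n, n, 0, 0, 0, 0] ?z 0) (at_time ?S)
      (cfg (0,0,0) (inp (x @ [SH])) ?z [0, 0, n, n + 1, 0, 0, 0, 0] ?z 0)"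
      by (rule execs_At_case) (auto simp: S_def inp_snoc n_def)
    have 6: "execs (bits a) (Reg (\<lambda>(q, f, s). (q_start M, f, s))) (cfg (0, 0, 1) (inp y) ?z (0 # 0 # p) ?z 0) 1
      (sim_state 0 1 ?z p (init M y))"
      using execs_Reg[of "bits a" "\<lambda>(q, f, s). (q_start M, f, s)" "(0, 0, 1)"] by (simp add: sim_state_init)
    obtain t' where t': "t' \<le> pbound k' c' (length y)" "halting M (run M {} y t')"
      "\<And>i. i < t' \<Longrightarrow> \<not> halting M (run M {} y i)" "run M {} y t' = run M {} y (pbound k' c' (length y))"
      using halting_first[OF M(2)] by blast
    have "length y \<le> 2 * n + 2 + A n" using la by (simp add: y_def n_def)
    from le_trans[OF t'(1) pbound_mono[OF this]] have t'S: "t' \<le> ?S" by (simp add: S_def)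
    have 7: "execs (bits a) (sim M Skip (empty_query M)) (sim_state 0 1 ?z p (init M y))
      (t' * (Suc 0 + at_time ?S + 3 + 3) + 1) (sim_state 0 1 ?z p (run M {} y t'))"
      by (rule execs_sim[where p = "\<lambda>_. p" and S = ?S])
        (use M(1) t' t'S in \<open>auto simp: run_Suc intro!: execs_empty_query\<close>, auto simp: sim_state_def intro!: execs_Skip)
    let ?c = "run M {} y t'"
    let ?s = "cfg (cstate ?c, if cstate ?c = q_acc M then 1 else 0, 1) (tp1 ?c) ?z (0 # hd1 ?c # p) (tp2 ?c) (hd2 ?c)"
    have 8: "execs (bits a) (final_test M) (sim_state 0 1 ?z p ?c) 1 ?s"
      using execs_Reg[of "bits a" "\<lambda>(q, f, s). (q, if q = q_acc M then 1 else 0, s)" "(cstate ?c, 0, 1)" "tp1 ?c" ?z "0 # hd1 ?c # p" "tp2 ?c" "hd2 ?c"]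
      by (simp add: final_test_def sim_state_def)
    have "t' * (Suc 0 + at_time ?S + 3 + 3) \<le> ?S * (at_time ?S + 10)" using t'S by (intro mult_mono) auto
    then have "execs (bits a) (main_prog M) (ini x) (t (length x)) ?s"
      unfolding main_prog_def n_def[symmetric]
      by (intro execs_mono[OF execs_Seq[OF 1 execs_Seq[OF 2 execs_Seq[OF 3 execs_Seq[OF 4 execs_Seq[OF 5 execs_Seq[OF 6 execs_Seq[OF 7 8]]]]]]]])
        (simp add: t_def)
    moreover have "x \<in> L \<longleftrightarrow> acc_reg (st_reg ?s)"
      unfolding L n_def[symmetric] y_def[symmetric] t'(4)[symmetric] by (simp add: cfg_def)
    ultimately show "\<exists>s. execs (bits a) (main_prog M) (ini x) (t (length x)) s \<and> (x \<in> L \<longleftrightarrow> acc_reg (st_reg s))" by blast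
  qed simp
qed

section \<open>Tabulating a unary oracle\<close>

text \<open>Coefficient and exponent of the table length are constants of the machine; the
  repetitions they govern are unrolled into the program.\<close>

fun rep :: "nat \<Rightarrow> com \<Rightarrow> com" where
  "rep 0 c = Skip"
| "rep (Suc i) c = c ;; rep i c"

lemma wfc_rep: "wfc R c \<Longrightarrow> wfc R (rep i c)"
  by (induction i) (auto intro: wfc_Skip)

lemma execs_rep:
  assumes "\<And>i. i < n \<Longrightarrow> execs Or c (cfg r t0 t1 (ps i) u k) B (cfg r t0 t1 (ps (Suc i)) u k)"
  shows "execs Or (rep n c) (cfg r t0 t1 (ps 0) u k) (n * (B + 1) + 1) (cfg r t0 t1 (ps n) u k)"
  using assms
proof (induction n arbitrary: ps)
  case 0 then show ?case using execs_Skip by simp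
next
  case (Suc n)
  have "execs Or (rep n c) (cfg r t0 t1 (ps (Suc 0)) u k) (n * (B + 1) + 1) (cfg r t0 t1 (ps (Suc n)) u k)"
    using Suc.IH[of "\<lambda>i. ps (Suc i)"] Suc.prems by simp
  from execs_Seq[OF Suc.prems[of 0] this] show ?case by (auto intro: execs_mono)
qed

text \<open>Unary multiplication of pointer 3 by \<open>n + 1\<close>, with \<open>n\<close> in
  pointer 2: each unit of pointer 3 moves pointer 4 by one and then, counted by pointer 5, by
  \<open>n\<close> more. The product is finally carried back to pointer 3.\<close>

definition times_Suc :: com where
  "times_Suc = Loop 3 (\<lambda>a0 a1 m b. m 0) (\<lambda>a0 a1 b. (a0, a1, Lft, b, Stay))
      (shift 4 Rgt ;; Loop 5 (\<lambda>a0 a1 m b. m 2) (\<lambda>a0 a1 b. (a0, a1, Rgt, b, Stay)) (shift 4 Rgt) ;; reset 5) ;;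
    Loop 4 (\<lambda>a0 a1 m b. m 0) (\<lambda>a0 a1 b. (a0, a1, Lft, b, Stay)) (shift 3 Rgt) ;;
    Reg (\<lambda>(q, f, s). (q, 0, s))"

text \<open>Pointer 7 is moved once per simulated step, hence bounds the part of track 0 that has to be erased
  afterwards; the final \<open>Qry\<close> serves only to erase the second tape.\<close>

definition table_body :: "otm \<Rightarrow> com" where
  "table_body M = fill 7 6 2 ;; Reg (\<lambda>(q, f, s). (q_start M, f, s)) ;; sim M (shift 7 Rgt) (real_query M) ;;
     At 6 (\<lambda>(q, f, s) a0 a1 m b. ((q, f, s), a0, if q = q_acc M then 2 else 1, Stay, b, Stay)) ;;
     Loop 7 (\<lambda>a0 a1 m b. m 0) (\<lambda>a0 a1 b. (0, a1, Lft, b, Stay)) Skip ;;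
     At 7 (\<lambda>r a0 a1 m b. (r, 0, a1, Stay, b, Stay)) ;; reset 1 ;; Qry (\<lambda>(q, f, s) v. (0, f, s)) ;; shift 6 Rgt"

text \<open>The table grows on track 1 because track 0 serves as work tape of the repeated
  simulations. The last loop turns each entry into a plain symbol on track 0, which also wipes out
  the pointer marks in these cells.\<close>

definition table_prog :: "otm \<Rightarrow> nat \<Rightarrow> nat \<Rightarrow> com" where
  "table_prog M d e = init_marks 8 ;;
     Loop 2 (\<lambda>a0 a1 m b. a0 = 0) (\<lambda>a0 a1 b. (0, a1, Rgt, b, Stay)) Skip ;;
     rep d (shift 3 Rgt) ;; rep e times_Suc ;;
     Loop 6 (\<lambda>a0 a1 m b. m 3) (\<lambda>a0 a1 b. (a0, a1, Stay, b, Stay)) (table_body M) ;;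
     Whl (\<lambda>r a. a 1 \<noteq> 0) (Act (\<lambda>r a b. (r, raw (a 1), Rgt, b, Stay)))"

lemma wfc_table_prog:
  assumes "wf_otm M" shows "wfc (nstates M + nsyms M + 12) (table_prog M d e)"
proof -
  have "q_start M < nstates M" using assms by (simp add: wf_otm_def)
  moreover have "wfc R (Act (\<lambda>r a b. (r, raw (a 1), Rgt, b, Stay)))" for R
    by (auto simp: valid_cell_def raw_def)
  ultimately show ?thesis
    unfolding table_prog_def times_Suc_def table_body_def
    by (auto intro!: wfc_init_marks wfc_At wfc_Loop wfc_Reg wfc_reset wfc_sim wfc_queries assms wfc_shift
        wfc_rep wfc_Skip wfc_fill wfc_Qry
        simp: valid_reg_def simp del: wfc.simps(1,2))
qed

definition times_time :: "nat \<Rightarrow> nat" where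
  "times_time S = loop_time S S (at_time S + loop_time S S (at_time S) + loop_time S S 1 + 5) + loop_time S S (at_time S) + 10"

lemma execs_times_Suc:
  assumes S: "y * (n + 1) < S" "n < S" "y < S"
  shows "execs Or times_Suc (cfg (0, 0, 0) t0 t1 [0, 0, n, y, 0, 0, 0, 0] u k) (times_time S)
    (cfg (0, 0, 0) t0 t1 [0, 0, n, y * (n + 1), 0, 0, 0, 0] u k)"
proof -
  let ?B = "at_time S + loop_time S S (at_time S) + loop_time S S 1 + 5"
  have 1: "execs Or (Loop 3 (\<lambda>a0 a1 m b. m 0) (\<lambda>a0 a1 b. (a0, a1, Lft, b, Stay))
      (shift 4 Rgt ;; Loop 5 (\<lambda>a0 a1 m b. m 2) (\<lambda>a0 a1 b. (a0, a1, Rgt, b, Stay)) (shift 4 Rgt) ;; reset 5))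
     (cfg (0, 0, 0) t0 t1 [0, 0, n, y - 0, 0 * (n + 1), 0, 0, 0] u k) (loop_time S y ?B)
     (cfg (0, 0, 0) t0 t1 [0, 0, n, y - y, y * (n + 1), 0, 0, 0] u k)"
  proof (rule execs_Loop[where ps = "\<lambda>i. [0, 0, n, y - i, i * (n + 1), 0, 0, 0]" and q = "\<lambda>_. 0" and s = "\<lambda>_. 0"
          and ?t0.0 = "\<lambda>_. t0" and ?t1.0 = "\<lambda>_. t1" and u = "\<lambda>_. u" and k = "\<lambda>_. k" and S = S], goal_cases)
    case (5 i)
    have le: "Suc i * (n + 1) \<le> y * (n + 1)" using 5 by (intro mult_right_mono) auto
    then have le': "i * (n + 1) + n + 1 < S" using S by simp
    have a: "execs Or (shift 4 Rgt) (cfg (0, 1, 0) t0 t1 [0, 0, n, y - Suc i, i * (n + 1), 0, 0, 0] u k) (at_time S)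
      (cfg (0, 1, 0) t0 t1 [0, 0, n, y - Suc i, Suc (i * (n + 1)) + 0, 0, 0, 0] u k)"
      by (rule execs_shift) (use le' in auto)
    have b: "execs Or (Loop 5 (\<lambda>a0 a1 m b. m 2) (\<lambda>a0 a1 b. (a0, a1, Rgt, b, Stay)) (shift 4 Rgt))
      (cfg (0, 1, 0) t0 t1 [0, 0, n, y - Suc i, Suc (i * (n + 1)) + 0, 0, 0, 0] u k) (loop_time S n (at_time S))
      (cfg (0, 0, 0) t0 t1 [0, 0, n, y - Suc i, Suc (i * (n + 1)) + n, n, 0, 0] u k)"
      by (rule execs_Loop[where ps = "\<lambda>j. [0, 0, n, y - Suc i, Suc (i * (n + 1)) + j, j, 0, 0]" and q = "\<lambda>_. 0" and s = "\<lambda>_. 0"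
          and ?t0.0 = "\<lambda>_. t0" and ?t1.0 = "\<lambda>_. t1" and u = "\<lambda>_. u" and k = "\<lambda>_. k" and S = S])
        (use S le' in \<open>auto simp: marks_def intro!: exI[of _ 1] execs_shift\<close>)
    have c: "execs Or (reset 5) (cfg (0, 0, 0) t0 t1 [0, 0, n, y - Suc i, Suc (i * (n + 1)) + n, n, 0, 0] u k) (loop_time S S 1)
      (cfg (0, 0, 0) t0 t1 [0, 0, n, y - Suc i, Suc i * (n + 1), 0, 0, 0] u k)"
      by (rule execs_reset) (use S in auto)
    have "loop_time S n (at_time S) \<le> loop_time S S (at_time S)" using S by (intro loop_time_mono) auto
    then have "execs Or (shift 4 Rgt ;; Loop 5 (\<lambda>a0 a1 m b. m 2) (\<lambda>a0 a1 b. (a0, a1, Rgt, b, Stay)) (shift 4 Rgt) ;; reset 5)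
      (cfg (0, 1, 0) t0 t1 [0, 0, n, y - Suc i, i * (n + 1), 0, 0, 0] u k) ?B
      (cfg (0, 0, 0) t0 t1 [0, 0, n, y - Suc i, Suc i * (n + 1), 0, 0, 0] u k)"
      by (intro execs_mono[OF execs_Seq[OF a execs_Seq[OF b c]]]) simp
    then show ?case by auto
  qed (use S in \<open>auto simp: marks_def\<close>)
  let ?z = "y * (n + 1)"
  have 2: "execs Or (Loop 4 (\<lambda>a0 a1 m b. m 0) (\<lambda>a0 a1 b. (a0, a1, Lft, b, Stay)) (shift 3 Rgt))
     (cfg (0, 0, 0) t0 t1 [0, 0, n, 0, ?z - 0, 0, 0, 0] u k) (loop_time S ?z (at_time S))
     (cfg (0, 0, 0) t0 t1 [0, 0, n, ?z, ?z - ?z, 0, 0, 0] u k)"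
    by (rule execs_Loop[where ps = "\<lambda>i. [0, 0, n, i, ?z - i, 0, 0, 0]" and q = "\<lambda>_. 0" and s = "\<lambda>_. 0"
          and ?t0.0 = "\<lambda>_. t0" and ?t1.0 = "\<lambda>_. t1" and u = "\<lambda>_. u" and k = "\<lambda>_. k" and S = S])
      (use S in \<open>auto simp: marks_def intro!: exI[of _ 1] execs_shift simp del: mult_Suc_right add_mult_distrib2\<close>)
  have "loop_time S y ?B \<le> loop_time S S ?B" "loop_time S ?z (at_time S) \<le> loop_time S S (at_time S)"
    using S by (intro loop_time_mono; simp)+
  with execs_Seq[OF 1[simplified diff_self_eq_0] execs_Seq[OF 2[unfolded diff_zero] execs_flag[where v = 0]]]
  show ?thesis unfolding times_Suc_def
    by (auto simp: times_time_def intro: execs_mono)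
qed

definition table_tape :: "lang \<Rightarrow> nat \<Rightarrow> nat \<Rightarrow> nat" where
  "table_tape U m i = (if i < m then (if unary i \<in> U then 2 else 1) else 0)"

definition body_time :: "nat \<Rightarrow> nat" where
  "body_time S = 3 * loop_time S S 1 + S * (2 * at_time S + 10) + 3 * at_time S + 20"

lemma execs_table_body:
  assumes M: "wf_otm M" "halting M (run M Or (unary m) t)"
    and U: "unary m \<in> U \<longleftrightarrow> cstate (run M Or (unary m) t) = q_acc M" and S: "m + t < S"
  shows "execs Or (table_body M) (cfg (0, f, 0) (\<lambda>_. 0) (table_tape U m) [0, 0, n, y, 0, 0, m, 0] (\<lambda>_. 0) 0) (body_time S)
    (cfg (0, 0, 0) (\<lambda>_. 0) (table_tape U (Suc m)) [0, 0, n, y, 0, 0, Suc m, 0] (\<lambda>_. 0) 0)"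
proof -
  let ?z = "\<lambda>_. 0 :: nat"
  obtain t' where t': "t' \<le> t" "halting M (run M Or (unary m) t')" "\<And>i. i < t' \<Longrightarrow> \<not> halting M (run M Or (unary m) i)"
    "run M Or (unary m) t' = run M Or (unary m) t" using halting_first[OF M(2)] by blast
  define c where "c = run M Or (unary m) t'"
  \<comment> \<open>Pointer 7 starts behind the \<open>m\<close> input cells and moves once per
    step; hence its final position bounds all nonblank cells of the simulated tape.\<close>
  define E where "E = m + t'"
  have hc: "hd1 c \<le> t'" unfolding c_def by (rule run_bounds)
  have zero: "tp1 c x = 0" if "E \<le> x" for x
    unfolding c_def by (rule run_bounds) (use that in \<open>simp add: E_def unary_def\<close>)
  have 1: "execs Or (fill 7 6 2) (cfg (0, f, 0) ?z (table_tape U m) [0, 0, n, y, 0, 0, m, 0] ?z 0) (loop_time S S 1)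
    (cfg (0, 0, 0) (inp (unary m)) (table_tape U m) [0, 0, n, y, 0, 0, m, m] ?z 0)"
    by (rule execs_fill) (use S in \<open>auto simp: inp_unary fun_eq_iff\<close>)
  have 2: "execs Or (Reg (\<lambda>(q, f, s). (q_start M, f, s))) (cfg (0, 0, 0) (inp (unary m)) (table_tape U m) [0, 0, n, y, 0, 0, m, m] ?z 0) 1
    (sim_state 0 0 (table_tape U m) [n, y, 0, 0, m, m + 0] (init M (unary m)))"
    using execs_Reg[of Or "\<lambda>(q, f, s). (q_start M, f, s)" "(0, 0, 0)"] by (simp add: sim_state_init)
  have 3: "execs Or (sim M (shift 7 Rgt) (real_query M)) (sim_state 0 0 (table_tape U m) [n, y, 0, 0, m, m + 0] (init M (unary m)))
    (t' * (at_time S + at_time S + 3 + 3) + 1) (sim_state 0 0 (table_tape U m) [n, y, 0, 0, m, E] c)"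
    unfolding c_def E_def
  proof (rule execs_sim[where p = "\<lambda>i. [n, y, 0, 0, m, m + i]" and S = S], goal_cases)
    case (5 i)
    then show ?case unfolding sim_state_def by (intro execs_shift) (use S t'(1) in auto)
  next
    case (6 i)
    then show ?case using execs_real_query[OF M(1)] by (simp add: run_Suc)
  qed (use M(1) t' S in auto)
  have 4: "execs Or (At 6 (\<lambda>(q, f, s) a0 a1 m b. ((q, f, s), a0, if q = q_acc M then 2 else 1, Stay, b, Stay)))
    (sim_state 0 0 (table_tape U m) [n, y, 0, 0, m, E] c) (at_time S)
    (cfg (cstate c, 0, 0) (tp1 c) (table_tape U (Suc m)) [0, hd1 c, n, y, 0, 0, m, E] (tp2 c) (hd2 c))"
    unfolding sim_state_def
  proof (rule execs_At_case, goal_cases)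
    case 5
    have "(table_tape U m)(m := if cstate c = q_acc M then 2 else 1) = table_tape U (Suc m)"
      using U t'(4) by (auto simp: table_tape_def fun_eq_iff c_def)
    then show ?case by simp
  qed (use S in auto)
  let ?t = "\<lambda>i x. if E - i < x then 0 else tp1 c x"
  have 5: "execs Or (Loop 7 (\<lambda>a0 a1 m b. m 0) (\<lambda>a0 a1 b. (0, a1, Lft, b, Stay)) Skip)
    (cfg (cstate c, 0, 0) (?t 0) (table_tape U (Suc m)) [0, hd1 c, n, y, 0, 0, m, E - 0] (tp2 c) (hd2 c)) (loop_time S E 1)
    (cfg (cstate c, 0, 0) (?t E) (table_tape U (Suc m)) [0, hd1 c, n, y, 0, 0, m, E - E] (tp2 c) (hd2 c))"
  proof (rule execs_Loop[where ps = "\<lambda>i. [0, hd1 c, n, y, 0, 0, m, E - i]" and q = "\<lambda>_. cstate c" and s = "\<lambda>_. 0"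
          and ?t0.0 = ?t and ?t1.0 = "\<lambda>_. table_tape U (Suc m)" and u = "\<lambda>_. tp2 c" and k = "\<lambda>_. hd2 c" and S = S], goal_cases)
    case (5 i)
    have "(?t i)(E - i := 0) = ?t (Suc i)" using 5 by (auto simp: fun_eq_iff)
    then show ?case by (auto intro!: exI[of _ 1] execs_Skip)
  qed (use S t'(1) in \<open>auto simp: marks_def E_def\<close>)
  have t0: "?t 0 = tp1 c" using zero by (auto simp: fun_eq_iff)
  have tE: "(?t E)(0 := 0) = ?z" by (auto simp: fun_eq_iff)
  \<comment> \<open>The erasing loop stops on reaching cell 0 without acting there, so this cell is
    cleared separately.\<close>
  have 6: "execs Or (At 7 (\<lambda>r a0 a1 m b. (r, 0, a1, Stay, b, Stay)))
    (cfg (cstate c, 0, 0) (?t E) (table_tape U (Suc m)) [0, hd1 c, n, y, 0, 0, m, E - E] (tp2 c) (hd2 c)) (at_time S)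
    (cfg (cstate c, 0, 0) ?z (table_tape U (Suc m)) [0, hd1 c, n, y, 0, 0, m, 0] (tp2 c) (hd2 c))"
    by (rule execs_At_case) (use tE in auto)
  have 7: "execs Or (reset 1) (cfg (cstate c, 0, 0) ?z (table_tape U (Suc m)) [0, hd1 c, n, y, 0, 0, m, 0] (tp2 c) (hd2 c)) (loop_time S S 1)
    (cfg (cstate c, 0, 0) ?z (table_tape U (Suc m)) [0, 0, n, y, 0, 0, m, 0] (tp2 c) (hd2 c))"
    by (rule execs_reset) (use hc S t'(1) in auto)
  have 8: "execs Or (Qry (\<lambda>(q, f, s) v. (0, f, s))) (cfg (cstate c, 0, 0) ?z (table_tape U (Suc m)) [0, 0, n, y, 0, 0, m, 0] (tp2 c) (hd2 c)) 3
    (cfg (0, 0, 0) ?z (table_tape U (Suc m)) [0, 0, n, y, 0, 0, m, 0] ?z 0)"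
    using execs_Qry[of Or "\<lambda>(q, f, s) v. (0, f, s)" "(cstate c, 0, 0)"] by simp
  have 9: "execs Or (shift 6 Rgt) (cfg (0, 0, 0) ?z (table_tape U (Suc m)) [0, 0, n, y, 0, 0, m, 0] ?z 0) (at_time S)
    (cfg (0, 0, 0) ?z (table_tape U (Suc m)) [0, 0, n, y, 0, 0, Suc m, 0] ?z 0)"
    by (rule execs_shift) (use S in auto)
  have "loop_time S E 1 \<le> loop_time S S 1" using S t'(1) by (intro loop_time_mono) (auto simp: E_def)
  moreover have "t' * (at_time S + at_time S + 3 + 3) \<le> S * (2 * at_time S + 10)" using t'(1) S by (intro mult_mono) auto
  ultimately show ?thesis unfolding table_body_def
    by (intro execs_mono[OF execs_Seq[OF 1 execs_Seq[OF 2 execs_Seq[OF 3 execs_Seq[OF 4 execs_Seq[OF 5[unfolded t0, unfolded diff_zero]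
              execs_Seq[OF 6 execs_Seq[OF 7 execs_Seq[OF 8 9]]]]]]]]]) (simp add: body_time_def)
qed

definition table :: "lang \<Rightarrow> nat \<Rightarrow> sym list" where
  "table U y = map (\<lambda>m. if unary m \<in> U then S1 else S0) [0..<y]"

lemma execs_unload:
  "execs Or (Whl (\<lambda>r a. a 1 \<noteq> 0) (Act (\<lambda>r a b. (r, raw (a 1), Rgt, b, Stay)))) (cfg r t0 (table_tape U y) ps u k) (y * (1 + 1) + 1)
    (St r (\<lambda>x. if x < y then raw (table_tape U y x) else cells t0 (table_tape U y) ps x) y u k)"
proof -
  let ?m = "cells t0 (table_tape U y) ps"
  let ?t = "\<lambda>i x. if x < i then raw (table_tape U y x) else ?m x"
  have m1: "?m x 1 = table_tape U y x" for x by (simp add: cells_def)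
  have "execs Or (Whl (\<lambda>r a. a 1 \<noteq> 0) (Act (\<lambda>r a b. (r, raw (a 1), Rgt, b, Stay)))) (St r (?t 0) 0 u k) (y * (1 + 1) + 1)
    (St r (?t y) y u k)"
  proof (rule execs_Whl[where n = y and \<sigma> = "\<lambda>i. St r (?t i) i u k"], goal_cases)
    case (1 i)
    have "(?t i)(i := raw (?t i i 1)) = ?t (Suc i)" by (auto simp: fun_eq_iff m1 cells_def)
    then have "execs Or (Act (\<lambda>r a b. (r, raw (a 1), Rgt, b, Stay))) (St r (?t i) i u k) 1 (St r (?t (Suc i)) (Suc i) u k)"
      using execs_Act[of "\<lambda>r a b. (r, raw (a 1), Rgt, b, Stay)" r "?t i" i u k r "raw (?t i i 1)" Rgt "u k" Stay Or, OF refl]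
      by (simp only: fun_upd_triv move.simps Suc_eq_plus1)
    then show ?case using 1 by (simp add: m1[unfolded One_nat_def] table_tape_def)
  next
    case 2
    show ?case by (simp add: m1[unfolded One_nat_def]) (simp add: table_tape_def)
  qed
  then show ?thesis by (simp add: cfg_def)
qed

text \<open>Each of the polynomially many entries costs one run of the decider of \<open>U\<close>
  on a word shorter than the table, so the total time is polynomial in \<open>n\<close>.\<close>

lemma table_advice:
  assumes M: "wf_otm M" "\<And>x. halting M (run M Or x (pbound k c (length x)))"
    and U: "\<And>x. x \<in> U \<longleftrightarrow> cstate (run M Or x (pbound k c (length x))) = q_acc M"
  shows "\<exists>T k d. wf_otm T \<and> (\<forall>n. halting T (run T Or (unary n) (pbound k d n)) \<and>
    read_word (tp1 (run T Or (unary n) (pbound k d n))) = table U (d0 * (n + 1) ^ e))"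
proof -
  define Y where "Y n = d0 * (n + 1) ^ e" for n
  define S where "S n = 2 * Y n + pbound k c (Y n) + n + d0 + 10" for n
  define t where "t n = loop_time (S n) (S n) 1 + d0 * (at_time (S n) + 1) + e * (times_time (S n) + 1) +
     loop_time (S n) (S n) (body_time (S n)) + S n * 2 + 20" for n
  have poly: "poly_bounded t"
    unfolding t_def times_time_def body_time_def S_def Y_def by (intro poly_bounded_intros)
  show ?thesis
  proof (rule transducer[OF wfc_table_prog[OF M(1), of d0 e] _ poly, of Or "\<lambda>n. table U (d0 * (n + 1) ^ e)"])
    fix n
    let ?S = "S n" and ?z = "\<lambda>_. 0 :: nat"
    have 1: "execs Or (init_marks 8) (ini (unary n)) 1 (cfg (0,0,0) (inp (unary n)) ?z [0, 0, 0, 0, 0, 0, 0, 0] ?z 0)"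
      using execs_init_marks[of Or 8 "unary n"] by (simp add: numeral_eq_Suc)
    let ?t = "\<lambda>i x. if x < i then 0 else inp (unary n) x"
    have 2: "execs Or (Loop 2 (\<lambda>a0 a1 m b. a0 = 0) (\<lambda>a0 a1 b. (0, a1, Rgt, b, Stay)) Skip)
      (cfg (0,0,0) (?t 0) ?z [0, 0, 0, 0, 0, 0, 0, 0] ?z 0) (loop_time ?S n 1) (cfg (0,0,0) (?t n) ?z [0, 0, n, 0, 0, 0, 0, 0] ?z 0)"
    proof (rule execs_Loop[where ps = "\<lambda>i. [0, 0, i, 0, 0, 0, 0, 0]" and q = "\<lambda>_. 0" and s = "\<lambda>_. 0"
          and ?t0.0 = ?t and ?t1.0 = "\<lambda>_. ?z" and u = "\<lambda>_. ?z" and k = "\<lambda>_. 0" and S = ?S], goal_cases)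
      case (5 i)
      have "(?t i)(i := 0) = ?t (Suc i)" by (auto simp: fun_eq_iff)
      then show ?case by (auto intro!: exI[of _ 1] execs_Skip)
    qed (auto simp: S_def inp_unary)
    have tz: "?t 0 = inp (unary n)" by simp
    have tn: "?t n = ?z" by (auto simp: inp_unary fun_eq_iff)
    have 3: "execs Or (rep d0 (shift 3 Rgt)) (cfg (0,0,0) ?z ?z [0, 0, n, 0, 0, 0, 0, 0] ?z 0) (d0 * (at_time ?S + 1) + 1)
      (cfg (0,0,0) ?z ?z [0, 0, n, d0, 0, 0, 0, 0] ?z 0)"
      by (rule execs_rep[where ps = "\<lambda>i. [0, 0, n, i, 0, 0, 0, 0]"], rule execs_shift) (auto simp: S_def)
    have 4: "execs Or (rep e times_Suc) (cfg (0,0,0) ?z ?z [0, 0, n, d0 * (n + 1) ^ 0, 0, 0, 0, 0] ?z 0) (e * (times_time ?S + 1) + 1)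
      (cfg (0,0,0) ?z ?z [0, 0, n, d0 * (n + 1) ^ e, 0, 0, 0, 0] ?z 0)"
    proof (rule execs_rep[where ps = "\<lambda>i. [0, 0, n, d0 * (n + 1) ^ i, 0, 0, 0, 0]"])
      fix i assume i: "i < e"
      have *: "d0 * (n + 1) ^ j \<le> Y n" if "j \<le> e" for j
        unfolding Y_def using that by (intro mult_left_mono power_increasing) auto
      have "execs Or times_Suc (cfg (0,0,0) ?z ?z [0, 0, n, d0 * (n + 1) ^ i, 0, 0, 0, 0] ?z 0) (times_time ?S)
        (cfg (0,0,0) ?z ?z [0, 0, n, d0 * (n + 1) ^ i * (n + 1), 0, 0, 0, 0] ?z 0)"
        by (rule execs_times_Suc) (use *[of i] *[of "Suc i"] i in \<open>auto simp: S_def mult_ac\<close>)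
      then show "execs Or times_Suc (cfg (0,0,0) ?z ?z [0, 0, n, d0 * (n + 1) ^ i, 0, 0, 0, 0] ?z 0) (times_time ?S)
        (cfg (0,0,0) ?z ?z [0, 0, n, d0 * (n + 1) ^ Suc i, 0, 0, 0, 0] ?z 0)" by (simp only: power_Suc mult_ac)
    qed
    have 5: "execs Or (Loop 6 (\<lambda>a0 a1 m b. m 3) (\<lambda>a0 a1 b. (a0, a1, Stay, b, Stay)) (table_body M))
      (cfg (0,0,0) ?z (table_tape U 0) [0, 0, n, Y n, 0, 0, 0, 0] ?z 0) (loop_time ?S (Y n) (body_time ?S))
      (cfg (0,0,0) ?z (table_tape U (Y n)) [0, 0, n, Y n, 0, 0, Y n, 0] ?z 0)"
    proof (rule execs_Loop[where ps = "\<lambda>m. [0, 0, n, Y n, 0, 0, m, 0]" and q = "\<lambda>_. 0" and s = "\<lambda>_. 0"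
          and ?t0.0 = "\<lambda>_. ?z" and ?t1.0 = "table_tape U" and u = "\<lambda>_. ?z" and k = "\<lambda>_. 0" and S = ?S], goal_cases)
      case (5 m)
      have l: "length (unary m) = m" by (simp add: unary_def)
      have "execs Or (table_body M) (cfg (0, 1, 0) ?z (table_tape U m) [0, 0, n, Y n, 0, 0, m, 0] ?z 0) (body_time ?S)
        (cfg (0, 0, 0) ?z (table_tape U (Suc m)) [0, 0, n, Y n, 0, 0, Suc m, 0] ?z 0)"
      proof (rule execs_table_body[OF M(1)])
        show "halting M (run M Or (unary m) (pbound k c m))" using M(2)[of "unary m"] by (simp add: l)
        show "unary m \<in> U \<longleftrightarrow> cstate (run M Or (unary m) (pbound k c m)) = q_acc M" using U[of "unary m"] by (simp add: l)
        show "m + pbound k c m < ?S" using pbound_mono[of m "Y n" k c] 5 by (simp add: S_def)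
      qed
      then show ?case by auto
    qed (auto simp: S_def marks_def)
    have 6: "execs Or (Whl (\<lambda>r a. a 1 \<noteq> 0) (Act (\<lambda>r a b. (r, raw (a 1), Rgt, b, Stay))))
      (cfg (0,0,0) ?z (table_tape U (Y n)) [0, 0, n, Y n, 0, 0, Y n, 0] ?z 0) (Y n * (1 + 1) + 1)
      (St (0,0,0) (\<lambda>x. if x < Y n then raw (table_tape U (Y n) x) else cells ?z (table_tape U (Y n)) [0, 0, n, Y n, 0, 0, Y n, 0] x) (Y n) ?z 0)"
      by (rule execs_unload)
    let ?s = "St (0,0,0) (\<lambda>x. if x < Y n then raw (table_tape U (Y n) x) else cells ?z (table_tape U (Y n)) [0, 0, n, Y n, 0, 0, Y n, 0] x) (Y n) ?z 0"
    have tab0: "table_tape U 0 = ?z" by (auto simp: table_tape_def)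
    have "loop_time ?S n 1 \<le> loop_time ?S ?S 1" "loop_time ?S (Y n) (body_time ?S) \<le> loop_time ?S ?S (body_time ?S)"
      by (intro loop_time_mono; simp add: S_def)+
    moreover have "Y n \<le> ?S" by (simp add: S_def)
    ultimately have A: "execs Or (table_prog M d0 e) (ini (unary n)) (t n) ?s"
      unfolding table_prog_def
      by (intro execs_mono[OF execs_Seq[OF 1 execs_Seq[OF 2[unfolded tn tz] execs_Seq[OF 3
          execs_Seq[OF 4[unfolded power_0 mult_1_right, folded Y_def] execs_Seq[OF 5[unfolded tab0] 6]]]]]])
        (simp add: t_def)
    have L: "length (table U (Y n)) = Y n" by (simp add: table_def)
    have N: "raw (enc (table U (Y n) ! i)) = raw (table_tape U (Y n) i)" if "i < Y n" for i
      using that by (simp add: table_def table_tape_def)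
    \<comment> \<open>The cell behind the table is not blank, since pointers 3 and 6 are marked in
      it; but its track 0 is 0, which suffices to end the output word.\<close>
    have K: "cells ?z (table_tape U (Y n)) [0, 0, n, Y n, 0, 0, Y n, 0] (Y n) \<noteq> raw j" if "j \<in> {1,2,3}" for j
    proof
      assume "cells ?z (table_tape U (Y n)) [0, 0, n, Y n, 0, 0, Y n, 0] (Y n) = raw j"
      then have "cells ?z (table_tape U (Y n)) [0, 0, n, Y n, 0, 0, Y n, 0] (Y n) 0 = raw j 0" by (simp only:)
      then show False using that by (auto simp: cells_def raw_def)
    qed
    show "\<exists>s. execs Or (table_prog M d0 e) (ini (unary n)) (t n) s \<and>
      (\<forall>i<length (table U (d0 * (n + 1) ^ e)). st_tape s i = raw (enc (table U (d0 * (n + 1) ^ e) ! i))) \<and>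
      (\<forall>j\<in>{1,2,3}. st_tape s (length (table U (d0 * (n + 1) ^ e))) \<noteq> raw j)"
      unfolding Y_def[symmetric] L
    proof (intro exI conjI)
      show "execs Or (table_prog M d0 e) (ini (unary n)) (t n) ?s" by (rule A)
      show "\<forall>i<Y n. st_tape ?s i = raw (enc (table U (Y n) ! i))" using N by simp
      show "\<forall>j\<in>{1,2,3}. st_tape ?s (Y n) \<noteq> raw j" using K by simp
    qed
  qed simp
qed

section \<open>Simulation with a table as oracle and clock\<close>

text \<open>Pointer 3, the clock, is never to the left of the second head, so moving the latter left that often
  rewinds it.  The last query only erases the second tape.\<close>

definition lookup :: "otm \<Rightarrow> com" where
  "lookup M = Loop 5 (\<lambda>a0 a1 m b. m 3) (\<lambda>a0 a1 b. (a0, a1, Rgt, b, Lft)) Skip ;; reset 5 ;;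
     upto 4 2 ;; shift 4 Rgt ;; Loop 4 (\<lambda>a0 a1 m b. b \<noteq> 2) (\<lambda>a0 a1 b. (a0, a1, Rgt, b, Rgt)) Skip ;;
     At 4 (\<lambda>(q, f, s) a0 a1 m b.
       ((if b \<notin> {1,3} \<and> a1 = 2 then q_yes M else q_no M, f, s), a0, a1, Stay, b, Stay)) ;;
     reset 4 ;; Qry (\<lambda>r v. r)"

text \<open>A blank on track 1 under the clock means that the table is used up. Switching to
  \<open>q_rej\<close> ends the simulation; the step that is still executed in this round leaves a
  halting state unchanged.\<close>

definition clock_body :: "otm \<Rightarrow> com" where
  "clock_body M = At 3 (\<lambda>(q, f, s) a0 a1 m b.
       ((if a1 = 0 then q_rej M else q, f, s), a0, a1, if a1 = 0 then Stay else Rgt, b, Stay)) ;;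
     sim_step M (lookup M)"

text \<open>The table is moved from track 0 to track 1 so that the simulated machine finds just
  \<open>x\<close> on its tape. Entry \<open>m\<close> keeps its place in cell
  \<open>n + 1 + m\<close>, where both the clock and the lookup expect it.\<close>

definition clock_prog :: "otm \<Rightarrow> com" where
  "clock_prog M = upto 3 2 ;; shift 3 Rgt ;;
     Loop 3 (\<lambda>a0 a1 m b. a0 = 0) (\<lambda>a0 a1 b. (0, a0, Rgt, b, Stay)) Skip ;; reset 3 ;; upto 3 2 ;; shift 3 Rgt ;;
     Reg (\<lambda>(q, f, s). (q_start M, f, s)) ;;
     WhlR (\<lambda>(q, f, s). q \<noteq> q_acc M \<and> q \<noteq> q_rej M) (clock_body M) ;; final_test M"

text \<open>The separator is sought from the right, as \<open>x\<close> may contain further ones. If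
  the search reaches cell 0 without finding any, the flag stays 0 and the word is rejected.\<close>

definition check_prog :: "otm \<Rightarrow> com" where
  "check_prog M = init_marks 6 ;; to_end 2 ;;
     Loop 2 (\<lambda>a0 a1 m b. a0 = 3 \<or> m 0) (\<lambda>a0 a1 b. (a0, a1, Lft, b, Stay)) Skip ;;
     At 2 (\<lambda>(q, f, s) a0 a1 m b. ((q, if a0 = 3 then 1 else 0, s), if a0 = 3 then 0 else a0, a1, Stay, b, Stay)) ;;
     CondR (\<lambda>(q, f, s). f = 1) (clock_prog M) Skip"

lemma wfc_check_prog:
  assumes "wf_otm M" shows "wfc (nstates M + nsyms M + 12) (check_prog M)"
proof -
  have "q_start M < nstates M" "q_rej M < nstates M" "q_yes M < nstates M" "q_no M < nstates M"
    using assms by (simp_all add: wf_otm_def)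
  then show ?thesis
    unfolding check_prog_def clock_prog_def clock_body_def lookup_def sim_step_def
    by (auto intro!: wfc_init_marks wfc_At wfc_Loop wfc_Reg wfc_reset wfc_sim_move assms wfc_shift
        wfc_to_end wfc_upto wfc_final_test wfc_Qry wfc_Skip
        simp: valid_reg_def simp del: wfc.simps(1,2))
qed

text \<open>The oracle represented by an arbitrary word \<open>b\<close>. Simulating with
  \<open>listed b\<close> allows a correctness statement without any assumption that
  \<open>b\<close> is a true table.\<close>

definition listed :: "sym list \<Rightarrow> lang" where
  "listed b = {unary m |m. m < length b \<and> b ! m = S1}"

definition tail_tape :: "nat \<Rightarrow> sym list \<Rightarrow> nat \<Rightarrow> nat" where
  "tail_tape n b i = (if n < i \<and> i - n - 1 < length b then enc (b ! (i - n - 1)) else 0)"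

lemma enc_simps: "enc y = 2 \<longleftrightarrow> y = S1" "enc y = 3 \<longleftrightarrow> y = SH" "enc y \<noteq> 0"
  by (cases y; simp)+

lemma tail_tape_2: "tail_tape n b (Suc (n + m)) = 2 \<longleftrightarrow> unary m \<in> listed b"
  by (auto simp: tail_tape_def listed_def enc_simps unary_inj)

text \<open>Let \<open>m\<close> be the first cell without a 1. If it holds another input symbol,
  the query word is not unary and the answer is no; otherwise the word is \<open>unary m\<close>,
  and entry \<open>m\<close> of the table decides. A blank entry beyond the table also gives
  no.\<close>

lemma read_word_listed:
  assumes "\<And>j. j < m \<Longrightarrow> u j = 2" "u m \<noteq> 2" "\<exists>j. u j \<notin> {1,2,3}"
  shows "read_word u \<in> listed b \<longleftrightarrow> u m \<notin> {1,3} \<and> tail_tape n b (Suc (n + m)) = 2"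
proof (cases "u m \<in> {1,3}")
  case True
  have len: "m < length (read_word u)"
  proof (rule ccontr)
    assume "\<not> m < length (read_word u)"
    moreover have "u (length (read_word u)) \<notin> {1,2,3}" using read_word_props(2)[OF assms(3)] .
    ultimately show False using assms(1)[of "length (read_word u)"] True
      by (cases "length (read_word u) = m") auto
  qed
  have "enc (read_word u ! m) = u m" using read_word_props(1)[OF assms(3) len] by blast
  then have "read_word u ! m \<noteq> S1" using assms(2) by auto
  then have "read_word u \<notin> listed b" using len by (auto simp: listed_def unary_def)
  then show ?thesis using True by simp
next
  case False
  have "(LEAST n. u n \<notin> {1,2,3}) = m"
  proof (rule Least_equality)
    fix j assume "u j \<notin> {1,2,3}"
    then show "m \<le> j" using assms(1)[of j] by (metis insertCI not_le)
  qed (use False assms(2) in auto)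
  then have "read_word u = unary m"
    unfolding read_word_def unary_def using assms(1) by (auto simp: dec_def list_eq_iff_nth_eq)
  then show ?thesis using False by (simp add: tail_tape_2)
qed

definition lookup_time :: "nat \<Rightarrow> nat" where
  "lookup_time S = 5 * loop_time S S 1 + 2 * at_time S + 20"

lemma execs_lookup:
  assumes M: "wf_otm M" "cstate c = q_query M"
    and S: "hd2 c \<le> C" "C \<le> S" "\<And>j. B \<le> j \<Longrightarrow> tp2 c j = 0" "n + B < S"
  shows "execs Or (lookup M) (sim_state 0 0 (tail_tape n b) [n, C, 0, 0] c) (lookup_time S)
    (sim_state 0 0 (tail_tape n b) [n, C, 0, 0] (step M (listed b) c))"
proof -
  let ?t = "tail_tape n b" and ?u = "tp2 c" and ?q = "cstate c" and ?h = "hd1 c"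
  define m where "m = (LEAST j. ?u j \<noteq> 2)"
  have uB: "?u B \<noteq> 2" using S(3)[of B] by simp
  have m: "?u m \<noteq> 2" "m \<le> B" unfolding m_def using uB by (rule LeastI, rule Least_le)
  have lt: "?u j = 2" if "j < m" for j using that not_less_Least unfolding m_def by blast
  let ?ans = "if ?u m \<notin> {1,3} \<and> ?t (Suc (n + m)) = 2 then q_yes M else q_no M"
  have 1: "execs Or (Loop 5 (\<lambda>a0 a1 m b. m 3) (\<lambda>a0 a1 b. (a0, a1, Rgt, b, Lft)) Skip)
     (cfg (?q, 0, 0) (tp1 c) ?t [0, ?h, n, C, 0, 0] ?u (hd2 c - 0)) (loop_time S C 1)
     (cfg (?q, 0, 0) (tp1 c) ?t [0, ?h, n, C, 0, C] ?u (hd2 c - C))"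
    by (rule execs_Loop[where ps = "\<lambda>i. [0, ?h, n, C, 0, i]" and q = "\<lambda>_. ?q" and s = "\<lambda>_. 0"
          and ?t0.0 = "\<lambda>_. tp1 c" and ?t1.0 = "\<lambda>_. ?t" and u = "\<lambda>_. ?u" and k = "\<lambda>i. hd2 c - i" and S = S])
      (use S in \<open>auto simp: marks_def intro!: exI[of _ 1] execs_Skip\<close>)
  have 2: "execs Or (reset 5) (cfg (?q, 0, 0) (tp1 c) ?t [0, ?h, n, C, 0, C] ?u 0) (loop_time S S 1)
     (cfg (?q, 0, 0) (tp1 c) ?t [0, ?h, n, C, 0, 0] ?u 0)"
    by (rule execs_reset) (use S in auto)
  have 3: "execs Or (upto 4 2) (cfg (?q, 0, 0) (tp1 c) ?t [0, ?h, n, C, 0, 0] ?u 0) (loop_time S S 1)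
     (cfg (?q, 0, 0) (tp1 c) ?t [0, ?h, n, C, n, 0] ?u 0)"
    by (rule execs_upto) (use S in auto)
  have 4: "execs Or (shift 4 Rgt) (cfg (?q, 0, 0) (tp1 c) ?t [0, ?h, n, C, n, 0] ?u 0) (at_time S)
     (cfg (?q, 0, 0) (tp1 c) ?t [0, ?h, n, C, Suc (n + 0), 0] ?u 0)"
    by (rule execs_shift) (use S in auto)
  have 5: "execs Or (Loop 4 (\<lambda>a0 a1 m b. b \<noteq> 2) (\<lambda>a0 a1 b. (a0, a1, Rgt, b, Rgt)) Skip)
     (cfg (?q, 0, 0) (tp1 c) ?t [0, ?h, n, C, Suc (n + 0), 0] ?u 0) (loop_time S m 1)
     (cfg (?q, 0, 0) (tp1 c) ?t [0, ?h, n, C, Suc (n + m), 0] ?u m)"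
    by (rule execs_Loop[where ps = "\<lambda>i. [0, ?h, n, C, Suc (n + i), 0]" and q = "\<lambda>_. ?q" and s = "\<lambda>_. 0"
          and ?t0.0 = "\<lambda>_. tp1 c" and ?t1.0 = "\<lambda>_. ?t" and u = "\<lambda>_. ?u" and k = "\<lambda>i. i" and S = S])
      (use S m lt in \<open>auto simp: fun_upd_idem intro!: exI[of _ 1] execs_Skip\<close>)
  have 6: "execs Or (At 4 (\<lambda>(q, f, s) a0 a1 m b.
       ((if b \<notin> {1,3} \<and> a1 = 2 then q_yes M else q_no M, f, s), a0, a1, Stay, b, Stay)))
     (cfg (?q, 0, 0) (tp1 c) ?t [0, ?h, n, C, Suc (n + m), 0] ?u m) (at_time S)
     (cfg (?ans, 0, 0) (tp1 c) ?t [0, ?h, n, C, Suc (n + m), 0] ?u m)"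
    by (rule execs_At_case) (use S m in auto)
  have 7: "execs Or (reset 4) (cfg (?ans, 0, 0) (tp1 c) ?t [0, ?h, n, C, Suc (n + m), 0] ?u m) (loop_time S S 1)
     (cfg (?ans, 0, 0) (tp1 c) ?t [0, ?h, n, C, 0, 0] ?u m)"
    by (rule execs_reset) (use S m in auto)
  have 8: "execs Or (Qry (\<lambda>r v. r)) (cfg (?ans, 0, 0) (tp1 c) ?t [0, ?h, n, C, 0, 0] ?u m) 3
     (cfg (?ans, 0, 0) (tp1 c) ?t [0, ?h, n, C, 0, 0] (\<lambda>_. 0) 0)"
    by (rule execs_Qry)
  have "\<exists>j. ?u j \<notin> {1,2,3}" using S(3)[of B] by (intro exI[of _ B]) simp
  from read_word_listed[of m ?u, OF lt m(1) this, of b n]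
  have fin: "cfg (?ans, 0, 0) (tp1 c) ?t [0, ?h, n, C, 0, 0] (\<lambda>_. 0) 0 = sim_state 0 0 ?t [n, C, 0, 0] (step M (listed b) c)"
    using M(2) not_halting_query[OF M] by (simp add: sim_state_def step_def)
  have "loop_time S C 1 \<le> loop_time S S 1" "loop_time S m 1 \<le> loop_time S S 1" using S m by (intro loop_time_mono; simp)+
  then show ?thesis
    unfolding lookup_def fin[symmetric] unfolding sim_state_def
    by (intro execs_mono[OF execs_Seq[OF 1[unfolded diff_zero diff_is_0_eq[THEN iffD2, OF S(1)]]
            execs_Seq[OF 2 execs_Seq[OF 3 execs_Seq[OF 4 execs_Seq[OF 5 execs_Seq[OF 6 execs_Seq[OF 7 8]]]]]]]])
      (simp add: lookup_time_def)
qed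

definition accepts_within :: "otm \<Rightarrow> sym list \<Rightarrow> sym list \<Rightarrow> bool" where
  "accepts_within M x b \<longleftrightarrow> (\<exists>t\<le>length b. cstate (run M (listed b) x t) = q_acc M)"

definition clock_time :: "nat \<Rightarrow> nat" where
  "clock_time S = S * (2 * at_time S + lookup_time S + 10) + 10"

lemma execs_clock_step:
  assumes M: "wf_otm M" and i: "i < length b" and S: "2 * length b + n + 3 < S"
  shows "execs Or (clock_body M) (sim_state 0 0 (tail_tape n b) [n, Suc (n + i), 0, 0] (run M (listed b) x i))
    (2 * at_time S + lookup_time S + 2) (sim_state 0 0 (tail_tape n b) [n, Suc (n + Suc i), 0, 0] (run M (listed b) x (Suc i)))"
proof -
  let ?c = "run M (listed b) x i"
  have "tail_tape n b (Suc (n + i)) \<noteq> 0" using i by (simp add: tail_tape_def enc_simps)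
  then have 1: "execs Or (At 3 (\<lambda>(q, f, s) a0 a1 m b.
       ((if a1 = 0 then q_rej M else q, f, s), a0, a1, if a1 = 0 then Stay else Rgt, b, Stay)))
      (sim_state 0 0 (tail_tape n b) [n, Suc (n + i), 0, 0] ?c) (at_time S)
      (sim_state 0 0 (tail_tape n b) [n, Suc (n + Suc i), 0, 0] ?c)"
    unfolding sim_state_def by (intro execs_At_case) (use i S in auto)
  have 2: "execs Or (sim_step M (lookup M)) (sim_state 0 0 (tail_tape n b) [n, Suc (n + Suc i), 0, 0] ?c)
    (at_time S + lookup_time S + 1) (sim_state 0 0 (tail_tape n b) [n, Suc (n + Suc i), 0, 0] (run M (listed b) x (Suc i)))"
    unfolding run_Suc
  proof (rule execs_sim_step[OF valid_config_run[OF M]])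
    show "hd1 ?c \<le> S" using run_bounds(1)[of M "listed b" x i] i S by linarith
    assume q: "cstate ?c = q_query M"
    show "execs Or (lookup M) (sim_state 0 0 (tail_tape n b) [n, Suc (n + Suc i), 0, 0] ?c) (lookup_time S)
      (sim_state 0 0 (tail_tape n b) [n, Suc (n + Suc i), 0, 0] (step M (listed b) ?c))"
      by (rule execs_lookup[OF M q, where B = i])
        (use run_bounds(2)[of M "listed b" x i] run_bounds(4)[where n = i and x = x] i S in auto)
  qed
  show ?thesis unfolding clock_body_def by (rule execs_mono[OF execs_Seq[OF 1 2]]) simp
qed

text \<open>The final configuration is left existential because after a time-out it does not occur
  in the run of \<open>M\<close>; only its verdict is specified.\<close>

lemma execs_clock_loop:
  assumes M: "wf_otm M" and S: "2 * length b + n + 3 < S"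
  shows "\<exists>c p. execs Or (WhlR (\<lambda>(q, f, s). q \<noteq> q_acc M \<and> q \<noteq> q_rej M) (clock_body M))
    (sim_state 0 0 (tail_tape n b) [n, Suc n, 0, 0] (init M x)) (clock_time S) (sim_state 0 0 (tail_tape n b) p c) \<and>
    (cstate c = q_acc M \<longleftrightarrow> accepts_within M x b)"
proof -
  let ?r = "run M (listed b) x" and ?p = "\<lambda>i. [n, Suc (n + i), 0, 0]"
  let ?W = "WhlR (\<lambda>(q, f, s). q \<noteq> q_acc M \<and> q \<noteq> q_rej M) (clock_body M)"
  let ?B = "2 * at_time S + lookup_time S + 3"
  have bnd: "m * (?B + 1) + 1 \<le> clock_time S" if "m \<le> Suc (length b)" for m
  proof -
    have "m * (?B + 1) \<le> S * (2 * at_time S + lookup_time S + 10)" using that S by (intro mult_mono) auto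
    then show ?thesis by (simp add: clock_time_def)
  qed
  have step: "execs Or (clock_body M) (sim_state 0 0 (tail_tape n b) (?p i) (?r i)) ?B (sim_state 0 0 (tail_tape n b) (?p (Suc i)) (?r (Suc i)))"
    if "i < length b" for i
    using execs_clock_step[OF M that S] by (rule execs_mono) simp
  have start: "sim_state 0 0 (tail_tape n b) (?p 0) (?r 0) = sim_state 0 0 (tail_tape n b) [n, Suc n, 0, 0] (init M x)"
    by (simp add: run_0)
  show ?thesis
  proof (cases "halting M (?r (length b))")
    case True
    then obtain t where t: "t \<le> length b" "halting M (?r t)" "\<And>i. i < t \<Longrightarrow> \<not> halting M (?r i)"
      "?r t = ?r (length b)" using halting_first by blast
    have "execs Or ?W (sim_state 0 0 (tail_tape n b) (?p 0) (?r 0)) (t * (?B + 1) + 1) (sim_state 0 0 (tail_tape n b) (?p t) (?r t))"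
    proof (rule execs_WhlR[where \<sigma> = "\<lambda>i. sim_state 0 0 (tail_tape n b) (?p i) (?r i)"])
      fix i assume i: "i < t"
      then have "\<not> halting M (?r i)" using t(3) by blast
      then show "(case reg_of (sim_state 0 0 (tail_tape n b) (?p i) (?r i)) of (q, f, s) \<Rightarrow> q \<noteq> q_acc M \<and> q \<noteq> q_rej M) \<and>
        execs Or (clock_body M) (sim_state 0 0 (tail_tape n b) (?p i) (?r i)) ?B (sim_state 0 0 (tail_tape n b) (?p (Suc i)) (?r (Suc i)))"
        using step[of i] i t(1) by (simp add: sim_state_def halting_def)
    qed (use t(2) in \<open>auto simp: sim_state_def halting_def\<close>)
    then have "execs Or ?W (sim_state 0 0 (tail_tape n b) [n, Suc n, 0, 0] (init M x)) (clock_time S) (sim_state 0 0 (tail_tape n b) (?p t) (?r t))"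
      unfolding start using bnd[of t] t(1) by (auto intro: execs_mono)
    moreover have "cstate (?r t) = q_acc M \<longleftrightarrow> accepts_within M x b"
    proof
      assume "accepts_within M x b"
      then obtain t' where t': "t' \<le> length b" "cstate (?r t') = q_acc M" by (auto simp: accepts_within_def)
      then have "?r (length b) = ?r t'" by (intro run_halted) (auto simp: halting_def)
      then show "cstate (?r t) = q_acc M" using t'(2) t(4) by simp
    qed (use t(1) in \<open>auto simp: accepts_within_def\<close>)
    ultimately show ?thesis by blast
  next
    case False
    then have nh: "\<not> halting M (?r i)" if "i \<le> length b" for i using run_halted[OF _ that] by metis
    \<comment> \<open>The effect of the time-out: everything remains as after
      \<open>length b\<close> steps except the state. This takes one extra round, number
      \<open>length b\<close>.\<close>
    let ?c = "?r (length b)\<lparr>cstate := q_rej M\<rparr>" and ?l = "length b"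
    have rej: "valid_config M ?c" "halting M ?c" "q_rej M \<noteq> q_query M" "q_acc M \<noteq> q_rej M"
      using valid_config_run[OF M, of "listed b" x ?l] M by (auto simp: valid_config_def halting_def wf_otm_def)
    have 1: "execs Or (At 3 (\<lambda>(q, f, s) a0 a1 m b.
         ((if a1 = 0 then q_rej M else q, f, s), a0, a1, if a1 = 0 then Stay else Rgt, b, Stay)))
        (sim_state 0 0 (tail_tape n b) (?p ?l) (?r ?l)) (at_time S) (sim_state 0 0 (tail_tape n b) (?p ?l) ?c)"
      unfolding sim_state_def by (intro execs_At_case) (use S in \<open>auto simp: tail_tape_def fun_upd_idem\<close>)
    have "execs Or (sim_step M (lookup M)) (sim_state 0 0 (tail_tape n b) (?p ?l) ?c) (at_time S + 0 + 1)
      (sim_state 0 0 (tail_tape n b) (?p ?l) (step M {} ?c))"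
      by (rule execs_sim_step[OF rej(1)]) (use rej run_bounds(1)[of M "listed b" x ?l] S in auto)
    moreover have "step M {} ?c = ?c" using rej(2) by (simp add: step_def)
    ultimately have last: "execs Or (clock_body M) (sim_state 0 0 (tail_tape n b) (?p ?l) (?r ?l)) ?B (sim_state 0 0 (tail_tape n b) (?p ?l) ?c)"
      unfolding clock_body_def by (intro execs_mono[OF execs_Seq[OF 1]]) auto
    let ?D = "\<lambda>i. if i \<le> ?l then sim_state 0 0 (tail_tape n b) (?p i) (?r i) else sim_state 0 0 (tail_tape n b) (?p ?l) ?c"
    have "execs Or ?W (?D 0) (Suc ?l * (?B + 1) + 1) (?D (Suc ?l))"
    proof (rule execs_WhlR[where \<sigma> = ?D])
      fix i assume i: "i < Suc ?l"
      have "execs Or (clock_body M) (?D i) ?B (?D (Suc i))"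
        using step[of i] last i by (cases "i = ?l") auto
      then show "(case reg_of (?D i) of (q, f, s) \<Rightarrow> q \<noteq> q_acc M \<and> q \<noteq> q_rej M) \<and>
        execs Or (clock_body M) (?D i) ?B (?D (Suc i))"
        using nh[of i] i by (simp add: sim_state_def halting_def)
    qed (simp add: sim_state_def)
    then have "execs Or ?W (sim_state 0 0 (tail_tape n b) (?p 0) (?r 0)) (Suc ?l * (?B + 1) + 1) (sim_state 0 0 (tail_tape n b) (?p ?l) ?c)"
      by simp
    then have "execs Or ?W (sim_state 0 0 (tail_tape n b) [n, Suc n, 0, 0] (init M x)) (clock_time S) (sim_state 0 0 (tail_tape n b) (?p ?l) ?c)"
      unfolding start using bnd[of "Suc ?l"] by (auto intro: execs_mono)
    moreover have "\<not> accepts_within M x b" using nh by (auto simp: accepts_within_def halting_def)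
    ultimately show ?thesis using rej(4) by (intro exI conjI) auto
  qed
qed

lemma execs_clock_prog:
  assumes M: "wf_otm M" and b: "SH \<notin> set b" and S: "2 * length b + n + 3 < S" "n = length x"
  shows "\<exists>s. execs Or (clock_prog M) (cfg (0, 1, 0) (\<lambda>i. if i = n then 0 else inp (x @ [SH] @ b) i) (\<lambda>_. 0) [0, 0, n, 0, 0, 0] (\<lambda>_. 0) 0)
    (5 * loop_time S S 1 + 2 * at_time S + clock_time S + 20) s \<and> (acc_reg (st_reg s) \<longleftrightarrow> accepts_within M x b)"
proof -
  let ?z = "\<lambda>_. 0 :: nat" and ?l = "length b"
  \<comment> \<open>Track 0 after \<open>j\<close> entries have been moved. The separator in cell
    \<open>n\<close> has been erased before, so for \<open>j = length b\<close> only
    \<open>x\<close> remains.\<close>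
  let ?t = "\<lambda>j i. if i = n \<or> n < i \<and> i \<le> n + j then 0 else inp (x @ [SH] @ b) i"
  let ?w = "\<lambda>j. tail_tape n (take j b)"
  have 1: "execs Or (upto 3 2) (cfg (0, 1, 0) (?t 0) ?z [0, 0, n, 0, 0, 0] ?z 0) (loop_time S S 1)
    (cfg (0, 0, 0) (?t 0) ?z [0, 0, n, n, 0, 0] ?z 0)"
    by (rule execs_upto) (use S in auto)
  have 2: "execs Or (shift 3 Rgt) (cfg (0, 0, 0) t0 t1 [0, 0, n, n, 0, 0] ?z 0) (at_time S)
    (cfg (0, 0, 0) t0 t1 [0, 0, n, Suc (n + 0), 0, 0] ?z 0)" for t0 t1
    by (rule execs_shift) (use S in auto)
  have inp: "inp (x @ [SH] @ b) (Suc (n + j)) = (if j < ?l then enc (b ! j) else 0)" for j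
    using S(2) by (auto simp: inp_def nth_append)
  have 3: "execs Or (Loop 3 (\<lambda>a0 a1 m b. a0 = 0) (\<lambda>a0 a1 b. (0, a0, Rgt, b, Stay)) Skip)
    (cfg (0, 0, 0) (?t 0) (?w 0) [0, 0, n, Suc (n + 0), 0, 0] ?z 0) (loop_time S ?l 1)
    (cfg (0, 0, 0) (?t ?l) (?w ?l) [0, 0, n, Suc (n + ?l), 0, 0] ?z 0)"
  proof (rule execs_Loop[where ps = "\<lambda>i. [0, 0, n, Suc (n + i), 0, 0]" and q = "\<lambda>_. 0" and s = "\<lambda>_. 0"
          and ?t0.0 = ?t and ?t1.0 = ?w and u = "\<lambda>_. ?z" and k = "\<lambda>_. 0" and S = S], goal_cases)
    case (5 j)
    have "(?t j)(Suc (n + j) := 0) = ?t (Suc j)" by (auto simp: fun_eq_iff)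
    moreover have "(?w j)(Suc (n + j) := ?t j (Suc (n + j))) = ?w (Suc j)"
    proof
      fix i
      show "((?w j)(Suc (n + j) := ?t j (Suc (n + j)))) i = ?w (Suc j) i"
      proof (cases "i = Suc (n + j)")
        case True
        then show ?thesis using 5 by (simp add: inp tail_tape_def del: append_Cons append_Nil append.simps)
      next
        case False
        then have "i - n - 1 < Suc j \<longleftrightarrow> i - n - 1 < j" if "n < i" using that by auto
        then show ?thesis using False 5 by (auto simp: tail_tape_def)
      qed
    qed
    ultimately show ?case by (auto intro!: exI[of _ 1] execs_Skip)
  qed (use S inp in \<open>auto simp: enc_simps\<close>)
  have 4: "execs Or (reset 3) (cfg (0, 0, 0) (?t ?l) (?w ?l) [0, 0, n, Suc (n + ?l), 0, 0] ?z 0) (loop_time S S 1)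
    (cfg (0, 0, 0) (?t ?l) (?w ?l) [0, 0, n, 0, 0, 0] ?z 0)"
    by (rule execs_reset) (use S in auto)
  have 5: "execs Or (upto 3 2) (cfg (0, 0, 0) (?t ?l) (?w ?l) [0, 0, n, 0, 0, 0] ?z 0) (loop_time S S 1)
    (cfg (0, 0, 0) (?t ?l) (?w ?l) [0, 0, n, n, 0, 0] ?z 0)"
    by (rule execs_upto) (use S in auto)
  have tl: "?t ?l = inp x"
  proof
    fix i
    consider "i < n" | "i = n" | j where "i = Suc (n + j)" by (metis less_iff_Suc_add linorder_neqE_nat)
    then show "?t ?l i = inp x i"
      by cases (use S(2) in \<open>auto simp: inp_def nth_append\<close>)
  qed
  have wl: "?w ?l = tail_tape n b" "?w 0 = ?z" by (auto simp: tail_tape_def)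
  have 7: "execs Or (Reg (\<lambda>(q, f, s). (q_start M, f, s))) (cfg (0, 0, 0) (inp x) (tail_tape n b) [0, 0, n, Suc (n + 0), 0, 0] ?z 0) 1
    (sim_state 0 0 (tail_tape n b) [n, Suc n, 0, 0] (init M x))"
    using execs_Reg[of Or "\<lambda>(q, f, s). (q_start M, f, s)" "(0, 0, 0)"] by (simp add: sim_state_init)
  obtain c p where 8: "execs Or (WhlR (\<lambda>(q, f, s). q \<noteq> q_acc M \<and> q \<noteq> q_rej M) (clock_body M))
    (sim_state 0 0 (tail_tape n b) [n, Suc n, 0, 0] (init M x)) (clock_time S) (sim_state 0 0 (tail_tape n b) p c)"
    and c: "cstate c = q_acc M \<longleftrightarrow> accepts_within M x b"
    using execs_clock_loop[OF M S(1), of Or x] by blast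
  let ?s = "cfg (cstate c, if cstate c = q_acc M then 1 else 0, 0) (tp1 c) (tail_tape n b) (0 # hd1 c # p) (tp2 c) (hd2 c)"
  have 9: "execs Or (final_test M) (sim_state 0 0 (tail_tape n b) p c) 1 ?s"
    using execs_Reg[of Or "\<lambda>(q, f, s). (q, if q = q_acc M then 1 else 0, s)" "(cstate c, 0, 0)" "tp1 c" "tail_tape n b"
        "0 # hd1 c # p" "tp2 c" "hd2 c"]
    by (simp add: final_test_def sim_state_def)
  have t0: "?t 0 = (\<lambda>i. if i = n then 0 else inp (x @ [SH] @ b) i)" by (auto simp: fun_eq_iff)
  have "loop_time S ?l 1 \<le> loop_time S S 1" using S by (intro loop_time_mono) auto
  then have "execs Or (clock_prog M) (cfg (0, 1, 0) (\<lambda>i. if i = n then 0 else inp (x @ [SH] @ b) i) ?z [0, 0, n, 0, 0, 0] ?z 0)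
    (5 * loop_time S S 1 + 2 * at_time S + clock_time S + 20) ?s"
    unfolding clock_prog_def t0[symmetric]
    by (intro execs_mono[OF execs_Seq[OF 1 execs_Seq[OF 2 execs_Seq[OF 3[unfolded wl tl] execs_Seq[OF 4[unfolded wl tl]
              execs_Seq[OF 5[unfolded wl tl] execs_Seq[OF 2 execs_Seq[OF 7 execs_Seq[OF 8 9]]]]]]]]]) simp
  moreover have "acc_reg (st_reg ?s) \<longleftrightarrow> accepts_within M x b" using c by (simp add: cfg_def)
  ultimately show ?thesis by blast
qed

text \<open>Reversal turns the last separator into the first one, for which a plain induction on the
  prefix works.\<close>

lemma last_SH_unique:
  assumes "SH \<notin> set b" "SH \<notin> set b'" "x @ [SH] @ b = x' @ [SH] @ b'"
  shows "x = x' \<and> b = b'"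
proof -
  have *: "SH \<notin> set u \<Longrightarrow> SH \<notin> set u' \<Longrightarrow> u @ SH # v = u' @ SH # v' \<Longrightarrow> u = u' \<and> v = v'" for u u' v v'
  proof (induction u arbitrary: u')
    case Nil then show ?case by (cases u') auto
  next
    case (Cons y u) then show ?case by (cases u') auto
  qed
  from assms(3) have "rev (x @ [SH] @ b) = rev (x' @ [SH] @ b')" by (rule arg_cong)
  then have "rev b @ SH # rev x = rev b' @ SH # rev x'" by simp
  from *[OF _ _ this] assms(1,2) show ?thesis by simp
qed

text \<open>Forbidding the separator in \<open>b\<close> makes the decomposition unique even though
  \<open>x\<close> is arbitrary; tables satisfy this condition.\<close>

definition checked :: "otm \<Rightarrow> lang" where
  "checked M = {x @ [SH] @ b |x b. SH \<notin> set b \<and> accepts_within M x b}"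

lemma checked_iff: "SH \<notin> set b \<Longrightarrow> x @ [SH] @ b \<in> checked M \<longleftrightarrow> accepts_within M x b"
  unfolding checked_def using last_SH_unique by blast

lemma checked_in_Pc:
  assumes M: "wf_otm M"
  shows "checked M \<in> Pc"
proof -
  define S where "S l = 2 * l + 10" for l :: nat
  define t where "t l = 8 * loop_time (S l) (S l) 1 + 4 * at_time (S l) + clock_time (S l) + 40" for l
  have poly: "poly_bounded t"
    unfolding t_def clock_time_def lookup_time_def S_def by (intro poly_bounded_intros)
  show ?thesis unfolding Pc_def
  proof (rule decider[OF wfc_check_prog[OF M] _ poly])
    fix w :: "sym list"
    let ?l = "length w" and ?z = "\<lambda>_. 0 :: nat" and ?S = "S (length w)"
    have 1: "execs {} (init_marks 6) (ini w) 1 (cfg (0,0,0) (inp w) ?z [0, 0, 0, 0, 0, 0] ?z 0)"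
      using execs_init_marks[of "{}" 6 w] by (simp add: numeral_eq_Suc)
    have 2: "execs {} (to_end 2) (cfg (0,0,0) (inp w) ?z [0, 0, 0, 0, 0, 0] ?z 0) (loop_time ?S ?S 1)
      (cfg (0,0,0) (inp w) ?z [0, 0, ?l, 0, 0, 0] ?z 0)"
      by (rule execs_to_end) (auto simp: S_def)
    have 3: "execs {} (Loop 2 (\<lambda>a0 a1 m b. a0 = 3 \<or> m 0) (\<lambda>a0 a1 b. (a0, a1, Lft, b, Stay)) Skip)
      (cfg (0,0,0) (inp w) ?z [0, 0, ?l, 0, 0, 0] ?z 0) (loop_time ?S ?S 1)
      (cfg (0,0,0) (inp w) ?z [0, 0, n, 0, 0, 0] ?z 0)"
      if n: "n \<le> ?l" "n = 0 \<or> inp w n = 3" "\<And>i. n < i \<Longrightarrow> inp w i \<noteq> 3" for n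
    proof -
      have "execs {} (Loop 2 (\<lambda>a0 a1 m b. a0 = 3 \<or> m 0) (\<lambda>a0 a1 b. (a0, a1, Lft, b, Stay)) Skip)
        (cfg (0,0,0) (inp w) ?z [0, 0, ?l - 0, 0, 0, 0] ?z 0) (loop_time ?S (?l - n) 1)
        (cfg (0,0,0) (inp w) ?z [0, 0, ?l - (?l - n), 0, 0, 0] ?z 0)"
        by (rule execs_Loop[where ps = "\<lambda>i. [0, 0, ?l - i, 0, 0, 0]" and q = "\<lambda>_. 0" and s = "\<lambda>_. 0"
            and ?t0.0 = "\<lambda>_. inp w" and ?t1.0 = "\<lambda>_. ?z" and u = "\<lambda>_. ?z" and k = "\<lambda>_. 0" and S = ?S])
          (use n in \<open>auto simp: marks_def S_def intro!: exI[of _ 1] execs_Skip\<close>)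
      moreover have "loop_time ?S (?l - n) 1 \<le> loop_time ?S ?S 1" by (intro loop_time_mono) (auto simp: S_def)
      ultimately show ?thesis using n(1) by (auto intro: execs_mono)
    qed
    let ?P = "At 2 (\<lambda>(q, f, s) a0 a1 m b. ((q, if a0 = 3 then 1 else 0, s), if a0 = 3 then 0 else a0, a1, Stay, b, Stay))"
    let ?C = "CondR (\<lambda>(q, f, s). f = 1) (clock_prog M) Skip"
    let ?T = "5 * loop_time ?S ?S 1 + 2 * at_time ?S + clock_time ?S + 20"
    have rest: "\<exists>s. execs {} (check_prog M) (ini w) (t ?l) s \<and> (w \<in> checked M \<longleftrightarrow> acc_reg (st_reg s))"
      if n: "n \<le> ?l" "n = 0 \<or> inp w n = 3" "\<And>i. n < i \<Longrightarrow> inp w i \<noteq> 3"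
        and P: "execs {} ?P (cfg (0,0,0) (inp w) ?z [0, 0, n, 0, 0, 0] ?z 0) (at_time ?S) s1"
        and C: "execs {} ?C s1 (?T + 1) s2" and acc: "w \<in> checked M \<longleftrightarrow> acc_reg (st_reg s2)" for n s1 s2
    proof -
      have "execs {} (check_prog M) (ini w) (t ?l) s2"
        unfolding check_prog_def
        by (rule execs_mono[OF execs_Seq[OF 1 execs_Seq[OF 2 execs_Seq[OF 3[OF n] execs_Seq[OF P C]]]]]) (simp_all add: t_def)
      then show ?thesis using acc by blast
    qed
    show "\<exists>s. execs {} (check_prog M) (ini w) (t ?l) s \<and> (w \<in> checked M \<longleftrightarrow> acc_reg (st_reg s))"
    proof (cases "SH \<in> set w")
      case True
      then obtain x b where w: "w = x @ [SH] @ b" and b: "SH \<notin> set b"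
        using split_list_last[OF True] unfolding append_Cons append_Nil by blast
      define n where "n = length x"
      have lw: "?l = n + 1 + length b" by (simp add: w n_def)
      have nl: "n \<le> ?l" "inp w n = 3" using lw by (simp_all add: inp_def) (simp add: w n_def)
      have i3: "inp w i \<noteq> 3" if ni: "n < i" for i
      proof -
        obtain j where j: "i = Suc (n + j)" using less_imp_Suc_add[OF ni] by blast
        have "w ! i = b ! j" by (simp add: w j n_def nth_append)
        moreover have "b ! j \<noteq> SH" if "j < length b" using b nth_mem[OF that] by metis
        ultimately show ?thesis using lw j by (auto simp: inp_def enc_simps)
      qed
      let ?t = "\<lambda>i. if i = n then 0 else inp (x @ [SH] @ b) i"
      have upd: "(inp w)(n := 0) = ?t" unfolding w fun_upd_def ..
      have P: "execs {} ?P (cfg (0,0,0) (inp w) ?z [0, 0, n, 0, 0, 0] ?z 0) (at_time ?S)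
        (cfg (0,1,0) ?t ?z [0, 0, n, 0, 0, 0] ?z 0)"
        by (rule execs_At_case) (use nl upd in \<open>simp_all add: S_def\<close>)
      have "2 * length b + n + 3 < ?S" by (simp add: S_def lw)
      from execs_clock_prog[OF M b this n_def, of "{}"]
      obtain s where s: "execs {} (clock_prog M) (cfg (0, 1, 0) ?t ?z [0, 0, n, 0, 0, 0] ?z 0) ?T s"
        "acc_reg (st_reg s) \<longleftrightarrow> accepts_within M x b" by blast
      have C: "execs {} ?C (cfg (0, 1, 0) ?t ?z [0, 0, n, 0, 0, 0] ?z 0) (?T + 1) s"
        by (rule execs_CondR) (use s(1) in simp_all)
      have acc: "w \<in> checked M \<longleftrightarrow> acc_reg (st_reg s)" unfolding w checked_iff[OF b] s(2) ..
      show ?thesis by (rule rest[OF nl(1) disjI2[OF nl(2)] _ P C acc]) (rule i3)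
    next
      case False
      have i3: "inp w i \<noteq> 3" for i
      proof (cases "i < length w")
        case True
        then have "w ! i \<noteq> SH" using False nth_mem[OF True] by metis
        then show ?thesis by (simp add: inp_def enc_simps)
      qed (simp add: inp_def)
      have P: "execs {} ?P (cfg (0,0,0) (inp w) ?z [0, 0, 0, 0, 0, 0] ?z 0) (at_time ?S)
        (cfg (0,0,0) (inp w) ?z [0, 0, 0, 0, 0, 0] ?z 0)"
        by (rule execs_At_case) (use i3 in \<open>auto simp: S_def\<close>)
      have C: "execs {} ?C (cfg (0,0,0) (inp w) ?z [0, 0, 0, 0, 0, 0] ?z 0) (?T + 1) (cfg (0,0,0) (inp w) ?z [0, 0, 0, 0, 0, 0] ?z 0)"
        by (rule execs_CondR) (auto intro!: execs_mono[OF execs_Skip])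
      have "w \<notin> checked M" using False by (auto simp: checked_def)
      then show ?thesis
        by (intro rest[OF _ _ _ P C]) (use i3 in \<open>auto simp: cfg_def\<close>)
    qed
  qed simp
qed

section \<open>A table as a truncated oracle\<close>

lemma SH_table: "SH \<notin> set (table U y)"
  by (auto simp: table_def)

lemma listed_table: "listed (table U y) = {unary m |m. m < y \<and> unary m \<in> U}"
  by (auto simp: listed_def table_def split: if_splits)

text \<open>Cell \<open>t\<close> of the query tape is still blank after \<open>t\<close> steps, so
  the word asked in step \<open>t + 1\<close> has length at most \<open>t < y\<close> and lies
  within the table. A word that is not unary belongs to neither language.\<close>

lemma run_listed:
  assumes "U \<subseteq> range unary" "t \<le> y"
  shows "run M (listed (table U y)) x t = run M U x t"
  using assms(2)
proof (induction t)
  case (Suc t)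
  let ?c = "run M U x t"
  have "tp2 ?c t = 0" by (rule run_bounds) simp
  then have "length (read_word (tp2 ?c)) \<le> t"
    by (simp add: read_word_def Least_le)
  then have "read_word (tp2 ?c) \<in> listed (table U y) \<longleftrightarrow> read_word (tp2 ?c) \<in> U"
    using assms(1) Suc.prems unfolding listed_table by (auto simp: unary_def)
  then show ?case using Suc by (simp add: run_Suc step_def)
qed (simp add: run_0)

text \<open>The coefficient 2 is needed because of \<open>0 ^ 0 = 1\<close>.\<close>

lemma pbound_le: "pbound k c n \<le> 2 * c * (n + 1) ^ k"
proof -
  have "c * n ^ k \<le> c * (n + 1) ^ k" by (intro mult_left_mono power_mono) auto
  moreover have "c * 1 \<le> c * (n + 1) ^ k" by (intro mult_left_mono one_le_power) auto
  moreover have "2 * c * (n + 1) ^ k = c * (n + 1) ^ k + c * (n + 1) ^ k" by (simp only: mult_2 add_mult_distrib)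
  ultimately show ?thesis unfolding pbound_def by linarith
qed

section \<open>The theorem\<close>

theorem theorem3:
  fixes B :: "sym list set set"
  shows "adv_poly Pc B = P_rel (Unary_part (P_rel B))"
proof (intro equalityI subsetI)
  fix L assume "L \<in> adv_poly Pc B"
  then obtain a Or T k c L' where Or: "Or \<in> B" and T: "wf_otm T"
    "\<And>n. halting T (run T Or (unary n) (pbound k c n))" "\<And>n. read_word (tp1 (run T Or (unary n) (pbound k c n))) = a n"
    and L': "L' \<in> Pc" "\<And>x. x \<in> L \<longleftrightarrow> x @ [SH] @ a (length x) \<in> L'"
    unfolding adv_poly_def by blast
  obtain M k' c' where M: "wf_otm M" "\<And>y. halting M (run M {} y (pbound k' c' (length y)))"
    "\<And>y. y \<in> L' \<longleftrightarrow> cstate (run M {} y (pbound k' c' (length y))) = q_acc M"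
    using L'(1) unfolding Pc_def P_orc_def by blast
  \<comment> \<open>\<open>T\<close> cannot write beyond its input length plus its running time, so
    its output ends there at the latest.\<close>
  have "length (a n) \<le> n + pbound k c n" for n
  proof -
    have "tp1 (run T Or (unary n) (pbound k c n)) (n + pbound k c n) = 0"
      by (rule run_bounds) (simp add: unary_def)
    then show ?thesis unfolding T(3)[symmetric] by (simp add: read_word_def Least_le)
  qed
  then have "L \<in> P_orc (bits a)"
    using M L'(2) by (intro main_in_P[of M k' c' a k c L]) auto
  moreover have "bits a \<in> Unary_part (P_rel B)"
    using Or bits_in_P[of T Or k c a] T bits_unary unfolding Unary_part_def P_rel_def by blast
  ultimately show "L \<in> P_rel (Unary_part (P_rel B))" unfolding P_rel_def by blast
next
  fix L assume "L \<in> P_rel (Unary_part (P_rel B))"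
  then obtain U Or where Or: "Or \<in> B" and U: "U \<in> P_orc Or" "U \<subseteq> range unary" and L: "L \<in> P_orc U"
    unfolding P_rel_def Unary_part_def by blast
  obtain N k c where N: "wf_otm N" "\<And>x. halting N (run N Or x (pbound k c (length x)))"
    "\<And>x. x \<in> U \<longleftrightarrow> cstate (run N Or x (pbound k c (length x))) = q_acc N"
    using U(1) unfolding P_orc_def by blast
  obtain M k' c' where M: "wf_otm M" "\<And>x. halting M (run M U x (pbound k' c' (length x)))"
    "\<And>x. x \<in> L \<longleftrightarrow> cstate (run M U x (pbound k' c' (length x))) = q_acc M"
    using L unfolding P_orc_def by blast
  \<comment> \<open>By \<open>pbound_le\<close> the table is at least as long as the running time of
    \<open>M\<close> on words of length \<open>n\<close>, so it serves as oracle and clock at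
    once.\<close>
  define a where "a n = table U (2 * c' * (n + 1) ^ k')" for n
  have "\<exists>T k d. wf_otm T \<and> (\<forall>n. halting T (run T Or (unary n) (pbound k d n)) \<and>
    read_word (tp1 (run T Or (unary n) (pbound k d n))) = a n)"
    unfolding a_def by (rule table_advice[OF N])
  moreover have "x \<in> L \<longleftrightarrow> x @ [SH] @ a (length x) \<in> checked M" for x
  proof -
    let ?y = "2 * c' * (length x + 1) ^ k'" and ?p = "pbound k' c' (length x)"
    have "x @ [SH] @ a (length x) \<in> checked M \<longleftrightarrow> (\<exists>t\<le>?y. cstate (run M (listed (table U ?y)) x t) = q_acc M)"
      unfolding a_def checked_iff[OF SH_table] accepts_within_def by (simp add: table_def)
    also have "\<dots> \<longleftrightarrow> (\<exists>t\<le>?y. cstate (run M U x t) = q_acc M)"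
      using run_listed[OF U(2), of _ ?y M x] by auto
    also have "\<dots> \<longleftrightarrow> cstate (run M U x ?p) = q_acc M"
    \<comment> \<open>Acceptance at some time and halting at time \<open>?p\<close> are compared at
      the later of the two, where the run is stationary from both. Conversely \<open>?p\<close>
      itself is a time within the table length.\<close>
    proof
      assume "\<exists>t\<le>?y. cstate (run M U x t) = q_acc M"
      then obtain t where t: "cstate (run M U x t) = q_acc M" by blast
      then have "run M U x (max t ?p) = run M U x t" by (intro run_halted) (auto simp: halting_def)
      moreover have "run M U x (max t ?p) = run M U x ?p" using M(2) by (intro run_halted) auto
      ultimately show "cstate (run M U x ?p) = q_acc M" using t by simp
    qed (use pbound_le in blast)
    finally show ?thesis using M(3) by blast
  qed
  ultimately show "L \<in> adv_poly Pc B"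
    unfolding adv_poly_def using Or checked_in_Pc[OF M(1)] by blast
qed

end
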